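(* There exists a numerical (absolute) constant $C>0$ such that the following holds. Let $0<\sigma'<\sigma<1/10$. Let $\omega$ be a positive, measurable, essentially bounded function on $\mathbb R$ with $\mathcal L(\omega)>-\infty$, and set $\Omega=-\log\omega$. Assume that $H(\Omega)$ is differentiable, that $H(\Omega)'$ is essentially bounded, and that $$\|H(\Omega)'\|_{L^\infty}\leq\pi\sigma' .$$ Then there is $\psi\in L^2(\mathbb R)$ with $$\operatorname{supp}\psi\subset[0,\sigma],\qquad |\mathcal F\psi|\leq\omega \quad\text{a.e. on }\mathbb R,$$ and, for a.e. $x$ in at least one of the two intervals $(-1,-1/2)$ or $(1/2,1)$, $$|\mathcal F\psi(x)|\geq C(\sigma-\sigma')^6\omega(x).$$
   Context: The Fourier transform is $\mathcal Ff(\xi)=\int_{\mathbb R}e^{-2\pi i x\xi}f(x)\,dx$. For a positive bounded measurable function $\omega$ on $\mathbb R$, the logarithmic integral is $\mathcal L(\omega)=\int_{\mathbb R}\frac{\log\omega(x)}{1+x^2}\,dx\in[-\infty,+\infty)$; it is $>-\infty$ if and only if $\log\omega\in L^1(\mathbb R,\langle x\rangle^{-2}dx)$, where $\langle x\rangle=\sqrt{1+x^2}$. The modified Hilbert transform is defined, for $f\in L^1(\mathbb R,\langle x\rangle^{-2}dx)$, by $$H(f)(x)=\frac1\pi\,\mathrm{p.v.}\int_{\mathbb R}f(y)\left(\frac{1}{x-y}+\frac{y}{y^2+1}\right)dy ,$$ the principal value existing for a.e. $x$. For $\psi\in L^2(\mathbb R)$, $\operatorname{supp}\psi$ denotes the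 essential support. *)

theory Defs
  imports "HOL-Analysis.Analysis" "HOL-Probability.Essential_Supremum"
begin

definition Linf_norm :: "(real \<Rightarrow> real) \<Rightarrow> ereal" where
  "Linf_norm f = esssup lebesgue (\<lambda>x. ereal \<bar>f x\<bar>)"

definition ess_bounded :: "(real \<Rightarrow> real) \<Rightarrow> bool" where
  "ess_bounded f \<longleftrightarrow> f \<in> borel_measurable lebesgue \<and> Linf_norm f < \<infinity>"

definition L2_fun :: "(real \<Rightarrow> complex) \<Rightarrow> bool" where
  "L2_fun f \<longleftrightarrow> f \<in> borel_measurable lebesgue \<and> integrable lebesgue (\<lambda>x. (norm (f x))\<^sup>2)"

text \<open>The essential support: the complement of the largest open set on which the
  function vanishes almost everywhere.\<close>

definition ess_support :: "(real \<Rightarrow> complex) \<Rightarrow> real set" where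
  "ess_support f = - \<Union>{U. open U \<and> (AE x in lebesgue. x \<in> U \<longrightarrow> f x = 0)}"

text \<open>The integral formula is meaningful for integrable functions, in particular for
  square-integrable functions with bounded essential support, where it agrees with the
  Plancherel extension.\<close>

definition fourier :: "(real \<Rightarrow> complex) \<Rightarrow> real \<Rightarrow> complex" where
  "fourier f \<xi> = (LINT x|lebesgue. exp (- 2 * complex_of_real pi * \<i> * complex_of_real (x * \<xi>)) * f x)"

text \<open>The Bochner integral is \<open>0\<close> on non-integrable functions, so the logarithmic integral,
  which may be \<open>-\<infinity>\<close>, is the difference of the integrals of the positive and the negative
  part. For a bounded measurable \<open>\<omega>\<close> the first of these is finite.\<close>

definition log_integral :: "(real \<Rightarrow> real) \<Rightarrow> ereal" where
  "log_integral \<omega> =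
     enn2ereal (\<integral>\<^sup>+ x. ennreal (ln (\<omega> x) / (1 + x\<^sup>2)) \<partial>lebesgue)
   - enn2ereal (\<integral>\<^sup>+ x. ennreal (- (ln (\<omega> x) / (1 + x\<^sup>2))) \<partial>lebesgue)"

text \<open>For \<open>f\<close> in \<open>L\<^sup>1(\<real>, (1 + x\<^sup>2)\<^sup>-\<^sup>1 dx)\<close> the integrand below is integrable away
  from \<open>y = x\<close>, because the kernel is \<open>O(y\<^sup>-\<^sup>2)\<close> at infinity; only the singularity at
  \<open>y = x\<close> needs a principal value.\<close>

definition hilbert_trunc :: "(real \<Rightarrow> real) \<Rightarrow> real \<Rightarrow> real \<Rightarrow> real" where
  "hilbert_trunc f \<epsilon> x =
     1 / pi * (LINT y:{y. \<bar>x - y\<bar> > \<epsilon>}|lebesgue. f y * (1 / (x - y) + y / (y\<^sup>2 + 1)))"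

text \<open>The principal value exists only almost everywhere, so \<open>H(f)\<close> is determined up to null
  sets: \<open>is_modified_hilbert f h\<close> says that \<open>h\<close> is a representative of \<open>H(f)\<close>.
  Accordingly ``\<open>H(f)\<close> is differentiable'' means that some representative is differentiable
  at every point; such a representative is unique, by continuity.\<close>

definition is_modified_hilbert :: "(real \<Rightarrow> real) \<Rightarrow> (real \<Rightarrow> real) \<Rightarrow> bool" where
  "is_modified_hilbert f h \<longleftrightarrow>
     integrable lebesgue (\<lambda>x. f x / (1 + x\<^sup>2)) \<and>
     (AE x in lebesgue. ((\<lambda>\<epsilon>. hilbert_trunc f \<epsilon> x) \<longlongrightarrow> h x) (at_right 0))"

end

theory Submission
  imports Defs "HOL-Probability.Sinc_Integral" "HOL-Complex_Analysis.Cauchy_Integral_Theorem"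
begin

text \<open>
  With \<open>\<Omega> = - ln \<omega>\<close>, the outer function \<open>F\<close> with \<open>|F| = \<omega>\<close> has boundary values
  \<open>\<omega> exp (- \<i> h)\<close>. Put \<open>\<sigma>\<^sub>1 = (\<sigma> + \<sigma>') / 2\<close> and \<open>\<theta> x = h x + \<pi> \<sigma>\<^sub>1 x - c\<close>; this phase is
  strictly increasing and Lipschitz. Reducing \<open>\<theta>\<close> modulo \<open>\<pi>\<close> to \<open>[- \<pi>/2, \<pi>/2]\<close> gives a
  sawtooth \<open>s\<close>, and the analytic function \<open>Q\<close> on the upper half-plane whose argument on the
  real line is \<open>s\<close> makes \<open>F Q\<close> equal to a real function times \<open>exp (\<i> (\<pi> \<sigma>\<^sub>1 x - c))\<close>. Hence
  \<open>F Q exp (- \<i> \<pi> (\<sigma> + \<sigma>\<^sub>1) x)\<close>, once multiplied by a sixth power of a sinc function of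
  exponential type \<open>\<pi> (\<sigma> - \<sigma>\<^sub>1)\<close>, is the Fourier transform of a function supported in
  \<open>[0, \<sigma>]\<close>: one half-line is excluded by shifting the contour to \<open>\<i> \<infinity>\<close>, the other one by
  complex conjugation. Since \<open>s\<close> only jumps downwards, \<open>|Q|\<close> is at most a multiple of
  \<open>(1 + x\<^sup>2)\<^sup>2\<close>, which the sinc factor absorbs at the cost of \<open>(\<sigma> - \<sigma>')\<^sup>6\<close>; normalising
  \<open>\<theta> (3/4) = 0\<close> keeps the jumps, where \<open>Q\<close> vanishes, away from \<open>(1/2, 1)\<close>.
\<close>

section \<open>Poisson averages of weighted integrable functions\<close>

text \<open>The gap \<sigma> - \<sigma>' is spent twice. One half makes the slope \<pi> \<sigma>1
  beat the Lipschitz constant \<pi> \<sigma>' of h, so that \<theta> increases strictly and its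
  reduction modulo \<pi> can only jump downwards; ln |Q|, the conjugate function of the sawtooth up
  to sign, then drops to minus infinity at a jump instead of rising to plus infinity. The other half
  is the exponential type of the sinc factor. The exponent six comes from the growth bound: (1 +
  x^2)^2 for |Q| and one more factor 1 + x^2 for integrability make three such factors, and each
  costs two sinc factors. The analytic obstacle is that \<Omega> lies only in a weighted L1 space
  and that its Hilbert transform is a principal value almost everywhere. Maximal functions and
  nontangential limits are avoided: an L1 estimate for Poisson averages gives a.e. convergence along
  one sequence of heights, and one sequence suffices when contours are moved by dominated
  convergence. The sawtooth data converge along every sequence, so they can share the one chosen for
  \<Omega>.\<close>

lemma has_bochner_integral_Cauchy_density:
  "has_bochner_integral lborel (\<lambda>t::real. 1 / (1 + t\<^sup>2)) pi"
  using integrable_inverse_1_plus_square LBINT_inverse_1_plus_square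
  by (simp add: has_bochner_integral_iff set_integrable_def interval_lebesgue_integral_def
      set_lebesgue_integral_def inverse_eq_divide)

lemma nn_integral_Cauchy_density:
  "(\<integral>\<^sup>+t. ennreal (1 / (1 + t\<^sup>2)) \<partial>lborel) = ennreal pi"
  using has_bochner_integral_Cauchy_density
  by (subst nn_integral_eq_integral) (auto simp: has_bochner_integral_iff)

lemma affine_Cauchy_density:
  fixes v x y :: real
  assumes "y > 0"
  shows "y / ((x + y * v - x)\<^sup>2 + y\<^sup>2) = (1 / y) * (1 / (1 + v\<^sup>2))"
proof -
  have "(x + y * v - x)\<^sup>2 + y\<^sup>2 = y * y * (1 + v\<^sup>2)"
    by (simp add: algebra_simps power2_eq_square)
  then show ?thesis using assms by simp
qed

lemma nn_integral_Poisson_affine: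
  fixes x y :: real and f :: "real \<Rightarrow> ennreal"
  assumes y: "y > 0" and [measurable]: "f \<in> borel_measurable borel"
  shows "(\<integral>\<^sup>+t. f t * ennreal (y / ((t - x)\<^sup>2 + y\<^sup>2)) \<partial>lborel)
       = (\<integral>\<^sup>+v. f (x + y * v) * ennreal (1 / (1 + v\<^sup>2)) \<partial>lborel)"
proof -
  have "(\<integral>\<^sup>+t. f t * ennreal (y / ((t - x)\<^sup>2 + y\<^sup>2)) \<partial>lborel)
      = ennreal y * (\<integral>\<^sup>+v. f (x + y * v) * ennreal (y / ((x + y * v - x)\<^sup>2 + y\<^sup>2)) \<partial>lborel)"
    using y by (subst nn_integral_real_affine[where c=y and t=x]) auto
  also have "\<dots> = (\<integral>\<^sup>+v. ennreal y * (f (x + y * v) * ennreal (y / ((x + y * v - x)\<^sup>2 + y\<^sup>2))) \<partial>lborel)"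
    by (rule nn_integral_cmult[symmetric]) measurable
  also have "\<dots> = (\<integral>\<^sup>+v. f (x + y * v) * ennreal (1 / (1 + v\<^sup>2)) \<partial>lborel)"
  proof (rule nn_integral_cong)
    fix v :: real
    have "ennreal y * ennreal (y / ((x + y * v - x)\<^sup>2 + y\<^sup>2)) = ennreal (1 / (1 + v\<^sup>2))"
      unfolding affine_Cauchy_density[OF y] using y
      by (subst ennreal_mult[symmetric]) auto
    then show "ennreal y * (f (x + y * v) * ennreal (y / ((x + y * v - x)\<^sup>2 + y\<^sup>2)))
        = f (x + y * v) * ennreal (1 / (1 + v\<^sup>2))"
      by (metis mult.left_commute)
  qed
  finally show ?thesis .
qed

lemma nn_integral_Poisson_kernel:
  fixes x y :: real
  assumes "y > 0"
  shows "(\<integral>\<^sup>+t. ennreal (y / ((t - x)\<^sup>2 + y\<^sup>2)) \<partial>lborel) = ennreal pi"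
  using nn_integral_Poisson_affine[OF assms, of "\<lambda>_. 1" x] nn_integral_Cauchy_density by simp

lemma has_bochner_integral_Poisson_kernel:
  fixes x y :: real
  assumes "y > 0"
  shows "has_bochner_integral lborel (\<lambda>t. y / ((t - x)\<^sup>2 + y\<^sup>2)) pi"
  by (rule has_bochner_integral_nn_integral)
    (use assms nn_integral_Poisson_kernel[OF assms] in auto)

section \<open>Continuity of translations in L1\<close>

lemma nn_integral_translate:
  fixes f :: "real \<Rightarrow> ennreal"
  assumes "f \<in> borel_measurable borel"
  shows "(\<integral>\<^sup>+x. f (x + h) \<partial>lborel) = (\<integral>\<^sup>+x. f x \<partial>lborel)"
  using nn_integral_real_affine[OF assms, of 1 h] by (simp add: add.commute)

text \<open>Squeeze the set between a compact \<open>K\<close> and an open \<open>U\<close>. A short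
  shift keeps \<open>K\<close> inside \<open>U\<close>, so wherever the two indicators differ, the
  point or its translate lies in \<open>A - K\<close> or in \<open>U - A\<close>: four errors, each
  below e/4.\<close>

lemma emeasure_translate_symdiff:
  fixes A :: "real set"
  assumes A: "A \<in> sets borel" and fin: "emeasure lborel A < \<infinity>" and e: "e > (0::real)"
  shows "\<exists>d>0. \<forall>h. \<bar>h\<bar> < d \<longrightarrow>
    (\<integral>\<^sup>+x. ennreal \<bar>indicator A (x + h) - indicator A x\<bar> \<partial>lborel) \<le> ennreal e"
proof -
  obtain U where U: "open U" "A \<subseteq> U" "emeasure lborel (U - A) < ennreal (e/4)"
    using outer_regular_lborel[OF A, of "e/4"] e by auto
  have [measurable]: "A \<in> sets borel" "U \<in> sets borel" using A U by auto
  obtain K where K: "compact K" "K \<subseteq> A" "emeasure lborel (A - K) < ennreal (e/4)"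
  proof -
    \<comment> \<open>Inner regularity is a fact about finite measures, so Lebesgue measure is first
      restricted to \<open>A\<close>.\<close>
    define M where "M = density lborel (indicator A :: real \<Rightarrow> ennreal)"
    have M: "emeasure M B = emeasure lborel (A \<inter> B)" if "B \<in> sets borel" for B
      using that A unfolding M_def by (subst emeasure_density) (auto simp flip: indicator_inter_arith)
    have sup: "emeasure M A = (SUP K \<in> {K. K \<subseteq> A \<and> compact K}. emeasure M K)"
      by (rule inner_regular) (use A fin M[of UNIV] in \<open>auto simp: M_def\<close>)
    have "\<exists>K\<in>{K. K \<subseteq> A \<and> compact K}. emeasure M A < emeasure M K + ennreal (e/4)"
      by (rule SUP_approx_ennreal[OF _ _ sup]) (use e fin M[OF A] in \<open>auto simp: less_top\<close>)
    then obtain K where K: "K \<subseteq> A" "compact K" "emeasure M A < emeasure M K + ennreal (e/4)"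
      by auto
    have KA: "A \<inter> K = K" and [measurable]: "K \<in> sets borel"
      using K by (auto intro: borel_compact)
    have Kfin: "emeasure lborel K < \<infinity>"
      using K A fin emeasure_mono[of K A lborel] by (auto simp: less_top[symmetric] top_unique)
    have "emeasure lborel (A - K) = emeasure lborel A - emeasure lborel K"
      using K A Kfin by (intro emeasure_Diff) auto
    also have "\<dots> < ennreal (e/4)"
      using K(3) M[of A] M[of K] A KA Kfin emeasure_mono[of K A lborel] K(1)
      by (subst minus_less_iff_ennreal) (auto simp: add.commute)
    finally show ?thesis using that K by blast
  qed
  have [measurable]: "K \<in> sets borel" using K by (auto intro: borel_compact)
  obtain d where d: "d > 0" "(\<Union>x\<in>K. ball x d) \<subseteq> U"
    using compact_subset_open_imp_ball_epsilon_subset[of K U] K U by blast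
  show ?thesis
  proof (intro exI[of _ d] conjI allI impI d)
    fix h :: real assume h: "\<bar>h\<bar> < d"
    have KU: "x + h \<in> U" "x - h \<in> U" if "x \<in> K" for x
    proof -
      have "x + h \<in> ball x d" "x - h \<in> ball x d" using h by (auto simp: dist_real_def)
      then show "x + h \<in> U" "x - h \<in> U" using d(2) that by blast+
    qed
    have KU': "x \<in> U" if "x + h \<in> K" for x
      using KU(2)[OF that] by simp
    have "(\<integral>\<^sup>+x. ennreal \<bar>indicator A (x + h) - indicator A x\<bar> \<partial>lborel)
      \<le> (\<integral>\<^sup>+x. (indicator (A - K) (x + h) + indicator (U - A) x)
            + (indicator (A - K) x + indicator (U - A) (x + h)) \<partial>lborel)"
      using KU KU' by (intro nn_integral_mono) (auto simp: indicator_def)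
    also have "\<dots> = (emeasure lborel (A - K) + emeasure lborel (U - A))
        + (emeasure lborel (A - K) + emeasure lborel (U - A))"
      by (simp add: nn_integral_add nn_integral_translate[of "indicator (A - K)"]
          nn_integral_translate[of "indicator (U - A)"])
    also have "\<dots> \<le> (ennreal (e/4) + ennreal (e/4)) + (ennreal (e/4) + ennreal (e/4))"
      using U(3) K(3) by (intro add_mono) (auto intro: less_imp_le)
    also have "\<dots> = ennreal e"
      using e by (simp flip: ennreal_plus)
    finally show "(\<integral>\<^sup>+x. ennreal \<bar>indicator A (x + h) - indicator A x\<bar> \<partial>lborel) \<le> ennreal e" .
  qed
qed

text \<open>Induction over integrable functions, starting from the indicator case. In the limit case
  the approximant is shifted in place of \<open>f\<close>; the two approximation errors agree by
  translation invariance.\<close>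

lemma nn_integral_translate_diff_le:
  fixes f :: "real \<Rightarrow> 'b::{banach, second_countable_topology}"
  assumes "integrable lborel f" and "e > (0::real)"
  shows "\<exists>d>0. \<forall>h. \<bar>h\<bar> < d \<longrightarrow>
    (\<integral>\<^sup>+x. ennreal (norm (f (x + h) - f x)) \<partial>lborel) \<le> ennreal e"
  using assms
proof (induction arbitrary: e rule: integrable_induct)
  case (base A c)
  define e' where "e' = e / (norm c + 1)"
  have "e' > 0" using base by (auto simp: e'_def add_nonneg_pos)
  then obtain d where d: "d > 0" "\<And>h. \<bar>h\<bar> < d \<Longrightarrow>
    (\<integral>\<^sup>+x. ennreal \<bar>indicator A (x + h) - indicator A x\<bar> \<partial>lborel) \<le> ennreal e'"
    using emeasure_translate_symdiff[of A e'] base by auto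
  have [measurable]: "A \<in> sets borel" using base by simp
  show ?case
  proof (intro exI[of _ d] conjI allI impI d)
    fix h :: real assume h: "\<bar>h\<bar> < d"
    have "(\<integral>\<^sup>+x. ennreal (norm (indicator A (x + h) *\<^sub>R c - indicator A x *\<^sub>R c)) \<partial>lborel)
        = (\<integral>\<^sup>+x. ennreal (norm c) * ennreal \<bar>indicator A (x + h) - indicator A x\<bar> \<partial>lborel)"
      by (intro nn_integral_cong)
        (simp flip: scaleR_diff_left ennreal_mult add: mult.commute)
    also have "\<dots> = ennreal (norm c) * (\<integral>\<^sup>+x. ennreal \<bar>indicator A (x + h) - indicator A x\<bar> \<partial>lborel)"
      by (rule nn_integral_cmult) measurable
    also have "\<dots> \<le> ennreal (norm c) * ennreal e'"
      by (intro mult_left_mono d(2) h) auto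
    also have "\<dots> = ennreal (norm c * e')"
      using \<open>e' > 0\<close> by (simp add: ennreal_mult)
    also have "norm c * e' \<le> e"
      using base(3) unfolding e'_def
      by (simp add: divide_simps add_nonneg_pos algebra_simps) (use norm_ge_zero[of c] in linarith)
    finally show "(\<integral>\<^sup>+x. ennreal (norm (indicator A (x + h) *\<^sub>R c - indicator A x *\<^sub>R c)) \<partial>lborel) \<le> ennreal e"
      by (simp add: ennreal_leI)
  qed
next
  case (add f g)
  have [measurable]: "f \<in> borel_measurable borel" "g \<in> borel_measurable borel"
    using add.hyps by auto
  obtain d1 where d1: "d1 > 0" "\<And>h. \<bar>h\<bar> < d1 \<Longrightarrow>
      (\<integral>\<^sup>+x. ennreal (norm (f (x + h) - f x)) \<partial>lborel) \<le> ennreal (e/2)"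
    using add.IH(1)[of "e/2"] add.prems by auto
  obtain d2 where d2: "d2 > 0" "\<And>h. \<bar>h\<bar> < d2 \<Longrightarrow>
      (\<integral>\<^sup>+x. ennreal (norm (g (x + h) - g x)) \<partial>lborel) \<le> ennreal (e/2)"
    using add.IH(2)[of "e/2"] add.prems by auto
  show ?case
  proof (intro exI[of _ "min d1 d2"] conjI allI impI)
    fix h :: real assume h: "\<bar>h\<bar> < min d1 d2"
    have "(\<integral>\<^sup>+x. ennreal (norm (f (x + h) + g (x + h) - (f x + g x))) \<partial>lborel)
        \<le> (\<integral>\<^sup>+x. ennreal (norm (f (x + h) - f x)) + ennreal (norm (g (x + h) - g x)) \<partial>lborel)"
      by (intro nn_integral_mono)
        (simp flip: ennreal_plus add: ennreal_leI norm_diff_triangle_ineq)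
    also have "\<dots> = (\<integral>\<^sup>+x. ennreal (norm (f (x + h) - f x)) \<partial>lborel)
        + (\<integral>\<^sup>+x. ennreal (norm (g (x + h) - g x)) \<partial>lborel)"
      by (rule nn_integral_add) measurable
    also have "\<dots> \<le> ennreal (e/2) + ennreal (e/2)"
      using h by (intro add_mono d1 d2) auto
    also have "\<dots> = ennreal e"
      using add.prems by (simp flip: ennreal_plus)
    finally show "(\<integral>\<^sup>+x. ennreal (norm (f (x + h) + g (x + h) - (f x + g x))) \<partial>lborel) \<le> ennreal e" .
  qed (use d1 d2 in auto)
next
  case (lim f s)
  have [measurable]: "f \<in> borel_measurable borel" "\<And>i. s i \<in> borel_measurable borel"
    using lim.hyps by auto
  have "(\<lambda>i. \<integral>\<^sup>+x. ennreal (norm (f x - s i x)) \<partial>lborel) \<longlonglongrightarrow> 0"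
    by (rule nn_integral_dominated_convergence_norm[where w="\<lambda>x. 2 * norm (f x)"])
      (use lim.hyps in \<open>auto simp: integrable_iff_bounded ennreal_mult nn_integral_cmult ennreal_mult_less_top\<close>)
  then have "eventually (\<lambda>i. (\<integral>\<^sup>+x. ennreal (norm (f x - s i x)) \<partial>lborel) < ennreal (e/4)) sequentially"
    using lim.prems by (intro order_tendstoD) auto
  then obtain i where i: "(\<integral>\<^sup>+x. ennreal (norm (f x - s i x)) \<partial>lborel) < ennreal (e/4)"
    by (auto simp: eventually_sequentially)
  obtain d where d: "d > 0" "\<And>h. \<bar>h\<bar> < d \<Longrightarrow>
      (\<integral>\<^sup>+x. ennreal (norm (s i (x + h) - s i x)) \<partial>lborel) \<le> ennreal (e/2)"
    using lim.IH[of "e/2" i] lim.prems by auto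
  show ?case
  proof (intro exI[of _ d] conjI allI impI d)
    fix h :: real assume h: "\<bar>h\<bar> < d"
    have "norm (f (x + h) - f x) \<le> norm (f (x + h) - s i (x + h)) + norm (f x - s i x)
        + norm (s i (x + h) - s i x)" for x
      by norm
    then have "(\<integral>\<^sup>+x. ennreal (norm (f (x + h) - f x)) \<partial>lborel)
        \<le> (\<integral>\<^sup>+x. (ennreal (norm (f (x + h) - s i (x + h))) + ennreal (norm (f x - s i x)))
            + ennreal (norm (s i (x + h) - s i x)) \<partial>lborel)"
      by (intro nn_integral_mono) (simp flip: ennreal_plus add: ennreal_leI)
    also have "\<dots> = (\<integral>\<^sup>+x. ennreal (norm (f (x + h) - s i (x + h))) \<partial>lborel)
        + (\<integral>\<^sup>+x. ennreal (norm (f x - s i x)) \<partial>lborel)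
        + (\<integral>\<^sup>+x. ennreal (norm (s i (x + h) - s i x)) \<partial>lborel)"
      by (subst nn_integral_add, measurable, subst nn_integral_add) measurable
    also have "(\<integral>\<^sup>+x. ennreal (norm (f (x + h) - s i (x + h))) \<partial>lborel)
        = (\<integral>\<^sup>+x. ennreal (norm (f x - s i x)) \<partial>lborel)"
      by (rule nn_integral_translate[of "\<lambda>x. ennreal (norm (f x - s i x))"]) measurable
    also have "(\<integral>\<^sup>+x. ennreal (norm (f x - s i x)) \<partial>lborel)
        + (\<integral>\<^sup>+x. ennreal (norm (f x - s i x)) \<partial>lborel)
        + (\<integral>\<^sup>+x. ennreal (norm (s i (x + h) - s i x)) \<partial>lborel)
        \<le> (ennreal (e/4) + ennreal (e/4)) + ennreal (e/2)"
      using h i by (intro add_mono d) auto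
    also have "\<dots> = ennreal e"
      using lim.prems by (simp flip: ennreal_plus)
    finally show "(\<integral>\<^sup>+x. ennreal (norm (f (x + h) - f x)) \<partial>lborel) \<le> ennreal e" .
  qed
qed

text \<open>This makes averaging with the Poisson kernel bounded on \<open>L\<^sup>1((1 + x\<^sup>2)\<^sup>-\<^sup>1 dx)\<close>,
  whose elements need not be integrable.\<close>

lemma Poisson_kernel_weight_le:
  fixes t y :: real
  assumes y: "0 < y" "y \<le> 1"
  shows "(\<integral>\<^sup>+x. ennreal (y / ((t - x)\<^sup>2 + y\<^sup>2)) * ennreal (1 / (1 + x\<^sup>2)) \<partial>lborel)
    \<le> ennreal (4 * pi) * ennreal (1 / (1 + t\<^sup>2))"
proof -
  \<comment> \<open>This rests on 1 + t^2 \<le> 2 (1 + x^2) + 2 (t - x)^2 and y \<le> 1: the product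
    of two kernels is bounded by a sum of single kernels, each of integral \<pi>.\<close>
  have pt: "y / ((t - x)\<^sup>2 + y\<^sup>2) * (1 / (1 + x\<^sup>2))
      \<le> 2 * (1 / (1 + t\<^sup>2)) * (y / ((x - t)\<^sup>2 + y\<^sup>2) + 1 / (1 + x\<^sup>2))" for x
  proof -
    have D: "(t - x)\<^sup>2 + y\<^sup>2 > 0" using y by (simp add: add_nonneg_pos)
    have X: "1 + x\<^sup>2 > 0" "1 + t\<^sup>2 > 0" by (auto simp: add_pos_nonneg)
    have "1 + t\<^sup>2 \<le> 2 * (1 + x\<^sup>2) + 2 * (t - x)\<^sup>2"
      using zero_le_power2[of "2 * x - t"] by (simp add: power2_eq_square algebra_simps)
    then have "y * (1 + t\<^sup>2) \<le> y * (2 * (1 + x\<^sup>2) + 2 * (t - x)\<^sup>2)"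
      using y by (intro mult_left_mono) auto
    also have "\<dots> \<le> 2 * (y * (1 + x\<^sup>2) + ((t - x)\<^sup>2 + y\<^sup>2))"
    proof -
      have "y * (2 * X + 2 * q) \<le> 2 * (y * X + (q + y\<^sup>2))" if "q \<ge> 0" for q X :: real
      proof -
        have "y * (2 * X + 2 * q) = 2 * (y * X) + 2 * (y * q)" by (simp add: algebra_simps)
        also have "\<dots> \<le> 2 * (y * X) + 2 * q"
          using mult_right_mono[of y 1 q] that y by (intro add_left_mono mult_left_mono) auto
        also have "\<dots> \<le> 2 * (y * X + (q + y\<^sup>2))" by simp
        finally show ?thesis .
      qed
      from this[of "(t - x)\<^sup>2" "1 + x\<^sup>2"] show ?thesis by simp
    qed
    finally have "y * (1 + t\<^sup>2) \<le> 2 * (y * (1 + x\<^sup>2) + ((t - x)\<^sup>2 + y\<^sup>2))" .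
    then have "y * (1 + t\<^sup>2) / (((t - x)\<^sup>2 + y\<^sup>2) * (1 + x\<^sup>2) * (1 + t\<^sup>2))
        \<le> 2 * (y * (1 + x\<^sup>2) + ((t - x)\<^sup>2 + y\<^sup>2)) / (((t - x)\<^sup>2 + y\<^sup>2) * (1 + x\<^sup>2) * (1 + t\<^sup>2))"
      using D X by (intro divide_right_mono) auto
    also have "y * (1 + t\<^sup>2) / (((t - x)\<^sup>2 + y\<^sup>2) * (1 + x\<^sup>2) * (1 + t\<^sup>2))
        = y / ((t - x)\<^sup>2 + y\<^sup>2) * (1 / (1 + x\<^sup>2))"
      using D X by simp
    also have "2 * (y * (1 + x\<^sup>2) + ((t - x)\<^sup>2 + y\<^sup>2)) / (((t - x)\<^sup>2 + y\<^sup>2) * (1 + x\<^sup>2) * (1 + t\<^sup>2))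
        = 2 * (1 / (1 + t\<^sup>2)) * (y / ((t - x)\<^sup>2 + y\<^sup>2) + 1 / (1 + x\<^sup>2))"
      using D X y by (simp add: divide_simps)
    finally show ?thesis by (simp add: power2_commute)
  qed
  have "(\<integral>\<^sup>+x. ennreal (y / ((t - x)\<^sup>2 + y\<^sup>2)) * ennreal (1 / (1 + x\<^sup>2)) \<partial>lborel)
    \<le> (\<integral>\<^sup>+x. ennreal (2 * (1 / (1 + t\<^sup>2))) * (ennreal (y / ((x - t)\<^sup>2 + y\<^sup>2)) + ennreal (1 / (1 + x\<^sup>2))) \<partial>lborel)"
  proof (rule nn_integral_mono)
    fix x
    have "ennreal (y / ((t - x)\<^sup>2 + y\<^sup>2)) * ennreal (1 / (1 + x\<^sup>2))
        = ennreal (y / ((t - x)\<^sup>2 + y\<^sup>2) * (1 / (1 + x\<^sup>2)))"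
      using y by (subst ennreal_mult) auto
    also have "\<dots> \<le> ennreal (2 * (1 / (1 + t\<^sup>2)) * (y / ((x - t)\<^sup>2 + y\<^sup>2) + 1 / (1 + x\<^sup>2)))"
      by (rule ennreal_leI[OF pt])
    also have "\<dots> = ennreal (2 * (1 / (1 + t\<^sup>2))) * (ennreal (y / ((x - t)\<^sup>2 + y\<^sup>2)) + ennreal (1 / (1 + x\<^sup>2)))"
      using y by (subst ennreal_mult, simp, simp, subst ennreal_plus) auto
    finally show "ennreal (y / ((t - x)\<^sup>2 + y\<^sup>2)) * ennreal (1 / (1 + x\<^sup>2)) \<le> \<dots>" .
  qed
  also have "\<dots> = ennreal (2 * (1 / (1 + t\<^sup>2))) * (ennreal pi + ennreal pi)"
    using y by (simp add: nn_integral_cmult nn_integral_add nn_integral_Poisson_kernel nn_integral_Cauchy_density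
      del: ennreal_plus)
  also have "\<dots> = ennreal (4 * pi) * ennreal (1 / (1 + t\<^sup>2))"
    by (simp flip: ennreal_plus ennreal_mult)
  finally show ?thesis .
qed

section \<open>Mean oscillation against the Poisson kernel\<close>

lemma nn_integral_translate_diff_bound:
  fixes u :: "real \<Rightarrow> 'b::{banach, second_countable_topology}"
  assumes [measurable]: "u \<in> borel_measurable borel"
  shows "(\<integral>\<^sup>+x. ennreal (norm (u (x + h) - u x)) \<partial>lborel)
    \<le> 2 * (\<integral>\<^sup>+x. ennreal (norm (u x)) \<partial>lborel)"
proof -
  have "(\<integral>\<^sup>+x. ennreal (norm (u (x + h) - u x)) \<partial>lborel)
      \<le> (\<integral>\<^sup>+x. ennreal (norm (u (x + h))) + ennreal (norm (u x)) \<partial>lborel)"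
    by (intro nn_integral_mono) (simp flip: ennreal_plus add: ennreal_leI norm_triangle_ineq4)
  also have "\<dots> = (\<integral>\<^sup>+x. ennreal (norm (u (x + h))) \<partial>lborel) + (\<integral>\<^sup>+x. ennreal (norm (u x)) \<partial>lborel)"
    by (rule nn_integral_add) measurable
  also have "(\<integral>\<^sup>+x. ennreal (norm (u (x + h))) \<partial>lborel) = (\<integral>\<^sup>+x. ennreal (norm (u x)) \<partial>lborel)"
    by (rule nn_integral_translate[of "\<lambda>x. ennreal (norm (u x))"]) measurable
  finally show ?thesis by (simp add: mult_2)
qed

text \<open>One quantity controls every boundary limit below: the error of the Poisson integral and
  that of the conjugate Poisson integral against the truncated Hilbert transform. The values are
  vectors because Fourier inversion uses it for complex functions.\<close>

definition Poisson_osc :: "(real \<Rightarrow> 'b::real_normed_vector) \<Rightarrow> real \<Rightarrow> real \<Rightarrow> ennreal" where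
  "Poisson_osc w y x = (\<integral>\<^sup>+t. ennreal (norm (w t - w x)) * ennreal (y / ((t - x)\<^sup>2 + y\<^sup>2)) \<partial>lborel)"

lemma measurable_Poisson_osc [measurable]:
  fixes w :: "real \<Rightarrow> 'b::{banach, second_countable_topology}"
  assumes [measurable]: "w \<in> borel_measurable borel"
  shows "Poisson_osc w y \<in> borel_measurable borel"
  unfolding Poisson_osc_def by measurable

text \<open>After t = x + y v and an exchange of integrals, the L1 norm is the Cauchy average of the
  translation modulus at y v. This modulus tends to 0 for each v and is bounded by twice the norm of
  \<open>u\<close>.\<close>

lemma Poisson_osc_L1_tendsto:
  fixes u :: "real \<Rightarrow> 'b::{banach, second_countable_topology}"
  assumes u: "integrable lborel u" and Y: "\<And>n. Y n > 0" "Y \<longlonglongrightarrow> 0"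
  shows "(\<lambda>n. \<integral>\<^sup>+x. Poisson_osc u (Y n) x \<partial>lborel) \<longlonglongrightarrow> 0"
proof -
  have [measurable]: "u \<in> borel_measurable borel" using u by auto
  define \<tau> where "\<tau> h = (\<integral>\<^sup>+x. ennreal (norm (u (x + h) - u x)) \<partial>lborel)" for h
  define c where "c = (\<lambda>v::real. ennreal (1 / (1 + v\<^sup>2)))"
  have [measurable]: "\<tau> \<in> borel_measurable borel" "c \<in> borel_measurable borel"
    unfolding \<tau>_def c_def by measurable
  have J: "(\<integral>\<^sup>+x. Poisson_osc u y x \<partial>lborel) = (\<integral>\<^sup>+v. \<tau> (y * v) * c v \<partial>lborel)" if "y > 0" for y
  proof -
    have "(\<integral>\<^sup>+x. Poisson_osc u y x \<partial>lborel)
        = (\<integral>\<^sup>+x. \<integral>\<^sup>+v. ennreal (norm (u (x + y * v) - u x)) * c v \<partial>lborel \<partial>lborel)"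
      unfolding Poisson_osc_def c_def
      by (intro nn_integral_cong nn_integral_Poisson_affine[OF that]) measurable
    also have "\<dots> = (\<integral>\<^sup>+v. \<integral>\<^sup>+x. ennreal (norm (u (x + y * v) - u x)) * c v \<partial>lborel \<partial>lborel)"
      by (rule lborel_pair.Fubini'[symmetric]) measurable
    also have "\<dots> = (\<integral>\<^sup>+v. \<tau> (y * v) * c v \<partial>lborel)"
      unfolding \<tau>_def by (intro nn_integral_cong nn_integral_multc) measurable
    finally show ?thesis .
  qed
  have \<tau>0: "(\<lambda>n. \<tau> (Y n * v)) \<longlonglongrightarrow> 0" for v
  proof (rule tendsto_zero_ennreal)
    fix e :: real assume "e > 0"
    then obtain d where d: "d > 0" "\<And>h. \<bar>h\<bar> < d \<Longrightarrow> \<tau> h \<le> ennreal (e/2)"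
      using nn_integral_translate_diff_le[OF u, of "e/2"] unfolding \<tau>_def by auto
    have "(\<lambda>n. Y n * v) \<longlonglongrightarrow> 0" using tendsto_mult_right[OF Y(2), of v] by simp
    then have "eventually (\<lambda>n. \<bar>Y n * v\<bar> < d) sequentially"
      using d(1) by (auto simp: tendsto_iff dist_real_def)
    then show "eventually (\<lambda>n. \<tau> (Y n * v) < ennreal e) sequentially"
    proof eventually_elim
      case (elim n)
      have "\<tau> (Y n * v) \<le> ennreal (e/2)" using d(2) elim .
      also have "\<dots> < ennreal e" using \<open>e > 0\<close> by (simp add: ennreal_less_iff)
      finally show ?case .
    qed
  qed
  have fin: "(\<integral>\<^sup>+x. ennreal (norm (u x)) \<partial>lborel) < \<infinity>"
    using u by (simp add: integrable_iff_bounded)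
  have "(\<lambda>n. \<integral>\<^sup>+v. \<tau> (Y n * v) * c v \<partial>lborel) \<longlonglongrightarrow> (\<integral>\<^sup>+v. 0 \<partial>(lborel :: real measure))"
  proof (rule nn_integral_dominated_convergence[where w="\<lambda>v. (2 * (\<integral>\<^sup>+x. ennreal (norm (u x)) \<partial>lborel)) * c v"])
    show "(\<integral>\<^sup>+v. (2 * (\<integral>\<^sup>+x. ennreal (norm (u x)) \<partial>lborel)) * c v \<partial>lborel) < \<infinity>"
      using fin by (simp add: nn_integral_cmult c_def nn_integral_Cauchy_density ennreal_mult_less_top)
    show "AE v in lborel. (\<lambda>n. \<tau> (Y n * v) * c v) \<longlonglongrightarrow> 0"
    proof (intro AE_I2)
      fix v
      have "(\<lambda>n. \<tau> (Y n * v) * c v) \<longlonglongrightarrow> 0 * c v"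
        using ennreal_tendsto_cmult[OF _ \<tau>0, of "c v" v] by (simp add: c_def mult.commute)
      then show "(\<lambda>n. \<tau> (Y n * v) * c v) \<longlonglongrightarrow> 0" by simp
    qed
  qed (auto simp: \<tau>_def intro!: mult_right_mono nn_integral_translate_diff_bound)
  then show ?thesis using Y by (simp add: J)
qed

text \<open>The triangle inequality leaves two terms. The one with \<open>u t\<close> costs 4 \<pi>
  by \<open>Poisson_kernel_weight_le\<close> after exchanging integrals, the one with
  \<open>u x\<close> costs the mass \<pi> of the kernel.\<close>

lemma Poisson_osc_weighted_le:
  fixes u :: "real \<Rightarrow> 'b::{banach, second_countable_topology}"
  assumes [measurable]: "u \<in> borel_measurable borel" and y: "0 < y" "y \<le> 1"
  shows "(\<integral>\<^sup>+x. Poisson_osc u y x * ennreal (1 / (1 + x\<^sup>2)) \<partial>lborel)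
    \<le> ennreal (5 * pi) * (\<integral>\<^sup>+t. ennreal (norm (u t)) * ennreal (1 / (1 + t\<^sup>2)) \<partial>lborel)"
proof -
  define W where "W = (\<integral>\<^sup>+t. ennreal (norm (u t)) * ennreal (1 / (1 + t\<^sup>2)) \<partial>lborel)"
  have "(\<integral>\<^sup>+x. Poisson_osc u y x * ennreal (1 / (1 + x\<^sup>2)) \<partial>lborel)
    \<le> (\<integral>\<^sup>+x. (\<integral>\<^sup>+t. ennreal (norm (u t)) * ennreal (y / ((t - x)\<^sup>2 + y\<^sup>2)) \<partial>lborel) * ennreal (1 / (1 + x\<^sup>2))
        + ennreal (norm (u x)) * ennreal pi * ennreal (1 / (1 + x\<^sup>2)) \<partial>lborel)"
  proof (rule nn_integral_mono)
    fix x
    have "Poisson_osc u y x \<le> (\<integral>\<^sup>+t. ennreal (norm (u t)) * ennreal (y / ((t - x)\<^sup>2 + y\<^sup>2))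
        + ennreal (norm (u x)) * ennreal (y / ((t - x)\<^sup>2 + y\<^sup>2)) \<partial>lborel)"
      unfolding Poisson_osc_def
      by (intro nn_integral_mono)
        (simp flip: distrib_right ennreal_plus add: mult_right_mono ennreal_leI norm_triangle_ineq4)
    also have "\<dots> = (\<integral>\<^sup>+t. ennreal (norm (u t)) * ennreal (y / ((t - x)\<^sup>2 + y\<^sup>2)) \<partial>lborel)
        + ennreal (norm (u x)) * ennreal pi"
      using y by (simp add: nn_integral_add nn_integral_cmult nn_integral_Poisson_kernel)
    finally show "Poisson_osc u y x * ennreal (1 / (1 + x\<^sup>2))
      \<le> (\<integral>\<^sup>+t. ennreal (norm (u t)) * ennreal (y / ((t - x)\<^sup>2 + y\<^sup>2)) \<partial>lborel) * ennreal (1 / (1 + x\<^sup>2))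
        + ennreal (norm (u x)) * ennreal pi * ennreal (1 / (1 + x\<^sup>2))"
      by (simp flip: distrib_right add: mult_right_mono)
  qed
  also have "\<dots> = (\<integral>\<^sup>+x. (\<integral>\<^sup>+t. ennreal (norm (u t)) * ennreal (y / ((t - x)\<^sup>2 + y\<^sup>2)) \<partial>lborel) * ennreal (1 / (1 + x\<^sup>2)) \<partial>lborel)
      + (\<integral>\<^sup>+x. ennreal pi * (ennreal (norm (u x)) * ennreal (1 / (1 + x\<^sup>2))) \<partial>lborel)"
    by (subst nn_integral_add) (auto simp: mult_ac)
  also have "(\<integral>\<^sup>+x. ennreal pi * (ennreal (norm (u x)) * ennreal (1 / (1 + x\<^sup>2))) \<partial>lborel) = ennreal pi * W"
    unfolding W_def by (rule nn_integral_cmult) measurable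
  also have "(\<integral>\<^sup>+x. (\<integral>\<^sup>+t. ennreal (norm (u t)) * ennreal (y / ((t - x)\<^sup>2 + y\<^sup>2)) \<partial>lborel) * ennreal (1 / (1 + x\<^sup>2)) \<partial>lborel)
     = (\<integral>\<^sup>+x. \<integral>\<^sup>+t. ennreal (norm (u t)) * (ennreal (y / ((t - x)\<^sup>2 + y\<^sup>2)) * ennreal (1 / (1 + x\<^sup>2))) \<partial>lborel \<partial>lborel)"
    by (subst nn_integral_multc[symmetric]) (auto simp: mult_ac)
  also have "\<dots> = (\<integral>\<^sup>+t. \<integral>\<^sup>+x. ennreal (norm (u t)) * (ennreal (y / ((t - x)\<^sup>2 + y\<^sup>2)) * ennreal (1 / (1 + x\<^sup>2))) \<partial>lborel \<partial>lborel)"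
    by (rule lborel_pair.Fubini') measurable
  also have "\<dots> = (\<integral>\<^sup>+t. ennreal (norm (u t)) * (\<integral>\<^sup>+x. ennreal (y / ((t - x)\<^sup>2 + y\<^sup>2)) * ennreal (1 / (1 + x\<^sup>2)) \<partial>lborel) \<partial>lborel)"
    by (intro nn_integral_cong nn_integral_cmult) measurable
  also have "\<dots> \<le> (\<integral>\<^sup>+t. ennreal (norm (u t)) * (ennreal (4 * pi) * ennreal (1 / (1 + t\<^sup>2))) \<partial>lborel)"
    by (intro nn_integral_mono mult_left_mono Poisson_kernel_weight_le y) auto
  also have "\<dots> = ennreal (4 * pi) * W"
    unfolding W_def by (subst nn_integral_cmult[symmetric]) (auto simp: mult_ac)
  finally have "(\<integral>\<^sup>+x. Poisson_osc u y x * ennreal (1 / (1 + x\<^sup>2)) \<partial>lborel)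
    \<le> ennreal (4 * pi) * W + ennreal pi * W" by (simp add: add_right_mono)
  also have "\<dots> = ennreal (5 * pi) * W"
    by (simp flip: distrib_right ennreal_plus)
  finally show ?thesis unfolding W_def .
qed

lemma Poisson_osc_add_le:
  fixes u v :: "real \<Rightarrow> 'b::{banach, second_countable_topology}"
  assumes [measurable]: "u \<in> borel_measurable borel" "v \<in> borel_measurable borel"
  shows "Poisson_osc (\<lambda>t. u t + v t) y x \<le> Poisson_osc u y x + Poisson_osc v y x"
proof -
  have "Poisson_osc (\<lambda>t. u t + v t) y x
    \<le> (\<integral>\<^sup>+t. ennreal (norm (u t - u x)) * ennreal (y / ((t - x)\<^sup>2 + y\<^sup>2))
        + ennreal (norm (v t - v x)) * ennreal (y / ((t - x)\<^sup>2 + y\<^sup>2)) \<partial>lborel)"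
    unfolding Poisson_osc_def
    by (intro nn_integral_mono)
      (simp flip: distrib_right ennreal_plus add: mult_right_mono ennreal_leI norm_diff_triangle_ineq)
  also have "\<dots> = Poisson_osc u y x + Poisson_osc v y x"
    unfolding Poisson_osc_def by (rule nn_integral_add) measurable
  finally show ?thesis .
qed

text \<open>A density argument: the part of \<open>w\<close> in a large interval is integrable and
  falls under the L1 statement, while the tail is small in the weighted norm, uniformly in the
  height by \<open>Poisson_osc_weighted_le\<close>.\<close>

lemma Poisson_osc_weighted_tendsto:
  fixes w :: "real \<Rightarrow> 'b::{banach, second_countable_topology}"
  assumes [measurable]: "w \<in> borel_measurable borel"
    and fin: "(\<integral>\<^sup>+t. ennreal (norm (w t)) * ennreal (1 / (1 + t\<^sup>2)) \<partial>lborel) < \<infinity>"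
    and Y: "\<And>n. Y n > 0" "\<And>n. Y n \<le> 1" "Y \<longlonglongrightarrow> 0"
  shows "(\<lambda>n. \<integral>\<^sup>+x. Poisson_osc w (Y n) x * ennreal (1 / (1 + x\<^sup>2)) \<partial>lborel) \<longlonglongrightarrow> 0"
proof (rule tendsto_zero_ennreal)
  fix e :: real assume e: "e > 0"
  define \<rho> where "\<rho> = (\<lambda>x::real. ennreal (1 / (1 + x\<^sup>2)))"
  have [measurable]: "\<rho> \<in> borel_measurable borel" unfolding \<rho>_def by measurable
  define v where "v R t = indicator (- {- real R..real R}) t *\<^sub>R w t" for R :: nat and t
  define u where "u R t = indicator {- real R..real R} t *\<^sub>R w t" for R :: nat and t
  have [measurable]: "v R \<in> borel_measurable borel" "u R \<in> borel_measurable borel" for R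
    unfolding v_def u_def by measurable
  have wuv: "w t = u R t + v R t" for R t
    by (auto simp: u_def v_def indicator_def)
  have "(\<lambda>R. \<integral>\<^sup>+t. ennreal (norm (v R t)) * \<rho> t \<partial>lborel) \<longlonglongrightarrow> (\<integral>\<^sup>+t. 0 \<partial>(lborel :: real measure))"
  proof (rule nn_integral_dominated_convergence[where w="\<lambda>t. ennreal (norm (w t)) * \<rho> t"])
    show "AE t in lborel. (\<lambda>R. ennreal (norm (v R t)) * \<rho> t) \<longlonglongrightarrow> 0"
    proof (intro AE_I2 tendsto_eventually)
      fix t :: real
      obtain R0 :: nat where R0: "\<bar>t\<bar> \<le> real R0" using real_arch_simple by blast
      then have "ennreal (norm (v R t)) * \<rho> t = 0" if "R \<ge> R0" for R
        using that of_nat_mono[OF that, where 'a=real] by (auto simp: v_def indicator_def abs_le_iff)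
      then show "eventually (\<lambda>R. ennreal (norm (v R t)) * \<rho> t = 0) sequentially"
        unfolding eventually_sequentially by blast
    qed
  qed (use fin in \<open>auto simp: \<rho>_def v_def indicator_def intro!: mult_right_mono\<close>)
  \<comment> \<open>The 20 \<pi> anticipates the factor 5 \<pi> of the weighted bound, so the tail
    contributes e/4.\<close>
  then have "eventually (\<lambda>R. (\<integral>\<^sup>+t. ennreal (norm (v R t)) * \<rho> t \<partial>lborel) < ennreal (e / (20 * pi))) sequentially"
    using e by (intro order_tendstoD) auto
  then obtain R where R: "(\<integral>\<^sup>+t. ennreal (norm (v R t)) * \<rho> t \<partial>lborel) < ennreal (e / (20 * pi))"
    by (auto simp: eventually_sequentially)
  have u_int: "integrable lborel (u R)"
  proof -
    have "(\<integral>\<^sup>+t. ennreal (norm (u R t)) \<partial>lborel)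
      \<le> (\<integral>\<^sup>+t. ennreal (1 + (real R)\<^sup>2) * (ennreal (norm (w t)) * \<rho> t) \<partial>lborel)"
    proof (rule nn_integral_mono)
      fix t
      show "ennreal (norm (u R t)) \<le> ennreal (1 + (real R)\<^sup>2) * (ennreal (norm (w t)) * \<rho> t)"
      proof (cases "\<bar>t\<bar> \<le> real R")
        case True
        then have "t\<^sup>2 \<le> (real R)\<^sup>2" using abs_le_square_iff[of t "real R"] by simp
        then have "1 \<le> (1 + (real R)\<^sup>2) * (1 / (1 + t\<^sup>2))"
          by (simp add: divide_simps add_pos_nonneg)
        then have "norm (w t) * 1 \<le> norm (w t) * ((1 + (real R)\<^sup>2) * (1 / (1 + t\<^sup>2)))"
          by (intro mult_left_mono) auto
        then show ?thesis using True unfolding \<rho>_def u_def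
          by (simp flip: ennreal_mult ennreal_plus add: ennreal_leI mult_ac abs_le_iff)
      qed (auto simp: u_def indicator_def)
    qed
    also have "\<dots> < \<infinity>" using fin
      by (subst nn_integral_cmult) (auto simp: \<rho>_def ennreal_mult_less_top)
    finally show ?thesis by (simp add: integrable_iff_bounded)
  qed
  have "eventually (\<lambda>n. (\<integral>\<^sup>+x. Poisson_osc (u R) (Y n) x \<partial>lborel) < ennreal (e/2)) sequentially"
    using Poisson_osc_L1_tendsto[OF u_int Y(1) Y(3)] e by (intro order_tendstoD) auto
  then show "eventually (\<lambda>n. (\<integral>\<^sup>+x. Poisson_osc w (Y n) x * ennreal (1 / (1 + x\<^sup>2)) \<partial>lborel) < ennreal e) sequentially"
  proof eventually_elim
    case (elim n)
    have "(\<integral>\<^sup>+x. Poisson_osc w (Y n) x * \<rho> x \<partial>lborel)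
      \<le> (\<integral>\<^sup>+x. Poisson_osc (u R) (Y n) x + Poisson_osc (v R) (Y n) x * \<rho> x \<partial>lborel)"
    proof (rule nn_integral_mono)
      fix x
      have "Poisson_osc w (Y n) x \<le> Poisson_osc (u R) (Y n) x + Poisson_osc (v R) (Y n) x"
        using Poisson_osc_add_le[of "u R" "v R" "Y n" x] by (simp flip: wuv)
      then have "Poisson_osc w (Y n) x * \<rho> x \<le> (Poisson_osc (u R) (Y n) x + Poisson_osc (v R) (Y n) x) * \<rho> x"
        by (rule mult_right_mono) simp
      also have "\<dots> \<le> Poisson_osc (u R) (Y n) x * 1 + Poisson_osc (v R) (Y n) x * \<rho> x"
        unfolding distrib_right
        by (intro add_mono mult_left_mono order_refl) (auto simp: \<rho>_def divide_le_eq_1 add_pos_nonneg)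
      finally show "Poisson_osc w (Y n) x * \<rho> x \<le> Poisson_osc (u R) (Y n) x + Poisson_osc (v R) (Y n) x * \<rho> x"
        by simp
    qed
    also have "\<dots> = (\<integral>\<^sup>+x. Poisson_osc (u R) (Y n) x \<partial>lborel) + (\<integral>\<^sup>+x. Poisson_osc (v R) (Y n) x * \<rho> x \<partial>lborel)"
      by (rule nn_integral_add) measurable
    also have "(\<integral>\<^sup>+x. Poisson_osc (v R) (Y n) x * \<rho> x \<partial>lborel) \<le> ennreal (5 * pi) * (\<integral>\<^sup>+t. ennreal (norm (v R t)) * \<rho> t \<partial>lborel)"
      unfolding \<rho>_def by (rule Poisson_osc_weighted_le) (use Y in auto)
    also have "\<dots> \<le> ennreal (5 * pi) * ennreal (e / (20 * pi))"
      using R by (intro mult_left_mono) auto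
    also have "\<dots> = ennreal (e/4)"
      using e by (simp flip: ennreal_mult)
    finally have "(\<integral>\<^sup>+x. Poisson_osc w (Y n) x * \<rho> x \<partial>lborel)
       \<le> (\<integral>\<^sup>+x. Poisson_osc (u R) (Y n) x \<partial>lborel) + ennreal (e/4)" by (simp add: add_left_mono)
    also have "\<dots> \<le> ennreal (e/2) + ennreal (e/4)"
      using elim by (intro add_mono) auto
    also have "\<dots> < ennreal e" using e by (simp flip: ennreal_plus add: ennreal_less_iff)
    finally show ?case unfolding \<rho>_def .
  qed
qed

text \<open>Convergence in the weighted mean becomes convergence a.e. once the heights are chosen
  with integrals below 2^-k: the sum over k then has a finite integral, so it is finite a.e. and its
  terms tend to 0.\<close>

lemma AE_Poisson_osc_subseq:
  fixes w :: "real \<Rightarrow> 'b::{banach, second_countable_topology}"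
  assumes [measurable]: "w \<in> borel_measurable borel"
    and int: "integrable lborel (\<lambda>t. norm (w t) / (1 + t\<^sup>2))"
  obtains Y :: "nat \<Rightarrow> real" where "\<And>n. Y n > 0" "\<And>n. Y n \<le> 1" "Y \<longlonglongrightarrow> 0"
    "AE x in lborel. (\<lambda>n. Poisson_osc w (Y n) x) \<longlonglongrightarrow> 0"
proof -
  define Z where "Z n = 1 / real (Suc n)" for n
  have Z: "Z n > 0" "Z n \<le> 1" "Z \<longlonglongrightarrow> 0" for n
    using LIMSEQ_inverse_real_of_nat by (auto simp: Z_def[abs_def] inverse_eq_divide)
  define J where "J y = (\<integral>\<^sup>+x. Poisson_osc w y x * ennreal (1 / (1 + x\<^sup>2)) \<partial>lborel)" for y
  have fin: "(\<integral>\<^sup>+t. ennreal (norm (w t)) * ennreal (1 / (1 + t\<^sup>2)) \<partial>lborel) < \<infinity>"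
    using int by (simp add: integrable_iff_bounded flip: ennreal_mult)
  have J0: "(\<lambda>n. J (Z n)) \<longlonglongrightarrow> 0"
    unfolding J_def by (rule Poisson_osc_weighted_tendsto[OF _ fin]) (use Z in auto)
  have "\<exists>n\<ge>k. J (Z n) < ennreal ((1/2)^k)" for k
  proof -
    have "eventually (\<lambda>n. J (Z n) < ennreal ((1/2)^k)) sequentially"
      using J0 by (intro order_tendstoD) auto
    then show ?thesis unfolding eventually_sequentially by (meson nat_le_linear order_refl)
  qed
  then obtain r where r: "\<And>k. r k \<ge> k" "\<And>k. J (Z (r k)) < ennreal ((1/2)^k)" by metis
  define Y where "Y k = Z (r k)" for k
  have Y0: "Y \<longlonglongrightarrow> 0"
    unfolding Y_def using Z(3) r(1) filterlim_at_top_mono[OF filterlim_ident, of r]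
    by (intro filterlim_compose[OF Z(3)]) auto
  have "(\<integral>\<^sup>+x. (\<Sum>k. Poisson_osc w (Y k) x * ennreal (1 / (1 + x\<^sup>2))) \<partial>lborel) = (\<Sum>k. J (Y k))"
    unfolding J_def by (rule nn_integral_suminf) measurable
  also have "\<dots> \<le> (\<Sum>k. ennreal ((1/2)^k))"
    by (intro suminf_le) (use r in \<open>auto simp: Y_def less_imp_le\<close>)
  also have "\<dots> = ennreal (\<Sum>k. (1/2)^k)"
    by (intro suminf_ennreal2) (auto simp: summable_geometric)
  also have "\<dots> < \<infinity>" by simp
  finally have "AE x in lborel. (\<Sum>k. Poisson_osc w (Y k) x * ennreal (1 / (1 + x\<^sup>2))) \<noteq> \<infinity>"
    by (intro nn_integral_PInf_AE) auto
  then have "AE x in lborel. (\<lambda>n. Poisson_osc w (Y n) x) \<longlonglongrightarrow> 0"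
  proof eventually_elim
    case (elim x)
    have "(\<lambda>k. Poisson_osc w (Y k) x * ennreal (1 / (1 + x\<^sup>2))) \<longlonglongrightarrow> 0"
    proof -
      define a where "a k = Poisson_osc w (Y k) x * ennreal (1 / (1 + x\<^sup>2))" for k
      have "a k < \<infinity>" for k
        using elim ennreal_suminf_lessD[of "\<lambda>k. a k" top k] by (simp add: a_def less_top)
      then have a: "a k = ennreal (enn2real (a k))" for k
        by simp
      then have "(\<Sum>k. ennreal (enn2real (a k))) \<noteq> top"
        using elim by (simp add: a_def)
      then have "summable (\<lambda>k. enn2real (a k))"
        by (intro summable_suminf_not_top) auto
      then have "(\<lambda>k. ennreal (enn2real (a k))) \<longlonglongrightarrow> ennreal 0"
        by (intro tendsto_ennrealI summable_LIMSEQ_zero)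
      then show ?thesis using a unfolding a_def by simp
    qed
    then have "(\<lambda>k. ennreal (1 + x\<^sup>2) * (Poisson_osc w (Y k) x * ennreal (1 / (1 + x\<^sup>2)))) \<longlonglongrightarrow> ennreal (1 + x\<^sup>2) * 0"
      by (intro ennreal_tendsto_cmult) auto
    moreover have "ennreal (1 / (1 + x\<^sup>2)) * ennreal (1 + x\<^sup>2) = 1"
      by (subst ennreal_mult[symmetric]) (auto simp: add_nonneg_eq_0_iff)
    then have "ennreal (1 + x\<^sup>2) * (p * ennreal (1 / (1 + x\<^sup>2))) = p" for p
      by (metis mult.commute mult.left_commute mult_1)
    ultimately show ?case by (simp only: mult_zero_right)
  qed
  with Y0 show ?thesis using that[of Y] Z by (auto simp: Y_def)
qed

section \<open>Cauchy integrals over the real line\<close>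

text \<open>The Herglotz-type integral with boundary values - \<pi> H(w) + \<i> \<pi> w. Subtracting
  t / (1 + t^2) makes the kernel O(t^-2), as the weighted space demands, and makes the real part
  vanish at \<i>.\<close>

definition cauchy_int :: "(real \<Rightarrow> real) \<Rightarrow> complex \<Rightarrow> complex" where
  "cauchy_int w z = (LINT t|lborel. of_real (w t) * (1 / (of_real t - z) - of_real (t / (1 + t\<^sup>2))))"

lemma one_plus_square_pos: "1 + (t::real)\<^sup>2 > 0"
  by (simp add: add_pos_nonneg)

lemma integrable_weight_mult:
  fixes w :: "real \<Rightarrow> real" and g :: "real \<Rightarrow> 'b::{real_normed_algebra_1, banach, second_countable_topology}"
  assumes w: "integrable lborel (\<lambda>t. w t / (1 + t\<^sup>2))" and [measurable]: "w \<in> borel_measurable borel"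
    and [measurable]: "g \<in> borel_measurable borel"
    and g: "\<And>t. norm (g t) \<le> C / (1 + t\<^sup>2)"
  shows "integrable lborel (\<lambda>t. of_real (w t) * g t)"
proof (rule Bochner_Integration.integrable_bound)
  show "integrable lborel (\<lambda>t. C * (w t / (1 + t\<^sup>2)))"
    using w by (rule integrable_mult_right)
  show "AE t in lborel. norm (of_real (w t) * g t) \<le> norm (C * (w t / (1 + t\<^sup>2)))"
  proof (rule AE_I2)
    fix t
    have "norm (of_real (w t) * g t) \<le> \<bar>w t\<bar> * norm (g t)"
      using norm_mult_ineq[of "of_real (w t)" "g t"] by simp
    also have "\<dots> \<le> \<bar>w t\<bar> * \<bar>C / (1 + t\<^sup>2)\<bar>"
      by (intro mult_left_mono order_trans[OF g abs_ge_self]) auto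
    finally show "norm (of_real (w t) * g t) \<le> norm (C * (w t / (1 + t\<^sup>2)))"
      by (simp add: abs_mult mult.commute)
  qed
qed measurable

lemma cmod_real_minus_ge_Im: "Im z > 0 \<Longrightarrow> Im z \<le> cmod (of_real t - z)"
  using abs_Im_le_cmod[of "of_real t - z"] by simp

lemma real_minus_neq_zero: "Im z > 0 \<Longrightarrow> of_real t - z \<noteq> 0"
  using cmod_real_minus_ge_Im[of z t] by auto

lemma inverse_square_real_minus_le:
  assumes "Im z > 0"
  shows "1 / (cmod (of_real t - z))\<^sup>2 \<le> (2 + (1 + 2 * (cmod z)\<^sup>2) / (Im z)\<^sup>2) / (1 + t\<^sup>2)"
proof -
  define d where "d = cmod (of_real t - z)"
  have d: "Im z \<le> d" "d > 0" using cmod_real_minus_ge_Im[OF assms, of t] assms by (auto simp: d_def)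
  have "\<bar>t\<bar> \<le> d + cmod z"
    unfolding d_def using norm_triangle_sub[of "of_real t" z] by simp
  then have "t\<^sup>2 \<le> (d + cmod z)\<^sup>2"
    using power_mono[of "\<bar>t\<bar>" "d + cmod z" 2] by simp
  also have "\<dots> \<le> 2 * d\<^sup>2 + 2 * (cmod z)\<^sup>2"
    using zero_le_power2[of "d - cmod z"] by (simp add: power2_eq_square algebra_simps)
  finally have "1 + t\<^sup>2 \<le> 2 * d\<^sup>2 + (1 + 2 * (cmod z)\<^sup>2) * 1" by simp
  also have "\<dots> \<le> 2 * d\<^sup>2 + (1 + 2 * (cmod z)\<^sup>2) * (d\<^sup>2 / (Im z)\<^sup>2)"
    using d assms by (intro add_left_mono mult_left_mono) (auto simp: divide_simps power_mono)
  also have "\<dots> = (2 + (1 + 2 * (cmod z)\<^sup>2) / (Im z)\<^sup>2) * d\<^sup>2"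
    by (simp add: algebra_simps)
  finally show ?thesis
    using d one_plus_square_pos[of t] unfolding d_def[symmetric] by (simp add: divide_simps mult.commute)
qed

lemma cauchy_kernel_le:
  assumes z: "Im z > 0"
  shows "cmod (1 / (of_real t - z) - of_real (t / (1 + t\<^sup>2)))
    \<le> (cmod z + (1 + (cmod z)\<^sup>2) / Im z) / (1 + t\<^sup>2)"
proof -
  have nz: "of_real t - z \<noteq> 0" using real_minus_neq_zero[OF z] .
  have pos: "1 + t\<^sup>2 > 0" by (rule one_plus_square_pos)
  have nz2: "(1 + (of_real t)\<^sup>2 :: complex) \<noteq> 0"
    using pos by (metis of_real_1 of_real_add of_real_eq_0_iff of_real_power less_irrefl)
  \<comment> \<open>This form shows the factor 1 / (1 + t^2), with a cofactor that stays bounded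
    because |t - z| \<ge> Im z.\<close>
  have "1 / (of_real t - z) - of_real (t / (1 + t\<^sup>2)) = (z + (1 + z\<^sup>2) / (of_real t - z)) / (1 + (of_real t)\<^sup>2)"
    using nz nz2 by (simp add: divide_simps) (simp add: power2_eq_square algebra_simps)
  moreover have "cmod (1 + (of_real t)\<^sup>2) = 1 + t\<^sup>2"
    using pos by (metis abs_of_pos norm_of_real of_real_1 of_real_add of_real_power)
  ultimately have "cmod (1 / (of_real t - z) - of_real (t / (1 + t\<^sup>2)))
      = cmod (z + (1 + z\<^sup>2) / (of_real t - z)) / (1 + t\<^sup>2)"
    by (simp add: norm_divide)
  also have "\<dots> \<le> (cmod z + (1 + (cmod z)\<^sup>2) / Im z) / (1 + t\<^sup>2)"
  proof (intro divide_right_mono)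
    have "cmod ((1 + z\<^sup>2) / (of_real t - z)) \<le> (1 + (cmod z)\<^sup>2) / Im z"
      unfolding norm_divide
      using norm_triangle_ineq[of 1 "z\<^sup>2"] z cmod_real_minus_ge_Im[OF z, of t]
      by (intro frac_le) (auto simp: norm_power)
    then show "cmod (z + (1 + z\<^sup>2) / (of_real t - z)) \<le> cmod z + (1 + (cmod z)\<^sup>2) / Im z"
      using norm_triangle_ineq[of z "(1 + z\<^sup>2) / (of_real t - z)"] by linarith
  qed (use pos in auto)
  finally show ?thesis .
qed

lemma Re_Im_inverse_real_minus:
  shows Re_inverse_real_minus: "Re (1 / (of_real t - Complex x y)) = (t - x) / ((t - x)\<^sup>2 + y\<^sup>2)"
    and Im_inverse_real_minus: "Im (1 / (of_real t - Complex x y)) = y / ((t - x)\<^sup>2 + y\<^sup>2)"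
  by (simp_all add: Re_divide Im_divide)

lemma Im_cauchy_kernel:
  "Im (of_real (r::real) * (1 / (of_real t - Complex x y) - of_real (t / (1 + t\<^sup>2)))) = r * (y / ((t - x)\<^sup>2 + y\<^sup>2))"
  by (simp only: times_complex.simps minus_complex.simps Re_complex_of_real Im_complex_of_real
      Im_inverse_real_minus mult_zero_left add_0_right diff_0_right)

lemma Re_cauchy_kernel:
  "Re (of_real (r::real) * (1 / (of_real t - Complex x y) - of_real (t / (1 + t\<^sup>2))))
    = r * ((t - x) / ((t - x)\<^sup>2 + y\<^sup>2) - t / (1 + t\<^sup>2))"
  by (simp only: times_complex.simps minus_complex.simps Re_complex_of_real Im_complex_of_real
      Re_inverse_real_minus mult_zero_left add_0_right diff_0_right)

text \<open>Shared by \<Omega> and by the sawtooth, whose Cauchy integrals are added in the exponent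
  of the multiplier.\<close>

locale log_weight =
  fixes w :: "real \<Rightarrow> real"
  assumes meas [measurable]: "w \<in> borel_measurable borel"
    and int_w: "integrable lborel (\<lambda>t. w t / (1 + t\<^sup>2))"
begin

lemma integrable_cauchy:
  assumes "Im z > 0"
  shows "integrable lborel (\<lambda>t. of_real (w t) * (1 / (of_real t - z) - of_real (t / (1 + t\<^sup>2))))"
  by (rule integrable_weight_mult[OF int_w _ _ cauchy_kernel_le[OF assms]]) measurable

text \<open>The error of the difference quotient is exactly \<eta> times the integral of w / ((t - z
  - \<eta>) (t - z)^2). For |\<eta>| < Im z / 2 the extra factor is at most 2 / Im z, so the error
  is linear in |\<eta>|. The derivative is kept as an explicit integral because it is estimated
  later.\<close>

lemma cauchy_int_has_field_derivative:
  assumes z: "Im z > 0"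
  shows "(cauchy_int w has_field_derivative (LINT t|lborel. of_real (w t) * (1 / (of_real t - z)\<^sup>2))) (at z)"
proof -
  define K where "K = 2 + (1 + 2 * (cmod z)\<^sup>2) / (Im z)\<^sup>2"
  define D where "D = (LINT t|lborel. of_real (w t) * (1 / (of_real t - z)\<^sup>2))"
  have sq: "norm (1 / (of_real t - z)\<^sup>2) \<le> K / (1 + t\<^sup>2)" for t
    using inverse_square_real_minus_le[OF z, of t] by (simp add: norm_divide norm_power K_def)
  have intD: "integrable lborel (\<lambda>t. of_real (w t) * (1 / (of_real t - z)\<^sup>2))"
    by (rule integrable_weight_mult[OF int_w _ _ sq]) measurable
  define M where "M = (LINT t|lborel. \<bar>w t\<bar> * (2 / Im z * (K / (1 + t\<^sup>2))))"
  have "integrable lborel (\<lambda>t. 2 / Im z * K * norm (w t / (1 + t\<^sup>2)))"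
    by (intro integrable_mult_right integrable_norm int_w)
  also have "(\<lambda>t. 2 / Im z * K * norm (w t / (1 + t\<^sup>2))) = (\<lambda>t. \<bar>w t\<bar> * (2 / Im z * (K / (1 + t\<^sup>2))))"
    by (auto simp: add_nonneg_nonneg)
  finally have intM: "integrable lborel (\<lambda>t. \<bar>w t\<bar> * (2 / Im z * (K / (1 + t\<^sup>2))))" .
  have est: "norm ((cauchy_int w (z + \<eta>) - cauchy_int w z) / \<eta> - D) \<le> M * norm \<eta>"
    if \<eta>: "\<eta> \<noteq> 0" "norm \<eta> < Im z / 2" for \<eta>
  proof -
    have Im: "Im (z + \<eta>) \<ge> Im z / 2" using abs_Im_le_cmod[of \<eta>] \<eta> by simp
    then have Im': "Im (z + \<eta>) > 0" using z by simp
    have ptw: "(of_real (w t) * (1 / (of_real t - (z + \<eta>)) - of_real (t / (1 + t\<^sup>2)))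
        - of_real (w t) * (1 / (of_real t - z) - of_real (t / (1 + t\<^sup>2)))) / \<eta>
        - of_real (w t) * (1 / (of_real t - z)\<^sup>2)
        = of_real (w t) * (\<eta> * (1 / (of_real t - (z + \<eta>)) * (1 / (of_real t - z)\<^sup>2)))" for t
    proof -
      have nz: "of_real t - z \<noteq> 0" "of_real t - (z + \<eta>) \<noteq> 0"
        using real_minus_neq_zero[OF z] real_minus_neq_zero[OF Im'] by auto
      have key: "(1 / (of_real t - (z + \<eta>)) - 1 / (of_real t - z)) / \<eta> - 1 / (of_real t - z)\<^sup>2
         = \<eta> * (1 / (of_real t - (z + \<eta>)) * (1 / (of_real t - z)\<^sup>2))"
        using nz \<eta>(1) by (simp add: divide_simps) (simp add: power2_eq_square algebra_simps)
      have "(W * (A - C) - W * (B - C)) / \<eta> - W * S = W * ((A - B) / \<eta> - S)" for W A B C S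
      proof -
        have "W * (A - C) - W * (B - C) = W * (A - B)" by (simp add: algebra_simps)
        then show ?thesis by (simp only: right_diff_distrib[of W "(A - B) / \<eta>" S] times_divide_eq_right)
      qed
      then show ?thesis unfolding key[symmetric] .
    qed
    have "(cauchy_int w (z + \<eta>) - cauchy_int w z) / \<eta> - D
       = (LINT t|lborel. of_real (w t) * (\<eta> * (1 / (of_real t - (z + \<eta>)) * (1 / (of_real t - z)\<^sup>2))))"
      unfolding cauchy_int_def D_def
    proof -
      let ?f = "\<lambda>z t. of_real (w t) * (1 / (of_real t - z) - of_real (t / (1 + t\<^sup>2))) :: complex"
      have "(LINT t|lborel. (?f (z + \<eta>) t - ?f z t) / \<eta> - of_real (w t) * (1 / (of_real t - z)\<^sup>2))
        = (LINT t|lborel. (?f (z + \<eta>) t - ?f z t) / \<eta>) - (LINT t|lborel. of_real (w t) * (1 / (of_real t - z)\<^sup>2))"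
        by (rule Bochner_Integration.integral_diff[OF integrable_divide[OF
              Bochner_Integration.integrable_diff[OF integrable_cauchy[OF Im'] integrable_cauchy[OF z]]] intD])
      also have "(LINT t|lborel. (?f (z + \<eta>) t - ?f z t) / \<eta>) = (LINT t|lborel. ?f (z + \<eta>) t - ?f z t) / \<eta>"
        by (rule integral_divide_zero)
      also have "(LINT t|lborel. ?f (z + \<eta>) t - ?f z t) = (LINT t|lborel. ?f (z + \<eta>) t) - (LINT t|lborel. ?f z t)"
        by (rule Bochner_Integration.integral_diff[OF integrable_cauchy[OF Im'] integrable_cauchy[OF z]])
      finally show "((LINT t|lborel. ?f (z + \<eta>) t) - (LINT t|lborel. ?f z t)) / \<eta>
          - (LINT t|lborel. of_real (w t) * (1 / (of_real t - z)\<^sup>2))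
        = (LINT t|lborel. of_real (w t) * (\<eta> * (1 / (of_real t - (z + \<eta>)) * (1 / (of_real t - z)\<^sup>2))))"
        unfolding ptw by (rule sym)
    qed
    also have "norm \<dots> \<le> (LINT t|lborel. norm \<eta> * (\<bar>w t\<bar> * (2 / Im z * (K / (1 + t\<^sup>2)))))"
    proof (rule Bochner_Integration.integral_norm_bound_integral)
      show "integrable lborel (\<lambda>t. of_real (w t) * (\<eta> * (1 / (of_real t - (z + \<eta>)) * (1 / (of_real t - z)\<^sup>2))))"
        unfolding ptw[symmetric]
        by (rule Bochner_Integration.integrable_diff[OF integrable_divide[OF
              Bochner_Integration.integrable_diff[OF integrable_cauchy[OF Im'] integrable_cauchy[OF z]]] intD])
      show "integrable lborel (\<lambda>t. norm \<eta> * (\<bar>w t\<bar> * (2 / Im z * (K / (1 + t\<^sup>2)))))"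
        by (intro integrable_mult_right intM)
      fix t
      have "norm (1 / (of_real t - (z + \<eta>))) \<le> 2 / Im z"
        using cmod_real_minus_ge_Im[OF Im', of t] Im z by (simp add: norm_divide divide_simps)
      then have "norm (1 / (of_real t - (z + \<eta>))) * norm (1 / (of_real t - z)\<^sup>2) \<le> 2 / Im z * (K / (1 + t\<^sup>2))"
        by (intro mult_mono sq) (use z in auto)
      then have "norm \<eta> * \<bar>w t\<bar> * (norm (1 / (of_real t - (z + \<eta>))) * norm (1 / (of_real t - z)\<^sup>2))
           \<le> norm \<eta> * \<bar>w t\<bar> * (2 / Im z * (K / (1 + t\<^sup>2)))"
        by (intro mult_left_mono) auto
      then show "norm (of_real (w t) * (\<eta> * (1 / (of_real t - (z + \<eta>)) * (1 / (of_real t - z)\<^sup>2))))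
          \<le> norm \<eta> * (\<bar>w t\<bar> * (2 / Im z * (K / (1 + t\<^sup>2))))"
        by (simp only: norm_mult norm_of_real mult.assoc mult.left_commute[of "\<bar>w t\<bar>" "norm \<eta>"])
    qed
    also have "\<dots> = norm \<eta> * M" unfolding M_def by (rule integral_mult_right_zero)
    finally show ?thesis by (simp only: mult.commute[of M])
  qed
  have "((\<lambda>\<eta>. (cauchy_int w (z + \<eta>) - cauchy_int w z) / \<eta> - D) \<longlongrightarrow> 0) (at 0)"
  proof (rule tendsto_0_le[where K=M])
    show "((\<lambda>\<eta>::complex. norm \<eta>) \<longlongrightarrow> 0) (at 0)" by (rule tendsto_norm_zero) simp
    show "eventually (\<lambda>\<eta>. norm ((cauchy_int w (z + \<eta>) - cauchy_int w z) / \<eta> - D) \<le> norm (norm \<eta>) * M) (at 0)"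
      unfolding eventually_at
    proof (intro exI[of _ "Im z / 2"] conjI ballI impI)
      fix \<eta> :: complex assume "\<eta> \<noteq> 0 \<and> dist \<eta> 0 < Im z / 2"
      then have "norm ((cauchy_int w (z + \<eta>) - cauchy_int w z) / \<eta> - D) \<le> M * norm \<eta>"
        by (intro est) auto
      then show "norm ((cauchy_int w (z + \<eta>) - cauchy_int w z) / \<eta> - D) \<le> norm (norm \<eta>) * M"
        by (simp only: real_norm_def abs_norm_cancel mult.commute[of M])
    qed (use z in simp)
  qed
  then show ?thesis
    unfolding DERIV_def D_def[symmetric] by (rule LIM_zero_cancel)
qed

lemma cauchy_int_holomorphic: "cauchy_int w holomorphic_on {z. Im z > 0}"
  by (rule holomorphic_onI)
    (use cauchy_int_has_field_derivative in \<open>auto simp: field_differentiable_def intro: has_field_derivative_at_within\<close>)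

section \<open>Boundary behaviour of the Cauchy integral\<close>

lemma integrable_Poisson:
  assumes "y > 0"
  shows "integrable lborel (\<lambda>t. w t * (y / ((t - x)\<^sup>2 + y\<^sup>2)))"
proof -
  have "integrable lborel (\<lambda>t. Im (of_real (w t) * (1 / (of_real t - Complex x y) - of_real (t / (1 + t\<^sup>2)))))"
    by (intro integrable_Im integrable_cauchy) (use assms in simp)
  then show ?thesis by (simp only: Im_cauchy_kernel)
qed

lemma Im_cauchy_int:
  assumes "y > 0"
  shows "Im (cauchy_int w (Complex x y)) = (LINT t|lborel. w t * (y / ((t - x)\<^sup>2 + y\<^sup>2)))"
proof -
  have "Im (cauchy_int w (Complex x y))
     = (LINT t|lborel. Im (of_real (w t) * (1 / (of_real t - Complex x y) - of_real (t / (1 + t\<^sup>2)))))"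
    unfolding cauchy_int_def by (rule integral_Im[symmetric]) (use integrable_cauchy assms in auto)
  then show ?thesis by (simp only: Im_cauchy_kernel)
qed

lemma integrable_conj_Poisson:
  assumes "y > 0"
  shows "integrable lborel (\<lambda>t. w t * ((t - x) / ((t - x)\<^sup>2 + y\<^sup>2) - t / (1 + t\<^sup>2)))"
proof -
  have "integrable lborel (\<lambda>t. Re (of_real (w t) * (1 / (of_real t - Complex x y) - of_real (t / (1 + t\<^sup>2)))))"
    by (intro integrable_Re integrable_cauchy) (use assms in simp)
  then show ?thesis by (simp only: Re_cauchy_kernel)
qed

lemma Re_cauchy_int:
  assumes "y > 0"
  shows "Re (cauchy_int w (Complex x y)) = (LINT t|lborel. w t * ((t - x) / ((t - x)\<^sup>2 + y\<^sup>2) - t / (1 + t\<^sup>2)))"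
proof -
  have "Re (cauchy_int w (Complex x y))
     = (LINT t|lborel. Re (of_real (w t) * (1 / (of_real t - Complex x y) - of_real (t / (1 + t\<^sup>2)))))"
    unfolding cauchy_int_def by (rule integral_Re[symmetric]) (use integrable_cauchy assms in auto)
  then show ?thesis by (simp only: Re_cauchy_kernel)
qed

text \<open>The Poisson kernel has mass \<pi>, so \<pi> w x can be moved under the integral.\<close>

lemma Im_cauchy_int_boundary:
  assumes y: "y > 0"
  shows "ennreal \<bar>Im (cauchy_int w (Complex x y)) - pi * w x\<bar> \<le> Poisson_osc w y x"
proof -
  have P: "integrable lborel (\<lambda>t. w x * (y / ((t - x)\<^sup>2 + y\<^sup>2)))"
    "(LINT t|lborel. w x * (y / ((t - x)\<^sup>2 + y\<^sup>2))) = pi * w x"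
    using has_bochner_integral_mult_right[OF has_bochner_integral_Poisson_kernel[OF y, of x], of "w x"]
    by (simp_all only: has_bochner_integral_iff mult.commute[of "w x" pi])
  have "Im (cauchy_int w (Complex x y)) - pi * w x
      = (LINT t|lborel. (w t - w x) * (y / ((t - x)\<^sup>2 + y\<^sup>2)))"
    unfolding Im_cauchy_int[OF y] P(2)[symmetric] left_diff_distrib
    by (rule Bochner_Integration.integral_diff[symmetric]) (intro integrable_Poisson y P)+
  moreover have "integrable lborel (\<lambda>t. (w t - w x) * (y / ((t - x)\<^sup>2 + y\<^sup>2)))"
    unfolding left_diff_distrib by (intro Bochner_Integration.integrable_diff integrable_Poisson y P)
  ultimately have "ennreal \<bar>Im (cauchy_int w (Complex x y)) - pi * w x\<bar>
      \<le> (\<integral>\<^sup>+t. ennreal (norm ((w t - w x) * (y / ((t - x)\<^sup>2 + y\<^sup>2)))) \<partial>lborel)"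
    using integral_norm_bound_ennreal by fastforce
  also have "\<dots> = Poisson_osc w y x"
    unfolding Poisson_osc_def using y
    by (intro nn_integral_cong, subst ennreal_mult[symmetric]) (auto simp: abs_mult)
  finally show ?thesis .
qed

text \<open>This is \<pi> times \<open>hilbert_trunc\<close>, over Borel measure; the truncation
  radius is called \<open>y\<close> because it is matched with the height in the half-plane.\<close>

definition hilbert_cut :: "real \<Rightarrow> real \<Rightarrow> real" where
  "hilbert_cut y x = (LINT t|lborel. indicator {t. \<bar>x - t\<bar> > y} t * (w t * (1 / (x - t) + t / (t\<^sup>2 + 1))))"

text \<open>The sum is the integral of w \<kappa> - w q. Here \<kappa> is the conjugate Poisson
  kernel minus the truncated Hilbert kernel: it is dominated by the Poisson kernel and odd about x,
  so \<open>w t\<close> may be replaced by \<open>w t - w x\<close>. The rest \<open>q\<close> lives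
  on |t - x| \<le> y and costs only O(y) times the Poisson kernel.\<close>

lemma Re_cauchy_int_boundary:
  assumes y: "0 < y" "y \<le> 1"
  shows "ennreal \<bar>Re (cauchy_int w (Complex x y)) + hilbert_cut y x\<bar>
    \<le> 3 * Poisson_osc w y x + ennreal (2 * pi * y * \<bar>w x\<bar>)"
proof -
  define p where "p t = y / ((t - x)\<^sup>2 + y\<^sup>2)" for t
  have [measurable]: "p \<in> borel_measurable borel" unfolding p_def by measurable
  have p0: "p t \<ge> 0" for t using y by (simp add: p_def)
  define \<kappa> where "\<kappa> t = (t - x) / ((t - x)\<^sup>2 + y\<^sup>2) + indicator {t. \<bar>x - t\<bar> > y} t * (1 / (x - t))" for t
  define q where "q t = indicator {t. \<bar>x - t\<bar> \<le> y} t * (t / (1 + t\<^sup>2))" for t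
  have [measurable]: "\<kappa> \<in> borel_measurable borel" "q \<in> borel_measurable borel"
    unfolding \<kappa>_def q_def by measurable
  have \<kappa>p: "\<bar>\<kappa> t\<bar> \<le> p t" for t
  proof -
    define u where "u = t - x"
    have D: "u\<^sup>2 + y\<^sup>2 > 0" using y by (simp add: add_nonneg_pos)
    have xt: "x - t = - u" by (simp add: u_def)
    show ?thesis
    proof (cases "\<bar>u\<bar> > y")
      case True
      then have u0: "u \<noteq> 0" using y by auto
      have "\<kappa> t = u / (u\<^sup>2 + y\<^sup>2) - 1 / u"
        using True by (simp add: \<kappa>_def xt) (simp add: u_def)
      also have "\<dots> = - (y\<^sup>2 / (u * (u\<^sup>2 + y\<^sup>2)))"
        using u0 D by (simp add: field_simps power2_eq_square)
      finally have "\<bar>\<kappa> t\<bar> = (y / \<bar>u\<bar>) * (y / (u\<^sup>2 + y\<^sup>2))"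
        using D by (simp add: abs_mult power2_eq_square)
      also have "\<dots> \<le> 1 * (y / (u\<^sup>2 + y\<^sup>2))"
        using True y D by (intro mult_right_mono) (auto simp: divide_simps)
      finally show ?thesis by (simp add: p_def u_def)
    next
      case False
      then have "\<bar>\<kappa> t\<bar> = \<bar>u\<bar> / (u\<^sup>2 + y\<^sup>2)"
        using D by (simp add: \<kappa>_def xt) (simp add: u_def)
      then show ?thesis using False D by (simp add: p_def u_def divide_right_mono)
    qed
  qed
  \<comment> \<open>On |t - x| \<le> y the Poisson kernel is at least 1 / (2 y), so 2 y p dominates
    the indicator there.\<close>
  have qp: "\<bar>q t\<bar> \<le> 2 * y * p t" for t
  proof (cases "\<bar>x - t\<bar> \<le> y")
    case True
    have "(t - x)\<^sup>2 \<le> y\<^sup>2" using True abs_le_square_iff[of "t - x" y] y by (simp add: abs_minus_commute)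
    then have "1 \<le> 2 * y * p t"
      using y by (simp add: p_def divide_simps add_nonneg_pos power2_eq_square)
    moreover have "\<bar>t / (1 + t\<^sup>2)\<bar> \<le> 1"
    proof -
      have "\<bar>t\<bar> \<le> 1 + t\<^sup>2" using zero_le_power2[of "\<bar>t\<bar> - 1"]
        by (simp add: power2_eq_square algebra_simps)
      then show ?thesis using one_plus_square_pos[of t] by (simp add: divide_simps)
    qed
    ultimately show ?thesis using True by (simp add: q_def)
  qed (use y p0 in \<open>simp add: q_def\<close>)
  have Pint: "integrable lborel p" "(LINT t|lborel. p t) = pi"
    using has_bochner_integral_Poisson_kernel[OF y(1), of x] by (auto simp: has_bochner_integral_iff p_def[abs_def])
  have \<kappa>int: "integrable lborel \<kappa>"
    using \<kappa>p p0 by (intro Bochner_Integration.integrable_bound[OF Pint(1)]) auto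
  \<comment> \<open>Reflection in x maps \<kappa> to its negative.\<close>
  have \<kappa>0: "(LINT t|lborel. \<kappa> t) = 0"
  proof -
    have "(LINT t|lborel. \<kappa> t) = (LINT t|lborel. \<kappa> (2 * x + (-1) * t))"
      using lborel_integral_real_affine[of "-1" \<kappa> "2 * x"] by simp
    also have "\<dots> = (LINT t|lborel. - \<kappa> t)"
    proof (intro Bochner_Integration.integral_cong refl)
      fix t
      define k where "k u = u / (u\<^sup>2 + y\<^sup>2) - (if \<bar>u\<bar> > y then 1 / u else 0)" for u
      have k: "\<kappa> t = k (t - x)" for t
        by (simp add: \<kappa>_def k_def minus_divide_right)
      have "k (- u) = - k u" for u by (simp add: k_def)
      from this[of "t - x"] show "\<kappa> (2 * x + (-1) * t) = - \<kappa> t"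
        unfolding k by simp
    qed
    finally show ?thesis by simp
  qed
  have wint: "integrable lborel (\<lambda>t. w t * p t)"
    unfolding p_def by (rule integrable_Poisson[OF y(1)])
  have w\<kappa>: "integrable lborel (\<lambda>t. w t * \<kappa> t)"
    using \<kappa>p p0 by (intro Bochner_Integration.integrable_bound[OF wint])
      (auto simp: abs_mult intro!: mult_left_mono)
  have wq: "integrable lborel (\<lambda>t. w t * q t)"
  proof (rule Bochner_Integration.integrable_bound[OF integrable_mult_right[OF wint, of "2 * y"]])
    have "norm (w t * q t) \<le> norm (2 * y * (w t * p t))" for t
      using mult_left_mono[OF qp, of "\<bar>w t\<bar>" t] y p0[of t] by (simp add: abs_mult mult_ac)
    then show "AE t in lborel. norm (w t * q t) \<le> norm (2 * y * (w t * p t))" by simp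
  qed measurable
  have d\<kappa>: "integrable lborel (\<lambda>t. (w t - w x) * \<kappa> t)"
    unfolding left_diff_distrib by (intro Bochner_Integration.integrable_diff w\<kappa> integrable_mult_right \<kappa>int)
  \<comment> \<open>The truncated integrand is the only term not known to be integrable; the
    identity \<open>split\<close> expresses it by three that are.\<close>
  have hc: "integrable lborel (\<lambda>t. indicator {t. \<bar>x - t\<bar> > y} t * (w t * (1 / (x - t) + t / (t\<^sup>2 + 1))))"
    and split: "w t * ((t - x) / ((t - x)\<^sup>2 + y\<^sup>2) - t / (1 + t\<^sup>2))
      + indicator {t. \<bar>x - t\<bar> > y} t * (w t * (1 / (x - t) + t / (t\<^sup>2 + 1))) = w t * \<kappa> t - w t * q t" for t
  proof -
    show split: "w t * ((t - x) / ((t - x)\<^sup>2 + y\<^sup>2) - t / (1 + t\<^sup>2))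
      + indicator {t. \<bar>x - t\<bar> > y} t * (w t * (1 / (x - t) + t / (t\<^sup>2 + 1))) = w t * \<kappa> t - w t * q t" for t
      by (cases "\<bar>x - t\<bar> > y")
        (simp_all add: \<kappa>_def q_def add.commute[of 1] right_diff_distrib distrib_left)
    have "integrable lborel (\<lambda>t. (w t * \<kappa> t - w t * q t) - w t * ((t - x) / ((t - x)\<^sup>2 + y\<^sup>2) - t / (1 + t\<^sup>2)))"
      by (intro Bochner_Integration.integrable_diff w\<kappa> wq integrable_conj_Poisson y)
    then show "integrable lborel (\<lambda>t. indicator {t. \<bar>x - t\<bar> > y} t * (w t * (1 / (x - t) + t / (t\<^sup>2 + 1))))"
      unfolding split[symmetric] by simp
  qed
  have "Re (cauchy_int w (Complex x y)) + hilbert_cut y x = (LINT t|lborel. w t * \<kappa> t - w t * q t)"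
    unfolding Re_cauchy_int[OF y(1)] hilbert_cut_def split[symmetric]
    by (rule Bochner_Integration.integral_add[symmetric]) (intro integrable_conj_Poisson y hc)+
  also have "\<dots> = (LINT t|lborel. w t * \<kappa> t) - (LINT t|lborel. w t * q t)"
    by (intro Bochner_Integration.integral_diff w\<kappa> wq)
  also have "(LINT t|lborel. w t * \<kappa> t) = (LINT t|lborel. (w t - w x) * \<kappa> t)"
  proof -
    have "(LINT t|lborel. (w t - w x) * \<kappa> t) = (LINT t|lborel. w t * \<kappa> t) - (LINT t|lborel. w x * \<kappa> t)"
      unfolding left_diff_distrib
      by (intro Bochner_Integration.integral_diff w\<kappa> integrable_mult_right \<kappa>int)
    moreover have "(LINT t|lborel. w x * \<kappa> t) = 0"
      by (simp only: integral_mult_right_zero \<kappa>0 mult_zero_right)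
    ultimately show ?thesis by simp
  qed
  finally have eq: "Re (cauchy_int w (Complex x y)) + hilbert_cut y x
     = (LINT t|lborel. (w t - w x) * \<kappa> t) - (LINT t|lborel. w t * q t)" .
  have osc: "Poisson_osc w y x = (\<integral>\<^sup>+t. ennreal (\<bar>w t - w x\<bar> * p t) \<partial>lborel)"
    unfolding Poisson_osc_def p_def using y
    by (intro nn_integral_cong, subst ennreal_mult[symmetric]) auto
  have b1: "ennreal \<bar>LINT t|lborel. (w t - w x) * \<kappa> t\<bar> \<le> Poisson_osc w y x"
  proof -
    have "ennreal \<bar>LINT t|lborel. (w t - w x) * \<kappa> t\<bar> \<le> (\<integral>\<^sup>+t. ennreal (norm ((w t - w x) * \<kappa> t)) \<partial>lborel)"
      using integral_norm_bound_ennreal[OF d\<kappa>] by simp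
    also have "\<dots> \<le> (\<integral>\<^sup>+t. ennreal (\<bar>w t - w x\<bar> * p t) \<partial>lborel)"
      using \<kappa>p by (intro nn_integral_mono ennreal_leI) (auto simp: abs_mult intro!: mult_left_mono)
    finally show ?thesis using osc by simp
  qed
  have b2: "ennreal \<bar>LINT t|lborel. w t * q t\<bar> \<le> ennreal (2 * y) * Poisson_osc w y x + ennreal (2 * pi * y * \<bar>w x\<bar>)"
  proof -
    have "ennreal \<bar>LINT t|lborel. w t * q t\<bar> \<le> (\<integral>\<^sup>+t. ennreal (norm (w t * q t)) \<partial>lborel)"
      using integral_norm_bound_ennreal[OF wq] by simp
    also have "\<dots> \<le> (\<integral>\<^sup>+t. ennreal (2 * y) * ennreal (\<bar>w t - w x\<bar> * p t) + ennreal (2 * y * \<bar>w x\<bar>) * ennreal (p t) \<partial>lborel)"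
    proof (rule nn_integral_mono)
      fix t
      have "norm (w t * q t) \<le> (\<bar>w t - w x\<bar> + \<bar>w x\<bar>) * (2 * y * p t)"
        unfolding real_norm_def abs_mult using qp[of t] by (intro mult_mono) auto
      then have "ennreal (norm (w t * q t)) \<le> ennreal (2 * y * (\<bar>w t - w x\<bar> * p t) + 2 * y * \<bar>w x\<bar> * p t)"
        by (intro ennreal_leI) (simp add: algebra_simps)
      also have "\<dots> = ennreal (2 * y) * ennreal (\<bar>w t - w x\<bar> * p t) + ennreal (2 * y * \<bar>w x\<bar>) * ennreal (p t)"
        using y p0[of t] by (subst ennreal_plus) (auto simp: ennreal_mult')
      finally show "ennreal (norm (w t * q t)) \<le> \<dots>" .
    qed
    also have "\<dots> = ennreal (2 * y) * Poisson_osc w y x + ennreal (2 * y * \<bar>w x\<bar>) * ennreal pi"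
      unfolding osc using nn_integral_Poisson_kernel[OF y(1), of x]
      by (simp add: nn_integral_add nn_integral_cmult p_def)
    also have "ennreal (2 * y * \<bar>w x\<bar>) * ennreal pi = ennreal (2 * pi * y * \<bar>w x\<bar>)"
      using y by (simp flip: ennreal_mult add: mult_ac)
    finally show ?thesis .
  qed
  have "ennreal \<bar>Re (cauchy_int w (Complex x y)) + hilbert_cut y x\<bar>
     \<le> ennreal \<bar>LINT t|lborel. (w t - w x) * \<kappa> t\<bar> + ennreal \<bar>LINT t|lborel. w t * q t\<bar>"
    unfolding eq by (simp flip: ennreal_plus add: ennreal_leI)
  also have "\<dots> \<le> Poisson_osc w y x + (ennreal (2 * y) * Poisson_osc w y x + ennreal (2 * pi * y * \<bar>w x\<bar>))"
    by (intro add_mono b1 b2)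
  also have "\<dots> \<le> Poisson_osc w y x + (2 * Poisson_osc w y x + ennreal (2 * pi * y * \<bar>w x\<bar>))"
  proof -
    have "ennreal (2 * y) \<le> 2" using y ennreal_leI[of "2 * y" 2] by simp
    then show ?thesis by (intro add_left_mono add_right_mono mult_right_mono) auto
  qed
  also have "\<dots> = 3 * Poisson_osc w y x + ennreal (2 * pi * y * \<bar>w x\<bar>)"
  proof -
    have "(3::ennreal) = 1 + 2" by simp
    then show ?thesis by (simp only: distrib_right mult_1 add.assoc)
  qed
  finally show ?thesis .
qed

end

section \<open>Integrals over the boundary of the upper half-plane\<close>

text \<open>A primitive exists because the half-plane is convex. Its increment along the horizontal
  segment is taken through the apex \<i> (R + y): on both slanted sides |w|^2 \<ge> R^2 / 2, so the
  derivative is at most 2 C / R^2 over a length of at most 2 R. A triangle replaces the usual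
  semicircle, as the mean value bound needs only segments.\<close>

lemma halfplane_horizontal_integral_le:
  assumes hol: "\<Phi> holomorphic_on {z. Im z > 0}"
    and bound: "\<And>z. Im z > 0 \<Longrightarrow> cmod (\<Phi> z) \<le> C / (1 + (cmod z)\<^sup>2)"
    and y: "y > 0" and R: "R > 0" and C: "C \<ge> 0"
  shows "cmod (LINT x|lborel. indicator {- R..R} x *\<^sub>R \<Phi> (Complex x y)) \<le> 8 * C / R"
proof -
  have "open {z. Im z > 0}" by (rule open_halfspace_Im_gt)
  moreover have "convex {z. Im z > 0}" by (rule convex_halfspace_Im_gt)
  ultimately obtain F where F: "\<And>z. z \<in> {z. Im z > 0} \<Longrightarrow> (F has_field_derivative \<Phi> z) (at z within {z. Im z > 0})"
    using hol holomorphic_convex_primitive' by metis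
  then have F': "(F has_field_derivative \<Phi> z) (at z)" if "Im z > 0" for z
    using F[of z] that at_within_open[OF _ \<open>open {z. Im z > 0}\<close>, of z] by simp
  define top where "top = Complex 0 (R + y)"
  have side: "cmod (F top - F (Complex r y)) \<le> 4 * C / R" if r: "\<bar>r\<bar> = R" for r
  proof -
    have seg: "Im w > 0 \<and> R\<^sup>2 / 2 \<le> (cmod w)\<^sup>2" if w_in: "w \<in> closed_segment (Complex r y) top" for w
    proof -
      obtain s where s: "0 \<le> s" "s \<le> 1" "w = (1 - s) *\<^sub>R Complex r y + s *\<^sub>R top"
        using w_in by (auto simp: in_segment)
      have w: "Re w = (1 - s) * r" "Im w = y + s * R"
        unfolding s(3) by (simp_all add: top_def algebra_simps)
      \<comment> \<open>The point is (1 - s)^2 + s^2 = 1/2 + 2 (s - 1/2)^2.\<close>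
      have "R\<^sup>2 / 2 \<le> ((1 - s) * r)\<^sup>2 + (s * R)\<^sup>2"
      proof -
        have "r\<^sup>2 = R\<^sup>2" using r by (metis power2_abs)
        then have "((1 - s) * r)\<^sup>2 + (s * R)\<^sup>2 = R\<^sup>2 / 2 + R\<^sup>2 * (2 * (s - 1/2)\<^sup>2)"
          by (simp add: power_mult_distrib) (simp add: power2_eq_square algebra_simps)
        then show ?thesis by simp
      qed
      also have "(s * R)\<^sup>2 \<le> (y + s * R)\<^sup>2"
        using s y R by (intro power_mono) auto
      finally have "R\<^sup>2 / 2 \<le> (cmod w)\<^sup>2" by (simp add: cmod_power2 w)
      moreover have "Im w > 0" using w y s R by (simp add: add_pos_nonneg)
      ultimately show ?thesis by simp
    qed
    have "cmod (F top - F (Complex r y)) \<le> (2 * C / R\<^sup>2) * cmod (top - Complex r y)"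
    proof (rule field_differentiable_bound[of "closed_segment (Complex r y) top" F \<Phi>])
      fix w assume w: "w \<in> closed_segment (Complex r y) top"
      show "(F has_field_derivative \<Phi> w) (at w within closed_segment (Complex r y) top)"
        using F' seg[OF w] has_field_derivative_at_within by blast
      have "cmod (\<Phi> w) \<le> C / (1 + (cmod w)\<^sup>2)" using bound seg[OF w] by blast
      also have "\<dots> \<le> C / (R\<^sup>2 / 2)"
        using seg[OF w] C R by (intro divide_left_mono) (auto intro!: mult_pos_pos add_pos_nonneg)
      finally show "cmod (\<Phi> w) \<le> 2 * C / R\<^sup>2" by (simp add: mult.commute)
    qed auto
    also have "cmod (top - Complex r y) \<le> \<bar>r\<bar> + \<bar>R\<bar>"
      using cmod_le[of "top - Complex r y"] by (simp add: top_def)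
    then have "(2 * C / R\<^sup>2) * cmod (top - Complex r y) \<le> (2 * C / R\<^sup>2) * (2 * R)"
      using r R C by (intro mult_left_mono) auto
    also have "\<dots> = 4 * C / R" using R by (simp add: power2_eq_square)
    finally show ?thesis .
  qed
  have der: "((\<lambda>x. F (Complex x y)) has_vector_derivative \<Phi> (Complex x y)) (at x within A)" for x A
  proof -
    have "((\<lambda>x. Complex x y) has_vector_derivative 1) (at x within A)"
      unfolding Complex_eq by (auto intro!: derivative_eq_intros)
    from field_vector_diff_chain_within[OF this, of F "\<Phi> (Complex x y)"]
    show ?thesis using has_field_derivative_at_within[OF F'[of "Complex x y"]] y by (simp add: o_def)
  qed
  have cont: "continuous_on A (\<lambda>x. \<Phi> (Complex x y))" for A
    unfolding Complex_eq
    by (rule continuous_on_compose2[OF holomorphic_on_imp_continuous_on[OF hol]])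
      (use y in \<open>auto intro!: continuous_intros\<close>)
  have "(LINT x|lborel. indicator {- R..R} x *\<^sub>R \<Phi> (Complex x y)) = F (Complex R y) - F (Complex (-R) y)"
    using R by (intro integral_FTC_Icc der cont) auto
  also have "cmod \<dots> = cmod ((F top - F (Complex (-R) y)) - (F top - F (Complex R y)))" by simp
  also have "\<dots> \<le> cmod (F top - F (Complex (-R) y)) + cmod (F top - F (Complex R y))"
    by (rule norm_triangle_ineq4)
  also have "\<dots> \<le> 4 * C / R + 4 * C / R"
    using R by (intro add_mono side) auto
  finally show ?thesis by simp
qed

lemma integrable_Cauchy_bound:
  fixes f :: "real \<Rightarrow> 'b::{banach, second_countable_topology}"
  assumes [measurable]: "f \<in> borel_measurable borel" and "AE x in lborel. norm (f x) \<le> C / (1 + x\<^sup>2)"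
  shows "integrable lborel f"
proof (rule Bochner_Integration.integrable_bound)
  show "integrable lborel (\<lambda>x::real. C * (1 / (1 + x\<^sup>2)))"
    using has_bochner_integral_Cauchy_density by (intro integrable_mult_right) (auto simp: has_bochner_integral_iff)
  show "AE x in lborel. norm (f x) \<le> norm (C * (1 / (1 + x\<^sup>2)))"
    using assms(2) by eventually_elim (metis abs_ge_self mult.right_neutral order_trans real_norm_def times_divide_eq_right)
qed measurable

lemma halfplane_horizontal_integral_eq_0:
  assumes hol: "\<Phi> holomorphic_on {z. Im z > 0}"
    and bound: "\<And>z. Im z > 0 \<Longrightarrow> cmod (\<Phi> z) \<le> C / (1 + (cmod z)\<^sup>2)"
    and y: "y > 0"
  shows "(LINT x|lborel. \<Phi> (Complex x y)) = 0"
proof -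
  have C: "C \<ge> 0"
    using order_trans[OF norm_ge_zero bound[of \<i>]] by (simp add: zero_le_divide_iff)
  have bnd: "cmod (\<Phi> (Complex x y)) \<le> C / (1 + x\<^sup>2)" for x
  proof -
    have "cmod (\<Phi> (Complex x y)) \<le> C / (1 + (cmod (Complex x y))\<^sup>2)" using y by (intro bound) simp
    also have "\<dots> \<le> C / (1 + x\<^sup>2)"
      using C by (intro divide_left_mono) (auto simp: cmod_power2 intro!: mult_pos_pos add_pos_nonneg)
    finally show ?thesis .
  qed
  have "continuous_on UNIV (\<lambda>x. \<Phi> (Complex x y))"
    unfolding Complex_eq
    by (rule continuous_on_compose2[OF holomorphic_on_imp_continuous_on[OF hol]])
      (use y in \<open>auto intro!: continuous_intros\<close>)
  then have [measurable]: "(\<lambda>x. \<Phi> (Complex x y)) \<in> borel_measurable borel"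
    by (rule borel_measurable_continuous_onI)
  have int: "integrable lborel (\<lambda>x. \<Phi> (Complex x y))"
    using bnd by (intro integrable_Cauchy_bound[of _ C]) auto
  have "(\<lambda>n. LINT x|lborel. indicator {- real n..real n} x *\<^sub>R \<Phi> (Complex x y)) \<longlonglongrightarrow> (LINT x|lborel. \<Phi> (Complex x y))"
  proof (rule integral_dominated_convergence[where w="\<lambda>x. norm (\<Phi> (Complex x y))"])
    show "AE x in lborel. (\<lambda>n. indicator {- real n..real n} x *\<^sub>R \<Phi> (Complex x y)) \<longlonglongrightarrow> \<Phi> (Complex x y)"
    proof (intro AE_I2 tendsto_eventually)
      fix x :: real
      obtain n0 :: nat where "\<bar>x\<bar> \<le> real n0" using real_arch_simple by blast
      then have "indicator {- real n..real n} x *\<^sub>R \<Phi> (Complex x y) = \<Phi> (Complex x y)" if "n \<ge> n0" for n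
        using of_nat_mono[OF that, where 'a=real] by (auto simp: indicator_def abs_le_iff)
      then show "eventually (\<lambda>n. indicator {- real n..real n} x *\<^sub>R \<Phi> (Complex x y) = \<Phi> (Complex x y)) sequentially"
        unfolding eventually_sequentially by blast
    qed
  qed (use int in \<open>auto simp: indicator_def\<close>)
  moreover have "(\<lambda>n. LINT x|lborel. indicator {- real n..real n} x *\<^sub>R \<Phi> (Complex x y)) \<longlonglongrightarrow> 0"
  proof (rule tendsto_0_le[where K="8 * C"])
    show "(\<lambda>n. 1 / real n) \<longlonglongrightarrow> 0" by (rule lim_1_over_n)
    have "cmod (LINT x|lborel. indicator {- real n..real n} x *\<^sub>R \<Phi> (Complex x y)) \<le> 8 * C / real n" if "n > 0" for n
      by (rule halfplane_horizontal_integral_le[OF hol bound y _ C]) (use that in auto)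
    then show "\<forall>\<^sub>F n in sequentially. norm (LINT x|lborel. indicator {- real n..real n} x *\<^sub>R \<Phi> (Complex x y)) \<le> norm (1 / real n) * (8 * C)"
      by (intro eventually_mono[OF eventually_gt_at_top[of "0::nat"]]) simp
  qed
  ultimately show ?thesis using LIMSEQ_unique by blast
qed

text \<open>The decay bound does not depend on the height and so serves as the dominating function;
  a.e. limits along a single sequence of heights are then enough.\<close>

lemma halfplane_boundary_integral_eq_0:
  assumes hol: "\<Phi> holomorphic_on {z. Im z > 0}"
    and bound: "\<And>z. Im z > 0 \<Longrightarrow> cmod (\<Phi> z) \<le> C / (1 + (cmod z)\<^sup>2)"
    and Y: "\<And>n. Y n > 0"
    and lim: "AE x in lborel. (\<lambda>n. \<Phi> (Complex x (Y n))) \<longlonglongrightarrow> \<phi> x"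
    and \<phi> [measurable]: "\<phi> \<in> borel_measurable borel"
  shows "(LINT x|lborel. \<phi> x) = 0"
proof -
  have C: "C \<ge> 0"
    using order_trans[OF norm_ge_zero bound[of \<i>]] by (simp add: zero_le_divide_iff)
  have m [measurable]: "(\<lambda>x. \<Phi> (Complex x (Y n))) \<in> borel_measurable borel" for n
    unfolding Complex_eq
    by (rule borel_measurable_continuous_onI,
        rule continuous_on_compose2[OF holomorphic_on_imp_continuous_on[OF hol]])
      (use Y in \<open>auto intro!: continuous_intros\<close>)
  have "(\<lambda>n. LINT x|lborel. \<Phi> (Complex x (Y n))) \<longlonglongrightarrow> (LINT x|lborel. \<phi> x)"
  proof (rule integral_dominated_convergence[where w="\<lambda>x. C * (1 / (1 + x\<^sup>2))"])
    show "integrable lborel (\<lambda>x::real. C * (1 / (1 + x\<^sup>2)))"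
      using has_bochner_integral_Cauchy_density by (intro integrable_mult_right) (auto simp: has_bochner_integral_iff)
    show "AE x in lborel. cmod (\<Phi> (Complex x (Y n))) \<le> C * (1 / (1 + x\<^sup>2))" for n
    proof (rule AE_I2)
      fix x
      have "cmod (\<Phi> (Complex x (Y n))) \<le> C / (1 + (cmod (Complex x (Y n)))\<^sup>2)" using Y by (intro bound) simp
      also have "\<dots> \<le> C / (1 + x\<^sup>2)"
        using C by (intro divide_left_mono) (auto simp: cmod_power2 intro!: mult_pos_pos add_pos_nonneg)
      finally show "cmod (\<Phi> (Complex x (Y n))) \<le> C * (1 / (1 + x\<^sup>2))" by simp
    qed
  qed (use lim in auto)
  then show ?thesis
    using halfplane_horizontal_integral_eq_0[OF hol bound Y] by (simp add: LIMSEQ_const_iff)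
qed

section \<open>Fourier inversion\<close>

lemma has_bochner_integral_exp_halfline:
  assumes a: "Re a > 0"
  shows "has_bochner_integral lborel (\<lambda>x::real. indicator {0..} x *\<^sub>R exp (- a * of_real x)) (1 / a)"
proof -
  let ?f = "\<lambda>x::real. indicator {0..} x *\<^sub>R exp (- a * of_real x)"
  have a0: "a \<noteq> 0" using a by auto
  have F: "((\<lambda>x. - exp (- a * of_real x) / a) has_vector_derivative exp (- a * of_real x)) (at x within A)" for x A
    using a0 by (auto intro!: derivative_eq_intros has_vector_derivative_real_field simp: field_simps)
  have nn: "(\<integral>\<^sup>+x. ennreal (exp (- Re a * x)) * indicator {0..} x \<partial>lborel) = ennreal (0 - (- exp (- Re a * 0) / Re a))"
  proof (rule nn_integral_FTC_atLeast)
    show "((\<lambda>x. - exp (- Re a * x) / Re a) has_real_derivative exp (- Re a * x)) (at x)" for x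
      using a by (auto intro!: derivative_eq_intros simp: field_simps)
    have "filterlim (\<lambda>x. - Re a * x) at_bot at_top"
      using filterlim_tendsto_pos_mult_at_top[OF tendsto_const[of "Re a"] a, of "\<lambda>x. x" at_top]
      by (simp add: filterlim_uminus_at_bot filterlim_ident)
    then have "((\<lambda>x. - exp (- Re a * x) / Re a) \<longlongrightarrow> - 0 / Re a) at_top"
      by (intro tendsto_divide tendsto_minus tendsto_const filterlim_compose[OF exp_at_bot]) (use a in auto)
    then show "((\<lambda>x. - exp (- Re a * x) / Re a) \<longlongrightarrow> 0) at_top" by simp
  qed auto
  have int: "integrable lborel ?f"
    unfolding integrable_iff_bounded
  proof
    have "(\<integral>\<^sup>+x. ennreal (norm (?f x)) \<partial>lborel) = (\<integral>\<^sup>+x. ennreal (exp (- Re a * x)) * indicator {0..} x \<partial>lborel)"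
      by (intro nn_integral_cong) (auto simp: indicator_def)
    then show "(\<integral>\<^sup>+x. ennreal (norm (?f x)) \<partial>lborel) < \<infinity>" unfolding nn by simp
  qed measurable
  have L1: "(\<lambda>n. LINT x|lborel. indicator {0..real n} x *\<^sub>R exp (- a * of_real x)) \<longlonglongrightarrow> (LINT x|lborel. ?f x)"
  proof (rule integral_dominated_convergence[where w="\<lambda>x. norm (?f x)"])
    show "AE x in lborel. (\<lambda>n. indicator {0..real n} x *\<^sub>R exp (- a * of_real x)) \<longlonglongrightarrow> ?f x"
    proof (intro AE_I2 tendsto_eventually)
      fix x :: real
      obtain n0 :: nat where "x \<le> real n0" using real_arch_simple by blast
      then have "indicator {0..real n} x *\<^sub>R exp (- a * of_real x) = ?f x" if "n \<ge> n0" for n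
        using of_nat_mono[OF that, where 'a=real] by (auto simp: indicator_def)
      then show "eventually (\<lambda>n. indicator {0..real n} x *\<^sub>R exp (- a * of_real x) = ?f x) sequentially"
        unfolding eventually_sequentially by blast
    qed
    show "integrable lborel (\<lambda>x. norm (?f x))" using int by (rule integrable_norm)
  qed (auto simp: indicator_def)
  have FTC: "(LINT x|lborel. indicator {0..real n} x *\<^sub>R exp (- a * of_real x)) = - exp (- a * of_real (real n)) / a - (- exp (- a * of_real 0) / a)" for n
    by (rule integral_FTC_Icc[OF _ F]) (auto intro!: continuous_intros)
  have L2: "(\<lambda>n. - exp (- a * of_real (real n)) / a - (- exp (- a * of_real 0) / a)) \<longlonglongrightarrow> - 0 / a - (- exp (- a * of_real 0) / a)"
  proof (intro tendsto_intros a0)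
    have "filterlim (\<lambda>n. - Re a * real n) at_bot sequentially"
      using filterlim_tendsto_pos_mult_at_top[OF tendsto_const a filterlim_real_sequentially]
      by (simp add: filterlim_uminus_at_bot)
    then have "(\<lambda>n. exp (- Re a * real n)) \<longlonglongrightarrow> 0" by (rule filterlim_compose[OF exp_at_bot])
    then show "(\<lambda>n. exp (- a * of_real (real n))) \<longlonglongrightarrow> 0"
      by (rule tendsto_norm_zero_cancel[OF Lim_transform_eventually]) (simp add: norm_exp_eq_Re)
  qed
  have "(LINT x|lborel. ?f x) = 1 / a"
    using LIMSEQ_unique[OF L1[unfolded FTC] L2] by simp
  with int show ?thesis by (simp add: has_bochner_integral_iff)
qed

section \<open>Abel summation of the inversion integral\<close>

lemma has_bochner_integral_exp_abs:
  fixes u y :: real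
  assumes y: "y > 0"
  shows "has_bochner_integral lborel
    (\<lambda>\<xi>. exp (2 * of_real pi * \<i> * of_real (u * \<xi>)) * of_real (exp (- 2 * pi * y * \<bar>\<xi>\<bar>)))
    (of_real (1 / pi * (y / (u\<^sup>2 + y\<^sup>2))) :: complex)"
proof -
  define a where "a = 2 * of_real pi * (of_real y - \<i> * of_real u)"
  have a: "Re a > 0" "Re (cnj a) > 0" using y by (auto simp: a_def)
  have h1: "has_bochner_integral lborel (\<lambda>x::real. indicator {0..} x *\<^sub>R exp (- a * of_real x)) (1 / a)"
    by (rule has_bochner_integral_exp_halfline[OF a(1)])
  have "has_bochner_integral lborel (\<lambda>x::real. indicator {0..} (0 + (-1) * x) *\<^sub>R exp (- cnj a * of_real (0 + (-1) * x)))
      ((1 / cnj a) /\<^sub>R \<bar>-1\<bar>)"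
    using has_bochner_integral_exp_halfline[OF a(2)]
    by (rule iffD1[OF lborel_has_bochner_integral_real_affine_iff, rotated]) simp
  then have h2: "has_bochner_integral lborel (\<lambda>x::real. indicator {..0} x *\<^sub>R exp (cnj a * of_real x)) (1 / cnj a)"
    by (simp add: indicator_def)
  have "1 / a + 1 / cnj a = of_real (1 / pi * (y / (u\<^sup>2 + y\<^sup>2)))"
  proof -
    have nz: "a \<noteq> 0" "cnj a \<noteq> 0" using a by auto
    have "1 / a + 1 / cnj a = (a + cnj a) / (a * cnj a)" using nz by (simp add: divide_simps)
    also have "a + cnj a = of_real (4 * pi * y)"
      unfolding complex_add_cnj by (simp add: a_def)
    also have "a * cnj a = of_real (4 * pi\<^sup>2 * (u\<^sup>2 + y\<^sup>2))"
      unfolding complex_mult_cnj by (simp add: a_def power2_eq_square algebra_simps)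
    also have "of_real (4 * pi * y) / of_real (4 * pi\<^sup>2 * (u\<^sup>2 + y\<^sup>2)) = (of_real ((4 * pi * y) / (4 * pi\<^sup>2 * (u\<^sup>2 + y\<^sup>2))) :: complex)"
      by (rule of_real_divide[symmetric])
    also have "(4 * pi * y) / (4 * pi\<^sup>2 * (u\<^sup>2 + y\<^sup>2)) = 1 / pi * (y / (u\<^sup>2 + y\<^sup>2))"
      by (simp add: power2_eq_square)
    finally show ?thesis .
  qed
  then have "has_bochner_integral lborel (\<lambda>x::real. indicator {0..} x *\<^sub>R exp (- a * of_real x)
      + indicator {..0} x *\<^sub>R exp (cnj a * of_real x)) (of_real (1 / pi * (y / (u\<^sup>2 + y\<^sup>2))))"
    using has_bochner_integral_add[OF h1 h2] by simp
  moreover have "AE x in lborel. indicator {0..} x *\<^sub>R exp (- a * of_real x) + indicator {..0} x *\<^sub>R exp (cnj a * of_real x)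
      = exp (2 * of_real pi * \<i> * of_real (u * x)) * of_real (exp (- 2 * pi * y * \<bar>x\<bar>))"
    \<comment> \<open>Both closed half-lines contain 0, where the sum of the two pieces counts
      twice.\<close>
    using AE_lborel_singleton[of 0]
  proof eventually_elim
    case (elim x)
    show ?case
    proof (cases "x > 0")
      case True
      then have "- a * of_real x = 2 * of_real pi * \<i> * of_real (u * x) + of_real (- 2 * pi * y * \<bar>x\<bar>)"
        by (simp add: a_def complex_eq_iff)
      then show ?thesis using True by (simp add: mult_exp_exp exp_of_real[symmetric] del: of_real_mult of_real_minus)
    next
      case False
      then have "x < 0" using elim by simp
      moreover from this have "cnj a * of_real x = 2 * of_real pi * \<i> * of_real (u * x) + of_real (- 2 * pi * y * \<bar>x\<bar>)"
        by (simp add: a_def complex_eq_iff)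
      ultimately show ?thesis by (simp add: mult_exp_exp exp_of_real[symmetric] del: of_real_mult of_real_minus)
    qed
  qed
  ultimately show ?thesis
    by (subst (asm) has_bochner_integral_cong_AE) auto
qed

text \<open>The damping factor makes the double integrand absolutely integrable, which legitimates
  the exchange; the inner integral is then the Poisson kernel.\<close>

lemma fourier_damped_eq_Poisson:
  fixes f :: "real \<Rightarrow> complex"
  assumes f: "integrable lborel f" and y: "y > 0"
  shows "(LINT \<xi>|lborel. exp (- 2 * of_real pi * \<i> * of_real (x * \<xi>)) * of_real (exp (- 2 * pi * y * \<bar>\<xi>\<bar>))
            * (LINT t|lborel. f t * exp (2 * of_real pi * \<i> * of_real (t * \<xi>))))
       = of_real (1 / pi) * (LINT t|lborel. of_real (y / ((t - x)\<^sup>2 + y\<^sup>2)) * f t)"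
proof -
  have [measurable]: "f \<in> borel_measurable borel" using f by auto
  define g where "g = (\<lambda>(t, \<xi>). f t * (exp (2 * of_real pi * \<i> * of_real ((t - x) * \<xi>)) * of_real (exp (- 2 * pi * y * \<bar>\<xi>\<bar>))))"
  have [measurable]: "g \<in> borel_measurable (lborel \<Otimes>\<^sub>M lborel)"
    unfolding g_def by measurable
  have inner: "has_bochner_integral lborel (\<lambda>\<xi>. g (t, \<xi>)) (f t * of_real (1 / pi * (y / ((t - x)\<^sup>2 + y\<^sup>2))))" for t
    unfolding g_def prod.case by (rule has_bochner_integral_mult_right[OF has_bochner_integral_exp_abs[OF y]])
  have damp: "integrable lborel (\<lambda>\<xi>. exp (- 2 * pi * y * \<bar>\<xi>\<bar>))"
    using integrable_norm[OF has_bochner_integral_iff[THEN iffD1, OF has_bochner_integral_exp_abs[OF y, of 0], THEN conjunct1]]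
    by simp
  have int: "integrable (lborel \<Otimes>\<^sub>M lborel) g"
  proof (rule lborel_pair.Fubini_integrable)
    have "(LINT \<xi>|lborel. norm (g (t, \<xi>))) = norm (f t) * (LINT \<xi>|lborel. exp (- 2 * pi * y * \<bar>\<xi>\<bar>))" for t
      unfolding g_def by (simp add: norm_mult)
    then show "integrable lborel (\<lambda>t. LINT \<xi>|lborel. norm (g (t, \<xi>)))"
      using f by (simp add: integrable_norm)
    show "AE t in lborel. integrable lborel (\<lambda>\<xi>. g (t, \<xi>))"
      using inner by (auto simp: has_bochner_integral_iff)
  qed measurable
  have "(LINT \<xi>|lborel. exp (- 2 * of_real pi * \<i> * of_real (x * \<xi>)) * of_real (exp (- 2 * pi * y * \<bar>\<xi>\<bar>))
            * (LINT t|lborel. f t * exp (2 * of_real pi * \<i> * of_real (t * \<xi>))))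
     = (LINT \<xi>|lborel. LINT t|lborel. g (t, \<xi>))"
  proof (intro Bochner_Integration.integral_cong refl)
    fix \<xi> :: real
    have "exp (- 2 * of_real pi * \<i> * of_real (x * \<xi>)) * of_real (exp (- 2 * pi * y * \<bar>\<xi>\<bar>))
            * (f t * exp (2 * of_real pi * \<i> * of_real (t * \<xi>))) = g (t, \<xi>)" for t
    proof -
      have "2 * of_real pi * \<i> * of_real ((t - x) * \<xi>)
        = - 2 * of_real pi * \<i> * of_real (x * \<xi>) + 2 * of_real pi * \<i> * (of_real (t * \<xi>) :: complex)"
        by (simp add: algebra_simps)
      then have "exp (2 * of_real pi * \<i> * of_real ((t - x) * \<xi>))
        = exp (- 2 * of_real pi * \<i> * of_real (x * \<xi>)) * exp (2 * of_real pi * \<i> * (of_real (t * \<xi>) :: complex))"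
        by (simp only: exp_add)
      then show ?thesis unfolding g_def prod.case by (simp only: mult_ac)
    qed
    then show "exp (- 2 * of_real pi * \<i> * of_real (x * \<xi>)) * of_real (exp (- 2 * pi * y * \<bar>\<xi>\<bar>))
            * (LINT t|lborel. f t * exp (2 * of_real pi * \<i> * of_real (t * \<xi>))) = (LINT t|lborel. g (t, \<xi>))"
      by (subst integral_mult_right_zero[symmetric]) simp
  qed
  also have "\<dots> = (LINT t|lborel. LINT \<xi>|lborel. g (t, \<xi>))"
    using lborel_pair.Fubini_integral[of "\<lambda>t \<xi>. g (t, \<xi>)"] int by simp
  also have "\<dots> = (LINT t|lborel. of_real (1 / pi) * (of_real (y / ((t - x)\<^sup>2 + y\<^sup>2)) * f t))"
    using inner by (intro Bochner_Integration.integral_cong refl) (simp add: has_bochner_integral_iff)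
  also have "\<dots> = of_real (1 / pi) * (LINT t|lborel. of_real (y / ((t - x)\<^sup>2 + y\<^sup>2)) * f t)"
    by (rule integral_mult_right_zero)
  finally show ?thesis .
qed

lemma Poisson_integral_minus_le:
  fixes f :: "real \<Rightarrow> complex"
  assumes f: "integrable lborel f" and y: "y > 0"
  shows "ennreal (cmod ((LINT t|lborel. of_real (y / ((t - x)\<^sup>2 + y\<^sup>2)) * f t) - of_real pi * f x)) \<le> Poisson_osc f y x"
proof -
  have [measurable]: "f \<in> borel_measurable borel" using f by auto
  have P: "has_bochner_integral lborel (\<lambda>t. complex_of_real (y / ((t - x)\<^sup>2 + y\<^sup>2)) * f x) (of_real pi * f x)"
    by (intro has_bochner_integral_mult_left has_bochner_integral_of_real has_bochner_integral_Poisson_kernel y)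
  have "integrable lborel (\<lambda>t. of_real (y / ((t - x)\<^sup>2 + y\<^sup>2)) * f t)"
  proof (rule Bochner_Integration.integrable_bound[OF integrable_mult_right[OF integrable_norm[OF f], of "1 / y"]])
    have "cmod (of_real (y / ((t - x)\<^sup>2 + y\<^sup>2)) * f t) \<le> 1 / y * norm (f t)" for t
      unfolding norm_mult norm_of_real
    proof (rule mult_right_mono)
      have "y / ((t - x)\<^sup>2 + y\<^sup>2) \<le> y / y\<^sup>2"
        using y by (intro divide_left_mono) (auto intro!: mult_pos_pos add_nonneg_pos)
      then show "\<bar>y / ((t - x)\<^sup>2 + y\<^sup>2)\<bar> \<le> 1 / y" using y by (simp add: power2_eq_square)
    qed simp
    then show "AE t in lborel. cmod (of_real (y / ((t - x)\<^sup>2 + y\<^sup>2)) * f t) \<le> norm (1 / y * norm (f t))"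
      using y by (simp add: abs_mult)
  qed measurable
  note h = has_bochner_integral_diff[OF has_bochner_integral_integrable[OF this] P]
  have eq: "of_real (y / ((t - x)\<^sup>2 + y\<^sup>2)) * f t - of_real (y / ((t - x)\<^sup>2 + y\<^sup>2)) * f x
     = of_real (y / ((t - x)\<^sup>2 + y\<^sup>2)) * (f t - f x)" for t
    by (rule right_diff_distrib[symmetric])
  have "ennreal (cmod ((LINT t|lborel. of_real (y / ((t - x)\<^sup>2 + y\<^sup>2)) * f t) - of_real pi * f x))
    \<le> (\<integral>\<^sup>+t. ennreal (cmod (of_real (y / ((t - x)\<^sup>2 + y\<^sup>2)) * (f t - f x))) \<partial>lborel)"
    using integral_norm_bound_ennreal[OF has_bochner_integral_iff[THEN iffD1, OF h, THEN conjunct1]]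
      has_bochner_integral_integral_eq[OF h] unfolding eq by simp
  also have "\<dots> = Poisson_osc f y x"
    unfolding Poisson_osc_def
    by (intro nn_integral_cong, subst ennreal_mult[symmetric], simp, use y in simp)
      (unfold norm_mult norm_of_real, use y in \<open>simp add: mult.commute\<close>)
  finally show ?thesis .
qed

text \<open>Along the heights of \<open>AE_Poisson_osc_subseq\<close> the damped integrals tend to
  \<open>f\<close> a.e., being Poisson averages of it; by dominated convergence they also tend to
  the undamped integral, \<psi> being integrable.\<close>

lemma fourier_inversion_AE:
  fixes f :: "real \<Rightarrow> complex"
  defines "\<psi> \<equiv> \<lambda>\<xi>. LINT t|lborel. f t * exp (2 * of_real pi * \<i> * of_real (t * \<xi>))"
  assumes f: "integrable lborel f" and \<psi>: "integrable lborel \<psi>"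
  shows "AE x in lborel. (LINT \<xi>|lborel. exp (- 2 * of_real pi * \<i> * of_real (x * \<xi>)) * \<psi> \<xi>) = f x"
proof -
  have [measurable]: "f \<in> borel_measurable borel" "\<psi> \<in> borel_measurable borel" using f \<psi> by auto
  have "integrable lborel (\<lambda>t. norm (f t) / (1 + t\<^sup>2))"
  proof (rule Bochner_Integration.integrable_bound[OF f])
    have "norm (f t) / (1 + t\<^sup>2) \<le> norm (f t) / 1" for t
      by (rule divide_left_mono) (auto simp: add_pos_nonneg)
    then show "AE t in lborel. norm (norm (f t) / (1 + t\<^sup>2)) \<le> norm (f t)" by simp
  qed measurable
  then obtain Y where Y: "\<And>n. Y n > 0" "\<And>n. Y n \<le> 1" "Y \<longlonglongrightarrow> 0"
    and osc: "AE x in lborel. (\<lambda>n. Poisson_osc f (Y n) x) \<longlonglongrightarrow> 0"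
    by (rule AE_Poisson_osc_subseq[of f, rotated]) auto
  have lhs: "(\<lambda>n. LINT \<xi>|lborel. exp (- 2 * of_real pi * \<i> * of_real (x * \<xi>)) * of_real (exp (- 2 * pi * Y n * \<bar>\<xi>\<bar>)) * \<psi> \<xi>)
      \<longlonglongrightarrow> (LINT \<xi>|lborel. exp (- 2 * of_real pi * \<i> * of_real (x * \<xi>)) * \<psi> \<xi>)" for x
  proof (rule integral_dominated_convergence[where w="\<lambda>\<xi>. norm (\<psi> \<xi>)"])
    show "AE \<xi> in lborel. (\<lambda>n. exp (- 2 * of_real pi * \<i> * of_real (x * \<xi>)) * of_real (exp (- 2 * pi * Y n * \<bar>\<xi>\<bar>)) * \<psi> \<xi>)
        \<longlonglongrightarrow> exp (- 2 * of_real pi * \<i> * of_real (x * \<xi>)) * \<psi> \<xi>"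
    proof (rule AE_I2)
      fix \<xi> :: real
      have "(\<lambda>n. exp (- 2 * of_real pi * \<i> * of_real (x * \<xi>)) * of_real (exp (- 2 * pi * Y n * \<bar>\<xi>\<bar>)) * \<psi> \<xi>)
        \<longlonglongrightarrow> exp (- 2 * of_real pi * \<i> * of_real (x * \<xi>)) * of_real (exp (- 2 * pi * 0 * \<bar>\<xi>\<bar>)) * \<psi> \<xi>"
        by (intro tendsto_intros Y)
      then show "(\<lambda>n. exp (- 2 * of_real pi * \<i> * of_real (x * \<xi>)) * of_real (exp (- 2 * pi * Y n * \<bar>\<xi>\<bar>)) * \<psi> \<xi>)
        \<longlonglongrightarrow> exp (- 2 * of_real pi * \<i> * of_real (x * \<xi>)) * \<psi> \<xi>" by simp
    qed
    show "AE \<xi> in lborel. norm (exp (- 2 * of_real pi * \<i> * of_real (x * \<xi>)) * of_real (exp (- 2 * pi * Y n * \<bar>\<xi>\<bar>)) * \<psi> \<xi>) \<le> norm (\<psi> \<xi>)" for n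
    proof (rule AE_I2)
      fix \<xi> :: real
      have "exp (- 2 * pi * Y n * \<bar>\<xi>\<bar>) \<le> 1" using Y(1)[of n] by (simp add: less_imp_le)
      moreover have "cmod (exp (- 2 * of_real pi * \<i> * of_real (x * \<xi>))) = 1" by (simp add: norm_exp_eq_Re)
      ultimately show "norm (exp (- 2 * of_real pi * \<i> * of_real (x * \<xi>)) * of_real (exp (- 2 * pi * Y n * \<bar>\<xi>\<bar>)) * \<psi> \<xi>) \<le> norm (\<psi> \<xi>)"
        unfolding norm_mult norm_of_real by (simp add: mult_left_le_one_le)
    qed
  qed (use \<psi> in auto)
  from osc show ?thesis
  proof eventually_elim
    case (elim x)
    let ?P = "\<lambda>n. LINT t|lborel. of_real (Y n / ((t - x)\<^sup>2 + (Y n)\<^sup>2)) * f t"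
    have "(\<lambda>n. ennreal (cmod (?P n - of_real pi * f x))) \<longlonglongrightarrow> 0"
      by (rule tendsto_sandwich[OF _ _ tendsto_const elim])
        (intro always_eventually allI zero_le Poisson_integral_minus_le f Y)+
    then have "(\<lambda>n. ?P n - of_real pi * f x) \<longlonglongrightarrow> 0"
      by (simp add: ennreal_tendsto_0_iff tendsto_norm_zero_iff)
    then have "?P \<longlonglongrightarrow> of_real pi * f x" by (rule LIM_zero_cancel)
    then have "(\<lambda>n. of_real (1 / pi) * ?P n) \<longlonglongrightarrow> of_real (1 / pi) * (of_real pi * f x)"
      by (intro tendsto_intros)
    moreover have "of_real (1 / pi) * (of_real pi * f x) = f x" by simp
    ultimately have "(\<lambda>n. LINT \<xi>|lborel. exp (- 2 * of_real pi * \<i> * of_real (x * \<xi>)) * of_real (exp (- 2 * pi * Y n * \<bar>\<xi>\<bar>)) * \<psi> \<xi>) \<longlonglongrightarrow> f x"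
      unfolding \<psi>_def fourier_damped_eq_Poisson[OF f Y(1)] by simp
    then show ?case using lhs LIMSEQ_unique by blast
  qed
qed

section \<open>The outer function with a sawtooth argument\<close>

text \<open>Only rises are controlled. A downward jump sends ln |Q| to minus infinity, which an
  upper bound for |Q| tolerates; an upward jump would send it to plus infinity.\<close>

locale one_sided_lipschitz =
  fixes s :: "real \<Rightarrow> real" and L :: real
  assumes meas_s: "s \<in> borel_measurable borel"
    and bounded: "\<bar>s t\<bar> \<le> pi / 2"
    and L: "L \<ge> 0"
    and rise: "a \<le> b \<Longrightarrow> s b - s a \<le> L * (b - a)"
begin

sublocale log_weight s
proof
  have [measurable]: "s \<in> borel_measurable borel" by (rule meas_s)
  have "integrable lborel (\<lambda>t::real. pi / 2 * (1 / (1 + t\<^sup>2)))"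
    using has_bochner_integral_Cauchy_density by (intro integrable_mult_right) (auto simp: has_bochner_integral_iff)
  then show "integrable lborel (\<lambda>t. s t / (1 + t\<^sup>2))"
  proof (rule Bochner_Integration.integrable_bound)
    have "norm (s t / (1 + t\<^sup>2)) \<le> norm (pi / 2 * (1 / (1 + t\<^sup>2)))" for t
      using mult_right_mono[OF bounded[of t], of "1 / (1 + t\<^sup>2)"] by simp
    then show "AE t in lborel. norm (s t / (1 + t\<^sup>2)) \<le> norm (pi / 2 * (1 / (1 + t\<^sup>2)))" by simp
  qed measurable
qed (rule meas_s)

text \<open>\<open>V x y = ln \<bar>Q (x + \<i> y)\<bar>\<close> for the function \<open>Q\<close> whose boundary argument is \<open>s\<close>.\<close>

definition V :: "real \<Rightarrow> real \<Rightarrow> real" where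
  "V x y = Re (cauchy_int s (Complex x y)) / pi"

section \<open>Growth of ln |Q| away from the real line\<close>

lemma cauchy_int_deriv_bound:
  assumes z: "Im z > 0"
  shows "cmod (LINT t|lborel. of_real (s t) * (1 / (of_real t - z)\<^sup>2)) \<le> pi\<^sup>2 / 2 / Im z"
proof -
  let ?p = "\<lambda>t. Im z / ((t - Re z)\<^sup>2 + (Im z)\<^sup>2)"
  have P: "has_bochner_integral lborel (\<lambda>t. pi / 2 / Im z * ?p t) (pi / 2 / Im z * pi)"
    by (intro has_bochner_integral_mult_right has_bochner_integral_Poisson_kernel z)
  have b: "cmod (of_real (s t) * (1 / (of_real t - z)\<^sup>2)) \<le> pi / 2 / Im z * ?p t" for t
  proof -
    have "(cmod (of_real t - z))\<^sup>2 = (t - Re z)\<^sup>2 + (Im z)\<^sup>2" by (simp add: cmod_power2)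
    then have "cmod (of_real (s t) * (1 / (of_real t - z)\<^sup>2)) = \<bar>s t\<bar> * (1 / ((t - Re z)\<^sup>2 + (Im z)\<^sup>2))"
      by (simp add: norm_mult norm_divide norm_power)
    also have "\<dots> \<le> pi / 2 * (1 / ((t - Re z)\<^sup>2 + (Im z)\<^sup>2))"
      using bounded[of t] by (intro mult_right_mono) auto
    also have "\<dots> = pi / 2 / Im z * ?p t" using z by simp
    finally show ?thesis .
  qed
  have K: "norm (1 / (of_real t - z)\<^sup>2) \<le> (2 + (1 + 2 * (cmod z)\<^sup>2) / (Im z)\<^sup>2) / (1 + t\<^sup>2)" for t
    using inverse_square_real_minus_le[OF z, of t] by (simp add: norm_divide norm_power)
  have "integrable lborel (\<lambda>t. of_real (s t) * (1 / (of_real t - z)\<^sup>2))"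
    by (rule integrable_weight_mult[OF int_w _ _ K]) measurable
  then have "cmod (LINT t|lborel. of_real (s t) * (1 / (of_real t - z)\<^sup>2)) \<le> (LINT t|lborel. pi / 2 / Im z * ?p t)"
    by (rule Bochner_Integration.integral_norm_bound_integral) (use P b in \<open>auto simp: has_bochner_integral_iff\<close>)
  also have "\<dots> = pi / 2 / Im z * pi" using P by (simp only: has_bochner_integral_iff)
  finally show ?thesis by (simp add: power2_eq_square)
qed

lemma V_i: "V 0 1 = 0"
  unfolding V_def by (subst Re_cauchy_int) (auto simp: add.commute)

text \<open>The derivative of the Cauchy integral is at most \<pi>^2 / (2 Im z), because |s| \<le>
  \<pi>/2 and |t - z|^-2 integrates to \<pi> / Im z. On the convex set Im z \<ge> y this is a
  Lipschitz constant.\<close>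

lemma V_horizontal:
  assumes y: "y > 0"
  shows "\<bar>V x1 y - V x2 y\<bar> \<le> pi / 2 / y * \<bar>x1 - x2\<bar>"
proof -
  have "cmod (cauchy_int s (Complex x1 y) - cauchy_int s (Complex x2 y))
      \<le> pi\<^sup>2 / 2 / y * cmod (Complex x1 y - Complex x2 y)"
  proof (rule field_differentiable_bound[of "{z. Im z \<ge> y}"])
    fix z assume z: "z \<in> {z. y \<le> Im z}"
    then have z': "Im z > 0" using y by simp
    show "(cauchy_int s has_field_derivative (LINT t|lborel. of_real (s t) * (1 / (of_real t - z)\<^sup>2))) (at z within {z. y \<le> Im z})"
      by (rule has_field_derivative_at_within[OF cauchy_int_has_field_derivative[OF z']])
    have "pi\<^sup>2 / 2 / Im z \<le> pi\<^sup>2 / 2 / y" using z y by (intro divide_left_mono) auto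
    then show "cmod (LINT t|lborel. of_real (s t) * (1 / (of_real t - z)\<^sup>2)) \<le> pi\<^sup>2 / 2 / y"
      using cauchy_int_deriv_bound[OF z'] by linarith
  qed (auto simp: convex_halfspace_Im_ge)
  moreover have "cmod (Complex x1 y - Complex x2 y) = \<bar>x1 - x2\<bar>"
    by (simp add: complex_diff cmod_def)
  moreover have "\<bar>Re (cauchy_int s (Complex x1 y)) - Re (cauchy_int s (Complex x2 y))\<bar>
      \<le> cmod (cauchy_int s (Complex x1 y) - cauchy_int s (Complex x2 y))"
    using abs_Re_le_cmod[of "cauchy_int s (Complex x1 y) - cauchy_int s (Complex x2 y)"] by simp
  ultimately have "\<bar>Re (cauchy_int s (Complex x1 y)) - Re (cauchy_int s (Complex x2 y))\<bar> / pi
     \<le> pi\<^sup>2 / 2 / y * \<bar>x1 - x2\<bar> / pi"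
    by (intro divide_right_mono) auto
  then show ?thesis
    unfolding V_def diff_divide_distrib[symmetric] abs_divide by (simp add: power2_eq_square)
qed

text \<open>The same derivative bound, now integrated in y, becomes logarithmic; this is done by
  showing that V + (\<pi>/2) ln y and - V + (\<pi>/2) ln y increase.\<close>

lemma V_vertical:
  assumes y: "0 < y1" "y1 \<le> y2"
  shows "\<bar>V x y2 - V x y1\<bar> \<le> pi / 2 * ln (y2 / y1)"
proof -
  define D where "D y = Re (\<i> * (LINT t|lborel. of_real (s t) * (1 / (of_real t - Complex x y)\<^sup>2))) / pi" for y
  have der: "((\<lambda>y. V x y) has_real_derivative D y) (at y)" if "y > 0" for y
  proof -
    have "((\<lambda>y. Complex x y) has_vector_derivative \<i>) (at y)"
      unfolding Complex_eq by (auto intro!: derivative_eq_intros)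
    from field_vector_diff_chain_at[OF this cauchy_int_has_field_derivative[of "Complex x y"]]
    have "((\<lambda>y. cauchy_int s (Complex x y)) has_vector_derivative
        \<i> * (LINT t|lborel. of_real (s t) * (1 / (of_real t - Complex x y)\<^sup>2))) (at y)"
      using that by (simp add: o_def)
    from bounded_linear.has_vector_derivative[OF bounded_linear_Re this]
    show ?thesis unfolding V_def D_def has_real_derivative_iff_has_vector_derivative
      by (rule has_vector_derivative_divide)
  qed
  have Db: "\<bar>D y\<bar> \<le> pi / 2 / y" if "y > 0" for y
  proof -
    have "\<bar>D y\<bar> \<le> (pi\<^sup>2 / 2 / y) / pi"
      unfolding D_def abs_divide abs_of_pos[OF pi_gt_zero]
      using cauchy_int_deriv_bound[of "Complex x y"] that
      by (intro divide_right_mono order_trans[OF abs_Re_le_cmod]) (auto simp: norm_mult)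
    then show ?thesis by (simp add: power2_eq_square)
  qed
  have "V x y1 + pi / 2 * ln y1 \<le> V x y2 + pi / 2 * ln y2"
  proof (rule DERIV_nonneg_imp_nondecreasing[OF y(2)])
    fix u assume u: "y1 \<le> u" "u \<le> y2"
    then have "((\<lambda>y. V x y + pi / 2 * ln y) has_real_derivative (D u + pi / 2 * (1 / u))) (at u)"
      using y by (auto intro!: derivative_eq_intros der)
    moreover have "D u + pi / 2 * (1 / u) \<ge> 0" using Db[of u] u y by (simp add: abs_le_iff)
    ultimately show "\<exists>d. ((\<lambda>y. V x y + pi / 2 * ln y) has_real_derivative d) (at u) \<and> 0 \<le> d" by blast
  qed
  moreover have "- V x y1 + pi / 2 * ln y1 \<le> - V x y2 + pi / 2 * ln y2"
  proof (rule DERIV_nonneg_imp_nondecreasing[OF y(2)])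
    fix u assume u: "y1 \<le> u" "u \<le> y2"
    then have "((\<lambda>y. - V x y + pi / 2 * ln y) has_real_derivative (- D u + pi / 2 * (1 / u))) (at u)"
      using y by (auto intro!: derivative_eq_intros der)
    moreover have "- D u + pi / 2 * (1 / u) \<ge> 0" using Db[of u] u y by (simp add: abs_le_iff)
    ultimately show "\<exists>d. ((\<lambda>y. - V x y + pi / 2 * ln y) has_real_derivative d) (at u) \<and> 0 \<le> d" by blast
  qed
  ultimately show ?thesis
    using y by (simp add: ln_div abs_le_iff right_diff_distrib)
qed

text \<open>Travel from \<i>, where V vanishes, up to height M = 1 + |x| + y, across to x and down
  to y. The crossing costs at most \<pi>/2 because |x| \<le> M, and each vertical leg at most
  (\<pi>/2) ln M.\<close>

lemma V_upper_strip:
  assumes y: "y \<ge> 1"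
  shows "V x y \<le> pi * ln (1 + \<bar>x\<bar> + y) + pi / 2"
proof -
  define M where "M = 1 + \<bar>x\<bar> + y"
  have M: "M \<ge> 1" "M \<ge> y" "\<bar>x\<bar> \<le> M" using y by (auto simp: M_def)
  have "\<bar>V 0 M - V 0 1\<bar> \<le> pi / 2 * ln (M / 1)" by (rule V_vertical) (use M in auto)
  moreover have "\<bar>V x M - V 0 M\<bar> \<le> pi / 2 / M * \<bar>x - 0\<bar>" by (rule V_horizontal) (use M in auto)
  moreover have "\<bar>V x M - V x y\<bar> \<le> pi / 2 * ln (M / y)" by (rule V_vertical) (use M y in auto)
  moreover have "pi / 2 / M * \<bar>x - 0\<bar> \<le> pi / 2" using M by (simp add: divide_simps)
  moreover have "pi / 2 * ln (M / y) \<le> pi / 2 * ln M"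
    using M y by (intro mult_left_mono) (auto simp: ln_div)
  ultimately show ?thesis using V_i unfolding M_def[symmetric] div_by_1 by linarith
qed

text \<open>The conjugate Poisson kernel u / (u^2 + y^2) minus the one at height 1. It is odd and
  decays like |u|^-3.\<close>

definition kern :: "real \<Rightarrow> real \<Rightarrow> real" where
  "kern y u = u * (1 - y\<^sup>2) / ((u\<^sup>2 + y\<^sup>2) * (u\<^sup>2 + 1))"

text \<open>Also used at \<open>y = 0\<close>, where \<open>kern 0 u = 1 / (u * (u\<^sup>2 + 1))\<close> and the
  integrand is bounded near \<open>u = 0\<close> at every point where \<open>s\<close> is Lipschitz.\<close>

definition drop_int :: "real \<Rightarrow> real \<Rightarrow> real" where
  "drop_int x y = (LINT u|lborel. (s (x + u) - s (x - u)) * kern y u) / (2 * pi)"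

lemma kern_mult_le:
  assumes y: "0 \<le> y" "y \<le> 1"
  shows "0 \<le> u * kern y u" "u * kern y u \<le> 1 / (1 + u\<^sup>2)"
proof -
  have eq: "u * kern y u = (u\<^sup>2 * (1 - y\<^sup>2) / (u\<^sup>2 + y\<^sup>2)) * (1 / (1 + u\<^sup>2))"
    by (simp add: kern_def power2_eq_square add.commute)
  have y1: "y\<^sup>2 \<le> 1" using y by (simp add: power_le_one)
  show "0 \<le> u * kern y u" unfolding eq using y1 by simp
  have "u\<^sup>2 * (1 - y\<^sup>2) \<le> u\<^sup>2 + y\<^sup>2"
    using mult_left_mono[of "1 - y\<^sup>2" 1 "u\<^sup>2"] by (simp add: add_increasing2)
  then have "u\<^sup>2 * (1 - y\<^sup>2) / (u\<^sup>2 + y\<^sup>2) \<le> 1"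
  proof (cases "u\<^sup>2 + y\<^sup>2 = 0")
    case False
    then have "u\<^sup>2 + y\<^sup>2 > 0" using sum_power2_ge_zero[of u y] by linarith
    then show ?thesis using \<open>u\<^sup>2 * (1 - y\<^sup>2) \<le> u\<^sup>2 + y\<^sup>2\<close> by (simp only: divide_le_eq_1_pos)
  qed simp
  from mult_right_mono[OF this, of "1 / (1 + u\<^sup>2)"] show "u * kern y u \<le> 1 / (1 + u\<^sup>2)"
    unfolding eq by simp
qed

lemma abs_kern_mult_le:
  assumes y: "0 \<le> y" "y \<le> 1" and d: "\<bar>d\<bar> \<le> K * \<bar>u\<bar>" and K: "K \<ge> 0"
  shows "\<bar>d * kern y u\<bar> \<le> K * (1 / (1 + u\<^sup>2))"
proof (cases "u = 0")
  case False
  have "\<bar>d * kern y u\<bar> \<le> K * \<bar>u\<bar> * \<bar>kern y u\<bar>"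
    unfolding abs_mult by (intro mult_right_mono d) auto
  also have "\<dots> = K * (u * kern y u)"
    using kern_mult_le(1)[OF y, of u] by (simp add: abs_mult[symmetric] mult.assoc)
  also have "\<dots> \<le> K * (1 / (1 + u\<^sup>2))"
    by (intro mult_left_mono kern_mult_le(2)[OF y] K)
  finally show ?thesis .
qed (use K in \<open>auto simp: kern_def\<close>)

lemma measurable_drop [measurable]: "(\<lambda>u. (s (x + u) - s (x - u)) * kern y u) \<in> borel_measurable borel"
  unfolding kern_def using meas_s by measurable

text \<open>Passing from height 1 to height y integrates \<open>s\<close> against the odd kernel
  \<open>kern y\<close>. Averaging the substitutions t = x + u and t = x - u turns \<open>s\<close>
  into its symmetric difference, where the one-sided bound applies; this is the 2 in the
  normalisation 2 \<pi> of \<open>drop_int\<close>.\<close>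

lemma V_minus_V1:
  assumes y: "0 < y" "y \<le> 1"
  shows "V x y = V x 1 + drop_int x y"
proof -
  let ?g = "\<lambda>y t. s t * ((t - x) / ((t - x)\<^sup>2 + y\<^sup>2) - t / (1 + t\<^sup>2))"
  have int: "integrable lborel (\<lambda>t. ?g y t - ?g 1 t)"
    using y by (intro Bochner_Integration.integrable_diff integrable_conj_Poisson) auto
  have eq: "?g y t - ?g 1 t = s t * kern y (t - x)" for t
  proof -
    define u where "u = t - x"
    have nz: "u\<^sup>2 + y\<^sup>2 \<noteq> 0" "u\<^sup>2 + 1 \<noteq> 0"
      using y by (auto simp: sum_power2_eq_zero_iff add_nonneg_eq_0_iff)
    have "u / (u\<^sup>2 + y\<^sup>2) - u / (u\<^sup>2 + 1\<^sup>2) = kern y u"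
      using nz by (simp add: kern_def divide_simps) (simp add: algebra_simps)
    moreover have "?g y t - ?g 1 t = s t * (u / (u\<^sup>2 + y\<^sup>2) - u / (u\<^sup>2 + 1\<^sup>2))"
      unfolding u_def[symmetric] by (simp only: right_diff_distrib)
    ultimately show ?thesis unfolding u_def by simp
  qed
  have int1: "integrable lborel (\<lambda>t. s t * kern y (t - x))" using int unfolding eq .
  have 1: "has_bochner_integral lborel (\<lambda>u. s (x + u) * kern y u) (LINT t|lborel. s t * kern y (t - x))"
    using lborel_has_bochner_integral_real_affine_iff[of 1 "\<lambda>t. s t * kern y (t - x)" _ x]
      has_bochner_integral_integrable[OF int1] by simp
  have 2: "has_bochner_integral lborel (\<lambda>u. s (x - u) * kern y (- u)) (LINT t|lborel. s t * kern y (t - x))"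
    using lborel_has_bochner_integral_real_affine_iff[of "-1" "\<lambda>t. s t * kern y (t - x)" _ x]
      has_bochner_integral_integrable[OF int1] by simp
  have "kern y (- u) = - kern y u" for u by (simp add: kern_def)
  then have "has_bochner_integral lborel (\<lambda>u. (s (x + u) - s (x - u)) * kern y u) (2 * (LINT t|lborel. s t * kern y (t - x)))"
    using has_bochner_integral_add[OF 1 2] by (simp add: left_diff_distrib)
  then have "drop_int x y = (LINT t|lborel. s t * kern y (t - x)) / pi"
    by (simp add: drop_int_def has_bochner_integral_iff)
  also have "(LINT t|lborel. s t * kern y (t - x)) = (LINT t|lborel. ?g y t) - (LINT t|lborel. ?g 1 t)"
    unfolding eq[symmetric] by (rule Bochner_Integration.integral_diff[OF integrable_conj_Poisson[OF y(1)] integrable_conj_Poisson[OF zero_less_one]])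
  finally show ?thesis
    using y by (simp add: V_def Re_cauchy_int diff_divide_distrib)
qed

text \<open>The symmetric difference is at most 2 L u for u > 0 and at least 2 L u for u < 0, and
  \<open>u * kern y u\<close> lies between 0 and 1 / (1 + u^2). Hence 2 L / (1 + u^2) dominates from
  above, whatever the downward jumps do.\<close>

lemma drop_int_le:
  assumes y: "0 \<le> y" "y \<le> 1"
  shows "drop_int x y \<le> L"
proof -
  have "(LINT u|lborel. (s (x + u) - s (x - u)) * kern y u) \<le> (LINT u|lborel. 2 * L * (1 / (1 + u\<^sup>2)))"
  \<comment> \<open>At y = 0 the left integrand may fail to be integrable; its integral is then 0,
    and this rule asks only for an integrable nonnegative majorant.\<close>
  proof (rule integral_mono_AE')
    show "integrable lborel (\<lambda>u::real. 2 * L * (1 / (1 + u\<^sup>2)))"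
      using has_bochner_integral_Cauchy_density by (intro integrable_mult_right) (auto simp: has_bochner_integral_iff)
    have "(s (x + u) - s (x - u)) * kern y u \<le> 2 * L * (1 / (1 + u\<^sup>2))" for u
    proof (cases "u = 0")
      case False
      have "(s (x + u) - s (x - u)) * u \<le> 2 * L * u * u"
      proof (cases "u > 0")
        case True
        then show ?thesis using rise[of "x - u" "x + u"] by (intro mult_right_mono) (auto simp: algebra_simps)
      next
        case F: False
        then have "s (x + u) - s (x - u) \<ge> 2 * L * u"
          using rise[of "x + u" "x - u"] by (simp add: algebra_simps)
        then show ?thesis using F by (intro mult_right_mono_neg) auto
      qed
      from mult_right_mono[OF this kern_mult_le(1)[OF y, of u]]
      have "u\<^sup>2 * ((s (x + u) - s (x - u)) * kern y u) \<le> u\<^sup>2 * (2 * L * (u * kern y u))"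
        by (simp add: power2_eq_square mult_ac)
      then have "(s (x + u) - s (x - u)) * kern y u \<le> 2 * L * (u * kern y u)"
        using False by (simp add: mult_le_cancel_left)
      also have "\<dots> \<le> 2 * L * (1 / (1 + u\<^sup>2))"
        using L by (intro mult_left_mono kern_mult_le y) auto
      finally show ?thesis .
    qed (use L in \<open>auto simp: kern_def\<close>)
    then show "AE u in lborel. (s (x + u) - s (x - u)) * kern y u \<le> 2 * L * (1 / (1 + u\<^sup>2))" by simp
  qed (use L in auto)
  also have "\<dots> = 2 * L * pi"
    using has_bochner_integral_mult_right[OF has_bochner_integral_Cauchy_density, of "2 * L"]
    by (simp only: has_bochner_integral_iff)
  finally show ?thesis unfolding drop_int_def by (simp add: divide_simps mult_ac)
qed

text \<open>\<open>V_upper_strip\<close> bounds V at height at least 1, and below that the descent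
  adds at most L. Since \<pi> < 4, the exponential of \<pi> ln M is at most M^4, and 144 is the
  square of the 12 in M^2 \<le> 12 (1 + x^2 + y^2).\<close>

lemma exp_V_le:
  assumes y: "y > 0"
  shows "exp (V x y) \<le> 144 * exp (L + pi / 2) * (1 + x\<^sup>2 + y\<^sup>2)\<^sup>2"
proof -
  define M where "M = 2 + \<bar>x\<bar> + y"
  have M: "M \<ge> 1" using y by (simp add: M_def)
  have "V x y \<le> pi * ln M + pi / 2 + L"
  proof (cases "y \<ge> 1")
    case True
    have "V x y \<le> pi * ln (1 + \<bar>x\<bar> + y) + pi / 2" by (rule V_upper_strip[OF True])
    also have "ln (1 + \<bar>x\<bar> + y) \<le> ln M" using y by (simp add: M_def)
    finally show ?thesis using L by (simp add: mult_left_mono)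
  next
    case False
    have "V x y = V x 1 + drop_int x y" using False y by (intro V_minus_V1) auto
    moreover have "drop_int x y \<le> L" using False y by (intro drop_int_le) auto
    moreover have "V x 1 \<le> pi * ln (1 + \<bar>x\<bar> + 1) + pi / 2" by (rule V_upper_strip) simp
    moreover have "pi * ln (1 + \<bar>x\<bar> + 1) \<le> pi * ln M" using y by (intro mult_left_mono) (auto simp: M_def)
    ultimately show ?thesis by linarith
  qed
  also have "pi * ln M \<le> 4 * ln M"
    using M pi_less_4 by (intro mult_right_mono) auto
  finally have "V x y \<le> (L + pi / 2) + 4 * ln M" by simp
  then have "exp (V x y) \<le> exp ((L + pi / 2) + 4 * ln M)" by simp
  also have "\<dots> = exp (L + pi / 2) * M ^ 4"
    using M by (simp add: exp_add exp_of_nat_mult[of 4 "ln M", simplified])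
  also have "M ^ 4 \<le> (12 * (1 + x\<^sup>2 + y\<^sup>2))\<^sup>2"
  proof -
    have "M\<^sup>2 \<le> 12 * (1 + x\<^sup>2 + y\<^sup>2)"
    proof -
      have "(a + b + c)\<^sup>2 \<le> 3 * (a\<^sup>2 + b\<^sup>2 + c\<^sup>2)" for a b c :: real
        using zero_le_power2[of "a - b"] zero_le_power2[of "b - c"] zero_le_power2[of "a - c"]
        by (simp add: power2_eq_square algebra_simps)
      from this[of 2 "\<bar>x\<bar>" y] have "M\<^sup>2 \<le> 12 + 3 * x\<^sup>2 + 3 * y\<^sup>2" by (simp add: M_def)
      also have "\<dots> \<le> 12 * (1 + x\<^sup>2 + y\<^sup>2)"
      proof -
        have "12 + 3 * X + 3 * Y \<le> 12 * (1 + X + Y)" if "X \<ge> 0" "Y \<ge> 0" for X Y :: real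
          using that by simp
        then show ?thesis by simp
      qed
      finally show ?thesis .
    qed
    from power_mono[OF this, of 2] show ?thesis by (simp flip: power_mult)
  qed
  then have "exp (L + pi / 2) * M ^ 4 \<le> exp (L + pi / 2) * (12 * (1 + x\<^sup>2 + y\<^sup>2))\<^sup>2"
    by (rule mult_left_mono) simp
  also have "\<dots> = 144 * exp (L + pi / 2) * (1 + x\<^sup>2 + y\<^sup>2)\<^sup>2"
    unfolding power_mult_distrib by simp
  finally show ?thesis .
qed

text \<open>The formula of \<open>V_minus_V1\<close> read at y = 0. It makes sense at every x and is
  visibly measurable, though it is shown to be the limit of V only where the symmetric differences
  of \<open>s\<close> are O(|u|).\<close>

definition V0 :: "real \<Rightarrow> real" where
  "V0 x = V x 1 + drop_int x 0"

lemma V_tendsto_V0: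
  assumes K: "\<And>u. \<bar>s (x + u) - s (x - u)\<bar> \<le> K * \<bar>u\<bar>"
    and Y: "\<And>n. Y n > 0" "\<And>n. Y n \<le> 1" "Y \<longlonglongrightarrow> 0"
  shows "(\<lambda>n. V x (Y n)) \<longlonglongrightarrow> V0 x"
proof -
  have K0: "K \<ge> 0" using order_trans[OF abs_ge_zero K[of 1]] by simp
  have "(\<lambda>n. LINT u|lborel. (s (x + u) - s (x - u)) * kern (Y n) u) \<longlonglongrightarrow> (LINT u|lborel. (s (x + u) - s (x - u)) * kern 0 u)"
  proof (rule integral_dominated_convergence[where w="\<lambda>u. K * (1 / (1 + u\<^sup>2))"])
    show "integrable lborel (\<lambda>u::real. K * (1 / (1 + u\<^sup>2)))"
      using has_bochner_integral_Cauchy_density by (intro integrable_mult_right) (auto simp: has_bochner_integral_iff)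
    show "AE u in lborel. norm ((s (x + u) - s (x - u)) * kern (Y n) u) \<le> K * (1 / (1 + u\<^sup>2))" for n
      unfolding real_norm_def using K Y K0 by (intro AE_I2 abs_kern_mult_le) (auto intro: less_imp_le)
    show "AE u in lborel. (\<lambda>n. (s (x + u) - s (x - u)) * kern (Y n) u) \<longlonglongrightarrow> (s (x + u) - s (x - u)) * kern 0 u"
      using AE_lborel_singleton[of 0]
    proof eventually_elim
      case (elim u)
      have "u\<^sup>2 + 1 \<noteq> 0" by (simp add: add_nonneg_eq_0_iff)
      then show ?case using elim unfolding kern_def by (intro tendsto_intros Y) auto
    qed
  qed measurable
  then have "(\<lambda>n. drop_int x (Y n)) \<longlonglongrightarrow> drop_int x 0"
    unfolding drop_int_def by (intro tendsto_intros) auto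
  then have "(\<lambda>n. V x 1 + drop_int x (Y n)) \<longlonglongrightarrow> V0 x"
    unfolding V0_def by (intro tendsto_intros)
  moreover have "V x (Y n) = V x 1 + drop_int x (Y n)" for n by (rule V_minus_V1[OF Y(1,2)])
  ultimately show ?thesis by simp
qed

text \<open>At height 1, V falls by at most (\<pi>/2) |x| from its value 0 at \<i>. A two-sided
  bound on the symmetric difference then limits the descent to K \<pi> / (2 \<pi>).\<close>

lemma V0_ge:
  assumes K: "\<And>u. \<bar>s (x + u) - s (x - u)\<bar> \<le> K * \<bar>u\<bar>"
  shows "V0 x \<ge> - (pi / 2 * \<bar>x\<bar>) - K / 2"
proof -
  have K0: "K \<ge> 0" using order_trans[OF abs_ge_zero K[of 1]] by simp
  have "\<bar>V x 1 - V 0 1\<bar> \<le> pi / 2 / 1 * \<bar>x - 0\<bar>" by (rule V_horizontal) simp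
  then have "V x 1 \<ge> - (pi / 2 * \<bar>x\<bar>)" using V_i by (simp add: abs_le_iff)
  moreover have "\<bar>LINT u|lborel. (s (x + u) - s (x - u)) * kern 0 u\<bar> \<le> K * pi"
  proof -
    have I: "integrable lborel (\<lambda>u::real. K * (1 / (1 + u\<^sup>2)))"
      using has_bochner_integral_Cauchy_density by (intro integrable_mult_right) (auto simp: has_bochner_integral_iff)
    have b: "\<bar>(s (x + u) - s (x - u)) * kern 0 u\<bar> \<le> K * (1 / (1 + u\<^sup>2))" for u
      by (rule abs_kern_mult_le[OF _ _ K K0]) auto
    have "integrable lborel (\<lambda>u. (s (x + u) - s (x - u)) * kern 0 u)"
    proof (rule Bochner_Integration.integrable_bound[OF I])
      show "AE u in lborel. norm ((s (x + u) - s (x - u)) * kern 0 u) \<le> norm (K * (1 / (1 + u\<^sup>2)))"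
        unfolding real_norm_def by (intro AE_I2 order_trans[OF b abs_ge_self])
    qed measurable
    then have "norm (LINT u|lborel. (s (x + u) - s (x - u)) * kern 0 u) \<le> (LINT u|lborel. K * (1 / (1 + u\<^sup>2)))"
      by (rule Bochner_Integration.integral_norm_bound_integral) (use I b in auto)
    also have "\<dots> = K * pi"
      using has_bochner_integral_mult_right[OF has_bochner_integral_Cauchy_density, of K]
      by (simp only: has_bochner_integral_iff)
    finally show ?thesis by simp
  qed
  then have "drop_int x 0 \<ge> - (K / 2)"
    unfolding drop_int_def by (simp add: abs_le_iff field_simps)
  ultimately show ?thesis unfolding V0_def by linarith
qed

text \<open>At a point of continuity the limit holds along every sequence of heights, so it is
  compatible with the sequence selected for \<Omega>.\<close>

lemma Im_cauchy_int_tendsto: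
  assumes cont: "isCont s x" and Y: "\<And>n. Y n > 0" "Y \<longlonglongrightarrow> 0"
  shows "(\<lambda>n. Im (cauchy_int s (Complex x (Y n)))) \<longlonglongrightarrow> pi * s x"
proof -
  have [measurable]: "s \<in> borel_measurable borel" by (rule meas_s)
  have eq: "Im (cauchy_int s (Complex x y)) = (LINT v|lborel. s (x + y * v) * (1 / (1 + v\<^sup>2)))" if y: "y > 0" for y
  proof -
    have "Im (cauchy_int s (Complex x y)) = y * (LINT v|lborel. s (x + y * v) * (y / ((x + y * v - x)\<^sup>2 + y\<^sup>2)))"
      unfolding Im_cauchy_int[OF y] using y
      by (subst lborel_integral_real_affine[where c=y and t=x]) auto
    also have "\<dots> = (LINT v|lborel. y * (s (x + y * v) * (y / ((x + y * v - x)\<^sup>2 + y\<^sup>2))))"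
      by (rule integral_mult_right_zero[symmetric])
    also have "\<dots> = (LINT v|lborel. s (x + y * v) * (1 / (1 + v\<^sup>2)))"
      unfolding affine_Cauchy_density[OF y] using y by simp
    finally show ?thesis .
  qed
  have "(\<lambda>n. LINT v|lborel. s (x + Y n * v) * (1 / (1 + v\<^sup>2))) \<longlonglongrightarrow> (LINT v|lborel. s x * (1 / (1 + v\<^sup>2)))"
  proof (rule integral_dominated_convergence[where w="\<lambda>u. pi / 2 * (1 / (1 + u\<^sup>2))"])
    show "integrable lborel (\<lambda>u::real. pi / 2 * (1 / (1 + u\<^sup>2)))"
      using has_bochner_integral_Cauchy_density by (intro integrable_mult_right) (auto simp: has_bochner_integral_iff)
    show "AE v in lborel. norm (s (x + Y n * v) * (1 / (1 + v\<^sup>2))) \<le> pi / 2 * (1 / (1 + v\<^sup>2))" for n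
      unfolding norm_mult using bounded by (intro AE_I2 mult_mono) auto
    show "AE v in lborel. (\<lambda>n. s (x + Y n * v) * (1 / (1 + v\<^sup>2))) \<longlonglongrightarrow> s x * (1 / (1 + v\<^sup>2))"
    proof (rule AE_I2)
      fix v :: real
      have "(\<lambda>n. x + Y n * v) \<longlonglongrightarrow> x + 0 * v" by (intro tendsto_intros Y)
      then have "(\<lambda>n. s (x + Y n * v)) \<longlonglongrightarrow> s x" using isCont_tendsto_compose[OF cont] by simp
      then show "(\<lambda>n. s (x + Y n * v) * (1 / (1 + v\<^sup>2))) \<longlonglongrightarrow> s x * (1 / (1 + v\<^sup>2))"
        by (intro tendsto_intros)
    qed
  qed measurable
  moreover have "(LINT v|lborel. s x * (1 / (1 + v\<^sup>2))) = pi * s x"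
    using has_bochner_integral_mult_right[OF has_bochner_integral_Cauchy_density, of "s x"]
    by (simp only: has_bochner_integral_iff mult.commute[of pi])
  ultimately show ?thesis using Y by (simp add: eq)
qed

end

section \<open>Phase and sawtooth\<close>

lemma AE_le_of_Linf_norm:
  assumes f: "f \<in> borel_measurable lebesgue" and le: "Linf_norm f \<le> ereal M"
  shows "AE x in lebesgue. \<bar>f x\<bar> \<le> M"
proof -
  have "AE x in lebesgue. ereal \<bar>f x\<bar> \<le> esssup lebesgue (\<lambda>x. ereal \<bar>f x\<bar>)"
    by (rule esssup_AE)
  then show ?thesis
    by eventually_elim (use le in \<open>auto simp: Linf_norm_def dest: order_trans\<close>)
qed

text \<open>Only the Henstock-Kurzweil fundamental theorem applies: the derivative exists
  everywhere but need not be continuous.\<close>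

lemma lipschitz_of_AE_deriv_bound:
  fixes h :: "real \<Rightarrow> real"
  assumes diff: "\<And>x. h differentiable (at x)"
    and AE: "AE x in lebesgue. \<bar>deriv h x\<bar> \<le> M" and M: "M \<ge> 0" and ab: "a \<le> b"
  shows "\<bar>h b - h a\<bar> \<le> M * (b - a)"
proof -
  \<comment> \<open>The derivative with its exceptional values replaced by 0: the bound holds
    everywhere and the integral is unchanged.\<close>
  define g where "g x = (if \<bar>deriv h x\<bar> \<le> M then deriv h x else 0)" for x
  have der: "(h has_real_derivative deriv h x) (at x)" for x
    using diff[of x] by (simp add: DERIV_deriv_iff_real_differentiable)
  have "(deriv h has_integral (h b - h a)) {a..b}"
    using der by (intro fundamental_theorem_of_calculus ab)
      (auto simp: has_real_derivative_iff_has_vector_derivative[symmetric] intro: has_field_derivative_at_within)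
  moreover obtain N where N: "{x. \<not> \<bar>deriv h x\<bar> \<le> M} \<subseteq> N" "N \<in> null_sets lebesgue"
    using AE by (auto simp: eventually_ae_filter)
  then have "negligible N" by (simp add: negligible_iff_null_sets)
  then have "(g has_integral (h b - h a)) {a..b} \<longleftrightarrow> (deriv h has_integral (h b - h a)) {a..b}"
    by (rule has_integral_spike_eq) (use N in \<open>auto simp: g_def\<close>)
  ultimately have "(g has_integral (h b - h a)) {a..b}" by simp
  then have "norm (h b - h a) \<le> M * measure lborel (cbox a b)"
    by (intro has_integral_bound[of M g]) (use M in \<open>auto simp: g_def\<close>)
  then show ?thesis using ab by simp
qed

locale phase =
  fixes \<theta> :: "real \<Rightarrow> real" and L :: real
  assumes incr: "a < b \<Longrightarrow> \<theta> a < \<theta> b"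
    and lip: "a \<le> b \<Longrightarrow> \<theta> b - \<theta> a \<le> L * (b - a)"
    and L0: "L \<ge> 0"
begin

definition jump :: "real \<Rightarrow> int" where "jump t = round (\<theta> t / pi)"

definition saw :: "real \<Rightarrow> real" where "saw t = \<theta> t - pi * of_int (jump t)"

lemma theta_mono: "a \<le> b \<Longrightarrow> \<theta> a \<le> \<theta> b"
  using incr[of a b] by (cases "a = b") auto

lemma abs_theta_diff_le: "\<bar>\<theta> b - \<theta> a\<bar> \<le> L * \<bar>b - a\<bar>"
  using lip[of a b] lip[of b a] theta_mono[of a b] theta_mono[of b a] by (cases "a \<le> b") auto

lemma isCont_theta: "isCont \<theta> x"
proof -
  have "(\<lambda>t. \<theta> t - \<theta> x) \<midarrow>x\<rightarrow> 0"
  proof (rule tendsto_0_le[where K=L])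
    show "(\<lambda>t. \<bar>t - x\<bar>) \<midarrow>x\<rightarrow> 0"
      by (intro tendsto_rabs_zero LIM_zero tendsto_ident_at)
    show "eventually (\<lambda>t. norm (\<theta> t - \<theta> x) \<le> norm \<bar>t - x\<bar> * L) (at x)"
      by (intro always_eventually allI) (use abs_theta_diff_le in \<open>simp add: mult.commute\<close>)
  qed
  then show ?thesis unfolding isCont_def by (rule LIM_zero_cancel)
qed

lemma jump_mono: "a \<le> b \<Longrightarrow> jump a \<le> jump b"
  unfolding jump_def by (intro round_mono divide_right_mono theta_mono) auto

text \<open>Since \<open>jump\<close> increases with \<theta>, subtracting it can only reduce a
  rise; this is where the monotonicity of the phase pays off.\<close>

sublocale one_sided_lipschitz saw L
proof
  have "mono (\<lambda>t. real_of_int (jump t))" "mono \<theta>"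
    using jump_mono theta_mono by (auto intro!: monoI)
  then have [measurable]: "(\<lambda>t. real_of_int (jump t)) \<in> borel_measurable borel" "\<theta> \<in> borel_measurable borel"
    by (auto intro: borel_measurable_mono)
  show "saw \<in> borel_measurable borel" unfolding saw_def by measurable
  show "\<bar>saw t\<bar> \<le> pi / 2" for t
  proof -
    have "saw t = - (pi * (of_int (jump t) - \<theta> t / pi))" by (simp add: saw_def algebra_simps)
    then have "\<bar>saw t\<bar> = pi * \<bar>of_int (jump t) - \<theta> t / pi\<bar>" by (simp add: abs_mult)
    also have "\<dots> \<le> pi * (1 / 2)"
      unfolding jump_def by (intro mult_left_mono of_int_round_abs_le) auto
    finally show ?thesis by simp
  qed
  show "saw b - saw a \<le> L * (b - a)" if "a \<le> b" for a b
  proof -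
    have "pi * real_of_int (jump a) \<le> pi * real_of_int (jump b)"
      using jump_mono[OF that] by simp
    then show ?thesis using lip[OF that] unfolding saw_def by linarith
  qed
qed (rule L0)

section \<open>Regularity of the sawtooth off its jumps\<close>

lemma AE_theta_between:
  "AE x in lborel. real_of_int (jump x) - 1 / 2 < \<theta> x / pi \<and> \<theta> x / pi < real_of_int (jump x) + 1 / 2"
proof -
  define B where "B = {x. \<theta> x \<in> range (\<lambda>k::int. pi * (real_of_int k + 1 / 2))}"
  \<comment> \<open>Strict monotonicity is essential: the jump levels form a countable set, and an
    injective \<theta> pulls it back to a countable one.\<close>
  have "inj \<theta>" by (rule linorder_injI) (use incr in \<open>auto dest: less_imp_neq\<close>)
  moreover have "countable (\<theta> ` B)"
    by (rule countable_subset[of _ "range (\<lambda>k::int. pi * (real_of_int k + 1 / 2))"]) (auto simp: B_def)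
  ultimately have "countable B"
    by (meson countable_image_inj_on inj_on_subset subset_UNIV)
  then have "B \<in> null_sets lborel" by (rule countable_imp_null_set_lborel)
  then have "AE x in lborel. x \<notin> B" by (rule AE_not_in)
  then show ?thesis
  proof eventually_elim
    case (elim x)
    have "\<bar>of_int (jump x) - \<theta> x / pi\<bar> \<le> 1 / 2" unfolding jump_def by (rule of_int_round_abs_le)
    moreover have "\<theta> x / pi \<noteq> real_of_int (jump x) + 1 / 2"
      using elim by (auto simp: B_def field_simps)
    moreover have "\<theta> x / pi \<noteq> real_of_int (jump x) - 1 / 2"
    proof
      assume "\<theta> x / pi = real_of_int (jump x) - 1 / 2"
      then have "\<theta> x = pi * (real_of_int (jump x - 1) + 1 / 2)" by (simp add: field_simps)
      then show False using elim unfolding B_def by blast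
    qed
    ultimately show ?case by (intro conjI) linarith+
  qed
qed

lemma round_eq_of_between:
  assumes "real_of_int n - 1 / 2 < r" "r < real_of_int n + 1 / 2"
  shows "round r = n"
  using assms unfolding round_def by (intro floor_unique) auto

lemma saw_locally_lipschitz:
  assumes x: "real_of_int (jump x) - 1 / 2 < \<theta> x / pi" "\<theta> x / pi < real_of_int (jump x) + 1 / 2"
  obtains d where "d > 0" "\<And>t. \<bar>t - x\<bar> < d \<Longrightarrow> saw t = \<theta> t - pi * of_int (jump x)"
proof -
  have "isCont (\<lambda>t. \<theta> t / pi) x" by (intro continuous_intros isCont_theta) auto
  then have lim: "((\<lambda>t. \<theta> t / pi) \<longlongrightarrow> \<theta> x / pi) (nhds x)"
    unfolding isCont_def by (rule iffD1[OF tendsto_at_iff_tendsto_nhds])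
  have "eventually (\<lambda>t. real_of_int (jump x) - 1 / 2 < \<theta> t / pi \<and> \<theta> t / pi < real_of_int (jump x) + 1 / 2) (nhds x)"
    using order_tendstoD[OF lim] x by (intro eventually_conj) auto
  then obtain d where d: "d > 0"
    "\<And>t. dist t x < d \<Longrightarrow> real_of_int (jump x) - 1 / 2 < \<theta> t / pi \<and> \<theta> t / pi < real_of_int (jump x) + 1 / 2"
    unfolding eventually_nhds_metric by blast
  have "saw t = \<theta> t - pi * of_int (jump x)" if "\<bar>t - x\<bar> < d" for t
    using round_eq_of_between[of "jump x" "\<theta> t / pi"] d(2)[of t] that by (simp add: saw_def jump_def dist_real_def)
  then show thesis using that d(1) by blast
qed

lemma abs_saw_diff_le_pi: "\<bar>saw a - saw b\<bar> \<le> pi"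
  using bounded[of a] bounded[of b] by linarith

text \<open>Within the distance d to the nearest jump the Lipschitz bound of \<theta> applies.
  Beyond it the oscillation is at most \<pi>, hence at most (\<pi> / d) |u|. The constant depends on
  x, which pointwise limits allow.\<close>

lemma AE_saw_regular:
  "AE x in lborel. isCont saw x \<and> (\<exists>K. \<forall>u. \<bar>saw (x + u) - saw (x - u)\<bar> \<le> K * \<bar>u\<bar>)"
  using AE_theta_between
proof eventually_elim
  case (elim x)
  then obtain d where d: "d > 0" "\<And>t. \<bar>t - x\<bar> < d \<Longrightarrow> saw t = \<theta> t - pi * of_int (jump x)"
    using saw_locally_lipschitz by metis
  have ev: "eventually (\<lambda>t. saw t = \<theta> t - pi * of_int (jump x)) (nhds x)"
    unfolding eventually_nhds_metric using d by (auto simp: dist_real_def)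
  have "isCont saw x \<longleftrightarrow> isCont (\<lambda>t. \<theta> t - pi * of_int (jump x)) x"
    by (rule isCont_cong[OF ev])
  then have "isCont saw x" by (auto intro!: continuous_intros isCont_theta)
  moreover have "\<bar>saw (x + u) - saw (x - u)\<bar> \<le> (2 * L + pi / d) * \<bar>u\<bar>" for u
  proof (cases "\<bar>u\<bar> < d")
    case True
    then have "\<bar>saw (x + u) - saw (x - u)\<bar> \<le> L * \<bar>2 * u\<bar>"
      using d(2)[of "x + u"] d(2)[of "x - u"] abs_theta_diff_le[of "x + u" "x - u"] by simp
    also have "\<dots> \<le> (2 * L + pi / d) * \<bar>u\<bar>" using d(1) by (simp add: distrib_right abs_mult)
    finally show ?thesis .
  next
    case False
    have "\<bar>saw (x + u) - saw (x - u)\<bar> \<le> pi" by (rule abs_saw_diff_le_pi)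
    also have "\<dots> \<le> pi / d * \<bar>u\<bar>" using False d(1) by (simp add: divide_simps)
    also have "\<dots> \<le> (2 * L + pi / d) * \<bar>u\<bar>" using L0 by (intro mult_right_mono) auto
    finally show ?thesis .
  qed
  ultimately show ?case by blast
qed

text \<open>Since L * 5/4 < \<pi>/2, no jump occurs within 5/4 of 3/4, and x + u, x - u stay in that
  range for |u| \<le> 1. There 2 L \<le> \<pi>; for larger |u| the oscillation is at most \<pi>. So
  \<open>V0_ge\<close> applies with K = \<pi>.\<close>

lemma V0_ge_window:
  assumes L: "L < pi / 5" and \<theta>0: "\<theta> (3/4) = 0" and x: "1/2 < x" "x < 1"
  shows "V0 x \<ge> - pi"
proof -
  have saw: "saw t = \<theta> t" if "\<bar>t - 3/4\<bar> \<le> 5/4" for t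
  proof -
    have "\<bar>\<theta> t\<bar> \<le> L * \<bar>t - 3/4\<bar>" using abs_theta_diff_le[of t "3/4"] \<theta>0 by simp
    also have "\<dots> \<le> L * (5/4)" using that L0 by (intro mult_left_mono) auto
    also have "\<dots> < pi / 2" using L pi_gt_zero by linarith
    finally have "\<bar>\<theta> t / pi\<bar> < 1 / 2" by (simp add: divide_simps)
    then have "jump t = 0" unfolding jump_def by (intro round_eq_of_between; unfold of_int_0) linarith+
    then show ?thesis by (simp add: saw_def)
  qed
  have "\<bar>saw (x + u) - saw (x - u)\<bar> \<le> pi * \<bar>u\<bar>" for u
  proof (cases "\<bar>u\<bar> \<le> 1")
    case True
    have "saw (x + u) = \<theta> (x + u)" "saw (x - u) = \<theta> (x - u)"
      by (rule saw, use True x in linarith)+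
    then have "\<bar>saw (x + u) - saw (x - u)\<bar> \<le> L * \<bar>2 * u\<bar>"
      using abs_theta_diff_le[of "x + u" "x - u"] by simp
    also have "\<dots> = 2 * L * \<bar>u\<bar>" by (simp add: abs_mult)
    also have "\<dots> \<le> pi * \<bar>u\<bar>" by (intro mult_right_mono, use L pi_gt_zero in linarith) simp
    finally show ?thesis .
  next
    case False
    have "\<bar>saw (x + u) - saw (x - u)\<bar> \<le> pi * 1" using abs_saw_diff_le_pi by simp
    also have "\<dots> \<le> pi * \<bar>u\<bar>" using False by (intro mult_left_mono) auto
    finally show ?thesis .
  qed
  from V0_ge[OF this] have "V0 x \<ge> - (pi / 2 * \<bar>x\<bar>) - pi / 2" .
  moreover have "pi / 2 * \<bar>x\<bar> \<le> pi / 2 * 1" using x by (intro mult_left_mono) auto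
  ultimately show ?thesis by linarith
qed

end

section \<open>Sixth power of the sinc function\<close>

text \<open>Division by zero gives the value 0 rather than 1 at the origin. The open half-plane
  avoids that point, and on the real line it is a null set.\<close>

definition sinc6 :: "real \<Rightarrow> complex \<Rightarrow> complex" where
  "sinc6 \<epsilon> z = (sin (of_real \<epsilon> * z) / (of_real \<epsilon> * z)) ^ 6"

lemma cmod_exp_i_le: "cmod (exp (\<i> * w)) \<le> exp \<bar>Im w\<bar>" "cmod (exp (- (\<i> * w))) \<le> exp \<bar>Im w\<bar>"
  by (simp_all add: norm_exp_eq_Re)

lemma cmod_sin_le: "cmod (sin w) \<le> exp \<bar>Im w\<bar>"
proof -
  have "cmod (exp (\<i> * w) - exp (- (\<i> * w))) \<le> exp \<bar>Im w\<bar> + exp \<bar>Im w\<bar>"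
    by (rule order_trans[OF norm_triangle_ineq4 add_mono[OF cmod_exp_i_le]])
  then show ?thesis unfolding sin_exp_eq by (simp add: norm_divide norm_mult)
qed

lemma cmod_cos_le: "cmod (cos w) \<le> exp \<bar>Im w\<bar>"
proof -
  have "cmod (exp (\<i> * w) + exp (- (\<i> * w))) \<le> exp \<bar>Im w\<bar> + exp \<bar>Im w\<bar>"
    by (rule order_trans[OF norm_triangle_ineq add_mono[OF cmod_exp_i_le]])
  then show ?thesis unfolding cos_exp_eq by (simp add: norm_divide)
qed

lemma cmod_sin_le_mult: "cmod (sin w) \<le> exp \<bar>Im w\<bar> * cmod w"
proof -
  have "cmod (sin 0 - sin w) \<le> exp \<bar>Im w\<bar> * cmod (0 - w)"
  proof (rule field_differentiable_bound[of "closed_segment 0 w"])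
    fix v assume "v \<in> closed_segment 0 w"
    then obtain r where r: "0 \<le> r" "r \<le> 1" "v = r *\<^sub>R w" by (auto simp: in_segment)
    show "(sin has_field_derivative cos v) (at v within closed_segment 0 w)"
      by (auto intro!: derivative_eq_intros)
    have "\<bar>Im v\<bar> \<le> \<bar>Im w\<bar>" using r by (simp add: abs_mult mult_left_le_one_le)
    then show "cmod (cos v) \<le> exp \<bar>Im w\<bar>"
      using cmod_cos_le[of v] by (meson exp_le_cancel_iff order_trans)
  qed auto
  then show ?thesis by simp
qed

text \<open>The summand 1 uses |sin w| \<le> |w| exp |Im w|, the summand |w|^2 uses |sin w| \<le>
  exp |Im w|.\<close>

lemma cmod_sinc6_le_aux: "(1 + (cmod w)\<^sup>2) * (cmod (sin w / w))\<^sup>2 \<le> 2 * exp (2 * \<bar>Im w\<bar>)"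
proof (cases "w = 0")
  case False
  have "cmod (sin w / w) \<le> exp \<bar>Im w\<bar>"
    using cmod_sin_le_mult[of w] False by (simp add: norm_divide divide_simps)
  then have "(cmod (sin w / w))\<^sup>2 \<le> (exp \<bar>Im w\<bar>)\<^sup>2" by (intro power_mono) auto
  moreover have "(cmod w)\<^sup>2 * (cmod (sin w / w))\<^sup>2 \<le> (exp \<bar>Im w\<bar>)\<^sup>2"
  proof -
    have "(cmod w)\<^sup>2 * (cmod (sin w / w))\<^sup>2 = (cmod (sin w))\<^sup>2"
      using False by (simp add: norm_divide power_divide)
    then show ?thesis using cmod_sin_le[of w] by (simp add: power_mono)
  qed
  moreover have "(exp \<bar>Im w\<bar>)\<^sup>2 = exp (2 * \<bar>Im w\<bar>)" by (rule exp_double[symmetric])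
  ultimately show ?thesis by (simp add: distrib_right)
qed simp

text \<open>The cube of the preceding estimate at w = \<epsilon> z, with \<epsilon>^2 (1 + |z|^2)
  \<le> 1 + |w|^2 because \<epsilon> \<le> 1. This is the source of the sixth power in the final
  bound.\<close>

lemma cmod_sinc6_le:
  assumes e: "0 < \<epsilon>" "\<epsilon> \<le> 1"
  shows "\<epsilon> ^ 6 * cmod (sinc6 \<epsilon> z) * (1 + (cmod z)\<^sup>2) ^ 3 \<le> 8 * exp (6 * \<epsilon> * \<bar>Im z\<bar>)"
proof -
  define w where "w = of_real \<epsilon> * z"
  define r where "r = cmod (sin w / w)"
  have "\<epsilon>\<^sup>2 * (1 + (cmod z)\<^sup>2) \<le> 1 + (cmod w)\<^sup>2"
    using e power_le_one[of \<epsilon> 2] by (simp add: w_def norm_mult power_mult_distrib distrib_left)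
  then have "\<epsilon>\<^sup>2 * (1 + (cmod z)\<^sup>2) * r\<^sup>2 \<le> (1 + (cmod w)\<^sup>2) * r\<^sup>2" by (rule mult_right_mono) simp
  also have "\<dots> \<le> 2 * exp (2 * \<bar>Im w\<bar>)" unfolding r_def by (rule cmod_sinc6_le_aux)
  finally have "(\<epsilon>\<^sup>2 * (1 + (cmod z)\<^sup>2) * r\<^sup>2) ^ 3 \<le> (2 * exp (2 * \<bar>Im w\<bar>)) ^ 3"
    by (intro power_mono) auto
  moreover have "(\<epsilon>\<^sup>2 * (1 + (cmod z)\<^sup>2) * r\<^sup>2) ^ 3 = \<epsilon> ^ 6 * cmod (sinc6 \<epsilon> z) * (1 + (cmod z)\<^sup>2) ^ 3"
  proof -
    have "cmod (sinc6 \<epsilon> z) = r ^ 6" by (simp add: sinc6_def r_def w_def norm_power)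
    then show ?thesis by (simp add: power_mult_distrib flip: power_mult)
  qed
  moreover have "(2 * exp (2 * \<bar>Im w\<bar>)) ^ 3 = 8 * exp (6 * \<epsilon> * \<bar>Im z\<bar>)"
    using e by (simp add: power_mult_distrib exp_of_nat_mult[of 3, symmetric, simplified] w_def abs_mult)
  ultimately show ?thesis by simp
qed

text \<open>On [0, 1] the cosine is at least cos (\<pi>/3) = 1/2, because \<pi> > 3.\<close>

lemma sin_ge_half:
  fixes v :: real
  assumes "0 \<le> v" "v \<le> 1"
  shows "v / 2 \<le> sin v"
proof -
  have "sin 0 - 0 / 2 \<le> sin v - v / 2"
  proof (rule DERIV_nonneg_imp_nondecreasing[OF assms(1)])
    fix u assume u: "0 \<le> u" "u \<le> v"
    have "cos (pi / 3) \<le> cos u"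
      using u assms pi_gt3 by (intro cos_monotone_0_pi_le) auto
    then have "cos u - 1 / 2 \<ge> 0" by (simp add: cos_60)
    moreover have "((\<lambda>u. sin u - u / 2) has_real_derivative (cos u - 1 / 2)) (at u)"
      by (auto intro!: derivative_eq_intros)
    ultimately show "\<exists>d. ((\<lambda>u. sin u - u / 2) has_real_derivative d) (at u) \<and> 0 \<le> d" by blast
  qed
  then show ?thesis by simp
qed

lemma sinc6_of_real: "sinc6 \<epsilon> (of_real x) = of_real ((sin (\<epsilon> * x) / (\<epsilon> * x)) ^ 6)"
  unfolding sinc6_def by (simp flip: of_real_mult sin_of_real)

lemma cmod_sinc6_ge:
  assumes e: "0 < \<epsilon>" "\<epsilon> \<le> 1" and x: "0 < x" "x \<le> 1"
  shows "cmod (sinc6 \<epsilon> (of_real x)) \<ge> 1 / 64"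
proof -
  have v: "0 < \<epsilon> * x" "\<epsilon> * x \<le> 1" using e x by (auto intro: mult_le_one)
  have "1 / 2 \<le> sin (\<epsilon> * x) / (\<epsilon> * x)"
    using sin_ge_half[of "\<epsilon> * x"] v by (simp add: divide_simps)
  then have "(1 / 2) ^ 6 \<le> (sin (\<epsilon> * x) / (\<epsilon> * x)) ^ 6" by (rule power_mono) simp
  also have "\<dots> \<le> cmod (sinc6 \<epsilon> (of_real x))" unfolding sinc6_of_real norm_of_real by simp
  finally show ?thesis by (simp add: power_divide)
qed

lemma sinc6_holomorphic:
  assumes "\<epsilon> > 0"
  shows "sinc6 \<epsilon> holomorphic_on {z. Im z > 0}"
  unfolding sinc6_def using assms by (intro holomorphic_intros) auto

lemma isCont_sinc6: "\<epsilon> > 0 \<Longrightarrow> z \<noteq> 0 \<Longrightarrow> isCont (sinc6 \<epsilon>) z"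
  unfolding sinc6_def by (intro continuous_intros) auto

section \<open>The multiplier\<close>

lemma mult_rearrange:
  fixes k a b :: "'a::comm_monoid_mult"
  assumes "x * y = u * (v * w)"
  shows "k * a * b * x * y = k * u * (b * v * a * w)"
proof -
  have "k * a * b * x * y = k * a * b * (x * y)" by (simp only: mult.assoc)
  also have "\<dots> = k * u * (b * v * a * w)" unfolding assms by (simp only: mult_ac)
  finally show ?thesis .
qed

text \<open>Here \<Omega> is already a Borel representative of - ln \<omega>, \<open>B\<close>
  encodes \<omega> \<le> exp B a.e., and only the Lipschitz consequence of the derivative bound on
  \<open>h\<close> is retained.\<close>

locale admissible_weight = log_weight \<Omega> for \<Omega> :: "real \<Rightarrow> real" +
  fixes h :: "real \<Rightarrow> real" and \<sigma>' \<sigma> B :: real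
  assumes \<sigma>: "0 < \<sigma>'" "\<sigma>' < \<sigma>" "\<sigma> < 1 / 10"
    and below: "AE x in lborel. - B \<le> \<Omega> x"
    and hilbert: "AE x in lborel. ((\<lambda>y. hilbert_cut y x) \<longlongrightarrow> pi * h x) (at_right 0)"
    and lip_h: "a \<le> b \<Longrightarrow> \<bar>h b - h a\<bar> \<le> pi * \<sigma>' * (b - a)"
begin

definition \<sigma>1 where "\<sigma>1 = (\<sigma> + \<sigma>') / 2"

definition L where "L = pi * (\<sigma>1 + \<sigma>')"

definition c where "c = h (3/4) + pi * \<sigma>1 * (3/4)"

definition \<theta> where "\<theta> x = h x + pi * \<sigma>1 * x - c"

text \<open>Twelve is six sinc factors times the two from halving the gap, which gives 6 \<epsilon>
  = \<pi> (\<sigma> - \<sigma>1).\<close>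

definition \<epsilon> where "\<epsilon> = pi * (\<sigma> - \<sigma>') / 12"

lemma \<sigma>1: "\<sigma>' < \<sigma>1" "\<sigma>1 < \<sigma>"
  using \<sigma> by (auto simp: \<sigma>1_def)

lemma L: "0 \<le> L" "L < pi / 5"
  using \<sigma> \<sigma>1 by (auto simp: L_def)

lemma \<epsilon>: "0 < \<epsilon>" "\<epsilon> \<le> 1" "6 * \<epsilon> = pi * (\<sigma> - \<sigma>1)"
proof -
  show "0 < \<epsilon>" using \<sigma> by (simp add: \<epsilon>_def)
  have "pi * (\<sigma> - \<sigma>') \<le> 4 * 1" using \<sigma> pi_less_4 by (intro mult_mono) auto
  then show "\<epsilon> \<le> 1" by (simp add: \<epsilon>_def)
  show "6 * \<epsilon> = pi * (\<sigma> - \<sigma>1)" by (simp add: \<epsilon>_def \<sigma>1_def field_simps)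
qed

sublocale S: phase \<theta> L
proof
  fix a b :: real
  show "\<theta> a < \<theta> b" if "a < b"
  proof -
    have "pi * \<sigma>' * (b - a) < pi * \<sigma>1 * (b - a)" using that \<sigma>1 by simp
    then show ?thesis using lip_h[of a b] that by (simp add: \<theta>_def algebra_simps abs_le_iff)
  qed
  show "\<theta> b - \<theta> a \<le> L * (b - a)" if "a \<le> b"
    using lip_h[OF that] by (simp add: \<theta>_def L_def algebra_simps abs_le_iff)
qed (rule L)

text \<open>\<open>P = F Q\<close>, and \<open>p\<close> is its boundary function.\<close>

definition P :: "complex \<Rightarrow> complex" where
  "P z = exp ((cauchy_int S.saw z + \<i> * cauchy_int \<Omega> z) / of_real pi)"

definition p :: "real \<Rightarrow> complex" where
  "p x = exp (Complex (S.V0 x - \<Omega> x) (S.saw x - h x))"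

section \<open>Growth and boundary values of the multiplier\<close>

lemma P_holomorphic: "P holomorphic_on {z. Im z > 0}"
  unfolding P_def by (intro holomorphic_intros cauchy_int_holomorphic S.cauchy_int_holomorphic) auto

text \<open>A Poisson average inherits the lower bound - B; this bounds the outer function by exp B
  in the whole half-plane.\<close>

lemma Im_cauchy_int_\<Omega>_ge:
  assumes y: "y > 0"
  shows "Im (cauchy_int \<Omega> (Complex x y)) \<ge> - B * pi"
proof -
  have "(LINT t|lborel. - B * (y / ((t - x)\<^sup>2 + y\<^sup>2))) \<le> (LINT t|lborel. \<Omega> t * (y / ((t - x)\<^sup>2 + y\<^sup>2)))"
  proof (rule integral_mono_AE)
    show "integrable lborel (\<lambda>t. - B * (y / ((t - x)\<^sup>2 + y\<^sup>2)))"
      using has_bochner_integral_Poisson_kernel[OF y, of x]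
      by (intro integrable_mult_right) (simp only: has_bochner_integral_iff)
    show "AE t in lborel. - B * (y / ((t - x)\<^sup>2 + y\<^sup>2)) \<le> \<Omega> t * (y / ((t - x)\<^sup>2 + y\<^sup>2))"
      using below by eventually_elim (rule mult_right_mono, use y in auto)
  qed (rule integrable_Poisson[OF y])
  moreover have "(LINT t|lborel. - B * (y / ((t - x)\<^sup>2 + y\<^sup>2))) = - B * pi"
    using has_bochner_integral_mult_right[OF has_bochner_integral_Poisson_kernel[OF y, of x], of "- B"]
    by (simp only: has_bochner_integral_iff)
  ultimately show ?thesis by (simp add: Im_cauchy_int[OF y])
qed

lemma cmod_P_le:
  assumes "Im z > 0"
  shows "cmod (P z) \<le> exp B * (144 * exp (L + pi / 2)) * (1 + (cmod z)\<^sup>2)\<^sup>2"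
proof -
  obtain x y where z: "z = Complex x y" "y > 0" using assms by (cases z) auto
  have "Re ((cauchy_int S.saw z + \<i> * cauchy_int \<Omega> z) / of_real pi) = S.V x y - Im (cauchy_int \<Omega> z) / pi"
    by (simp add: S.V_def z diff_divide_distrib)
  moreover have "- Im (cauchy_int \<Omega> z) / pi \<le> B"
    using Im_cauchy_int_\<Omega>_ge[OF z(2), of x] by (simp add: z divide_simps)
  ultimately have "cmod (P z) \<le> exp (B + S.V x y)"
    unfolding P_def norm_exp_eq_Re by simp
  also have "\<dots> \<le> exp B * (144 * exp (L + pi / 2) * (1 + x\<^sup>2 + y\<^sup>2)\<^sup>2)"
    unfolding exp_add[of B] by (intro mult_left_mono S.exp_V_le z) auto
  also have "1 + x\<^sup>2 + y\<^sup>2 = 1 + (cmod z)\<^sup>2" by (simp add: z cmod_power2)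
  finally show ?thesis by (simp only: mult.assoc)
qed

text \<open>The sequence is dictated by the oscillation of \<Omega>, which settles both parts of its
  Cauchy integral. The Hilbert limit and the two sawtooth limits hold along any heights decreasing
  to 0, so they follow this sequence too.\<close>

lemma P_boundary:
  obtains Y where "\<And>n. Y n > 0" "\<And>n. Y n \<le> 1" "Y \<longlonglongrightarrow> 0"
    "AE x in lborel. (\<lambda>n. P (Complex x (Y n))) \<longlonglongrightarrow> p x"
proof -
  have "integrable lborel (\<lambda>t. norm (\<Omega> t / (1 + t\<^sup>2)))" using int_w by (rule integrable_norm)
  then have "integrable lborel (\<lambda>t. norm (\<Omega> t) / (1 + t\<^sup>2))" by (simp add: abs_of_pos one_plus_square_pos)
  then obtain Y where Y: "\<And>n. Y n > 0" "\<And>n. Y n \<le> 1" "Y \<longlonglongrightarrow> 0"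
    and osc: "AE x in lborel. (\<lambda>n. Poisson_osc \<Omega> (Y n) x) \<longlonglongrightarrow> 0"
    using AE_Poisson_osc_subseq[OF meas] by metis
  have "AE x in lborel. (\<lambda>n. P (Complex x (Y n))) \<longlonglongrightarrow> p x"
    using osc hilbert S.AE_saw_regular
  proof eventually_elim
    case (elim x)
    then obtain K where K: "\<And>u. \<bar>S.saw (x + u) - S.saw (x - u)\<bar> \<le> K * \<bar>u\<bar>" by blast
    have "(\<lambda>n. ennreal \<bar>Im (cauchy_int \<Omega> (Complex x (Y n))) - pi * \<Omega> x\<bar>) \<longlonglongrightarrow> 0"
      by (rule tendsto_sandwich[OF _ _ tendsto_const elim(1)])
        (intro always_eventually allI zero_le Im_cauchy_int_boundary Y)+
    then have "(\<lambda>n. Im (cauchy_int \<Omega> (Complex x (Y n))) - pi * \<Omega> x) \<longlonglongrightarrow> 0"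
      by (simp add: ennreal_tendsto_0_iff tendsto_rabs_zero_iff)
    then have imO: "(\<lambda>n. Im (cauchy_int \<Omega> (Complex x (Y n)))) \<longlonglongrightarrow> pi * \<Omega> x" by (rule LIM_zero_cancel)
    have "(\<lambda>n. ennreal \<bar>Re (cauchy_int \<Omega> (Complex x (Y n))) + hilbert_cut (Y n) x\<bar>) \<longlonglongrightarrow> 0"
    proof (rule tendsto_sandwich[OF _ _ tendsto_const])
      show "(\<lambda>n. 3 * Poisson_osc \<Omega> (Y n) x + ennreal (2 * pi * Y n * \<bar>\<Omega> x\<bar>)) \<longlonglongrightarrow> 0"
      proof -
        have "(\<lambda>n. 2 * pi * Y n * \<bar>\<Omega> x\<bar>) \<longlonglongrightarrow> 2 * pi * 0 * \<bar>\<Omega> x\<bar>" by (intro tendsto_intros Y)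
        then have "(\<lambda>n. ennreal (2 * pi * Y n * \<bar>\<Omega> x\<bar>)) \<longlonglongrightarrow> ennreal (2 * pi * 0 * \<bar>\<Omega> x\<bar>)"
          by (rule tendsto_ennrealI)
        moreover have "(\<lambda>n. 3 * Poisson_osc \<Omega> (Y n) x) \<longlonglongrightarrow> 3 * 0"
          using elim(1) by (intro ennreal_tendsto_cmult) auto
        ultimately have "(\<lambda>n. 3 * Poisson_osc \<Omega> (Y n) x + ennreal (2 * pi * Y n * \<bar>\<Omega> x\<bar>)) \<longlonglongrightarrow> 3 * 0 + ennreal (2 * pi * 0 * \<bar>\<Omega> x\<bar>)"
          by (intro tendsto_add)
        then show ?thesis by simp
      qed
    qed (intro always_eventually allI zero_le Re_cauchy_int_boundary Y)+
    then have "(\<lambda>n. Re (cauchy_int \<Omega> (Complex x (Y n))) + hilbert_cut (Y n) x) \<longlonglongrightarrow> 0"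
      by (simp add: ennreal_tendsto_0_iff tendsto_rabs_zero_iff)
    moreover have "(\<lambda>n. hilbert_cut (Y n) x) \<longlonglongrightarrow> pi * h x"
    proof (rule filterlim_compose[OF elim(2)])
      have "Y n \<noteq> 0" for n using Y(1)[of n] by simp
      then show "filterlim Y (at_right 0) sequentially" using Y by (simp add: filterlim_at)
    qed
    ultimately have "(\<lambda>n. Re (cauchy_int \<Omega> (Complex x (Y n))) + hilbert_cut (Y n) x - hilbert_cut (Y n) x) \<longlonglongrightarrow> 0 - pi * h x"
      by (intro tendsto_diff)
    then have reO: "(\<lambda>n. Re (cauchy_int \<Omega> (Complex x (Y n)))) \<longlonglongrightarrow> - (pi * h x)" by simp
    have imS: "(\<lambda>n. Im (cauchy_int S.saw (Complex x (Y n)))) \<longlonglongrightarrow> pi * S.saw x"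
      using elim(3) Y by (intro S.Im_cauchy_int_tendsto) auto
    have vS: "(\<lambda>n. S.V x (Y n)) \<longlonglongrightarrow> S.V0 x" by (rule S.V_tendsto_V0[OF K Y])
    have "P (Complex x (Y n)) = exp (Complex (S.V x (Y n) - Im (cauchy_int \<Omega> (Complex x (Y n))) / pi)
        (Im (cauchy_int S.saw (Complex x (Y n))) / pi + Re (cauchy_int \<Omega> (Complex x (Y n))) / pi))" for n
      unfolding P_def by (rule arg_cong[of _ _ exp]) (simp add: complex_eq_iff S.V_def diff_divide_distrib add_divide_distrib)
    moreover have "p x = exp (Complex (S.V0 x - pi * \<Omega> x / pi) (pi * S.saw x / pi + - (pi * h x) / pi))"
      unfolding p_def by (rule arg_cong[of _ _ exp]) (simp add: complex_eq_iff)
    ultimately show ?case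
      by (simp only:) (intro tendsto_exp tendsto_Complex tendsto_intros imO reO imS vS; simp)
  qed
  then show thesis using that Y by blast
qed

lemma measurable_V0 [measurable]: "S.V0 \<in> borel_measurable borel"
proof -
  have [measurable]: "S.saw \<in> borel_measurable borel" by (rule S.meas_s)
  have "(\<lambda>x. cauchy_int S.saw (Complex x 1)) \<in> borel_measurable borel"
    unfolding Complex_eq
    by (rule borel_measurable_continuous_onI,
        rule continuous_on_compose2[OF holomorphic_on_imp_continuous_on[OF S.cauchy_int_holomorphic]])
      (auto intro!: continuous_intros)
  then have [measurable]: "(\<lambda>x. S.V x 1) \<in> borel_measurable borel" unfolding S.V_def by measurable
  have [measurable]: "(\<lambda>x. S.drop_int x 0) \<in> borel_measurable borel"
    unfolding S.drop_int_def S.kern_def by measurable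
  show ?thesis unfolding S.V0_def by measurable
qed

lemma measurable_h [measurable]: "h \<in> borel_measurable borel"
proof -
  have eq: "(\<lambda>x. \<theta> x - pi * \<sigma>1 * x + c) = h" by (auto simp: \<theta>_def)
  have "continuous_on UNIV (\<lambda>x. \<theta> x - pi * \<sigma>1 * x + c)"
    by (intro continuous_at_imp_continuous_on ballI continuous_intros S.isCont_theta)
  then show ?thesis unfolding eq by (rule borel_measurable_continuous_onI)
qed

lemma measurable_p [measurable]: "p \<in> borel_measurable borel"
proof -
  have [measurable]: "S.saw \<in> borel_measurable borel" by (rule S.meas_s)
  show ?thesis unfolding p_def Complex_eq by measurable
qed

lemma measurable_sinc6_real [measurable]: "(\<lambda>x. sinc6 \<epsilon> (of_real x)) \<in> borel_measurable borel"
  unfolding sinc6_of_real by measurable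

text \<open>The factor exp (\<i> \<mu> z) has modulus exp (- \<mu> Im z), which cancels the growth
  exp (6 \<epsilon> Im z) of \<open>sinc6\<close> once \<mu> \<ge> 6 \<epsilon>. Growth (1 +
  |z|^2)^2 against decay (1 + |z|^2)^-3 leaves exactly the decay that the half-plane lemma
  requires.\<close>

lemma boundary_integral_eq_0:
  assumes \<mu>: "\<mu> \<ge> 6 * \<epsilon>"
  shows "(LINT x|lborel. p x * sinc6 \<epsilon> (of_real x) * exp (\<i> * of_real (\<mu> * x))) = 0"
proof -
  define \<Phi> where "\<Phi> z = P z * sinc6 \<epsilon> z * exp (\<i> * of_real \<mu> * z)" for z
  obtain Y where Y: "\<And>n. Y n > 0" "\<And>n. Y n \<le> 1" "Y \<longlonglongrightarrow> 0"
    and lim: "AE x in lborel. (\<lambda>n. P (Complex x (Y n))) \<longlonglongrightarrow> p x"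
    using P_boundary by blast
  define D where "D = exp B * (144 * exp (L + pi / 2))"
  have D: "D > 0" by (simp add: D_def)
  show ?thesis
  proof (rule halfplane_boundary_integral_eq_0[where \<Phi>=\<Phi> and C="D * 8 / \<epsilon> ^ 6" and Y=Y])
    show "\<Phi> holomorphic_on {z. 0 < Im z}"
      unfolding \<Phi>_def by (intro holomorphic_intros P_holomorphic sinc6_holomorphic \<epsilon>)
    show "cmod (\<Phi> z) \<le> D * 8 / \<epsilon> ^ 6 / (1 + (cmod z)\<^sup>2)" if z: "0 < Im z" for z
    proof -
      define q where "q = 1 + (cmod z)\<^sup>2"
      have q: "q > 0" by (simp add: q_def add_pos_nonneg)
      have "cmod (exp (\<i> * of_real \<mu> * z)) = exp (- \<mu> * Im z)" by (simp add: norm_exp_eq_Re)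
      also have "\<dots> \<le> exp (- (6 * \<epsilon> * Im z))" using \<mu> z by (simp add: mult_right_mono)
      finally have E: "cmod (exp (\<i> * of_real \<mu> * z)) \<le> exp (- (6 * \<epsilon> * Im z))" .
      have "\<epsilon> ^ 6 * cmod (sinc6 \<epsilon> z) * q ^ 3 \<le> 8 * exp (6 * \<epsilon> * Im z)"
        using cmod_sinc6_le[OF \<epsilon>(1,2), of z] z by (simp add: q_def)
      then have A: "cmod (sinc6 \<epsilon> z) \<le> 8 * exp (6 * \<epsilon> * Im z) / (\<epsilon> ^ 6 * q ^ 3)"
        using \<epsilon>(1) q by (simp add: pos_le_divide_eq mult_ac)
      have "cmod (\<Phi> z) \<le> (D * q\<^sup>2) * (8 * exp (6 * \<epsilon> * Im z) / (\<epsilon> ^ 6 * q ^ 3)) * exp (- (6 * \<epsilon> * Im z))"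
        unfolding \<Phi>_def norm_mult
        by (intro mult_mono A E) (use cmod_P_le[OF z] D q \<epsilon> in \<open>auto simp: D_def q_def\<close>)
      also have "\<dots> = D * 8 / \<epsilon> ^ 6 / q"
        using q \<epsilon>(1) by (simp add: exp_minus field_simps power2_eq_square power3_eq_cube)
      finally show ?thesis by (simp add: q_def)
    qed
    show "AE x in lborel. (\<lambda>n. \<Phi> (Complex x (Y n))) \<longlonglongrightarrow> p x * sinc6 \<epsilon> (of_real x) * exp (\<i> * of_real (\<mu> * x))"
      \<comment> \<open>The origin is discarded because \<open>sinc6\<close> is not continuous
        there.\<close>
      using lim AE_lborel_singleton[of 0]
    proof eventually_elim
      case (elim x)
      have Z: "(\<lambda>n. Complex x (Y n)) \<longlonglongrightarrow> of_real x"
        using tendsto_Complex[OF tendsto_const Y(3), of x] by (simp add: complex_of_real_def)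
      have "(\<lambda>n. sinc6 \<epsilon> (Complex x (Y n))) \<longlonglongrightarrow> sinc6 \<epsilon> (of_real x)"
        using elim(2) by (intro isCont_tendsto_compose[OF isCont_sinc6 Z] \<epsilon>) auto
      moreover have "(\<lambda>n. exp (\<i> * of_real \<mu> * Complex x (Y n))) \<longlonglongrightarrow> exp (\<i> * of_real \<mu> * of_real x)"
        by (intro tendsto_intros Z)
      ultimately show ?case unfolding \<Phi>_def using elim(1) by (simp add: tendsto_mult mult.assoc)
    qed
  qed (use Y in auto)
qed

text \<open>The cosine is the sign (-1)^jump, written so that it is a real number for an integer
  \<open>jump\<close> of either sign.\<close>

definition g :: "real \<Rightarrow> real" where
  "g x = exp (S.V0 x - \<Omega> x) * cos (pi * of_int (S.jump x))"

text \<open>1152 = 8 * 144 joins the constants of \<open>cmod_sinc6_le\<close> and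
  \<open>exp_V_le\<close>; exp \<pi> bounds exp (L + \<pi>/2).\<close>

definition N where "N = 1152 * exp pi"

text \<open>The product of \<open>sinc6\<close> and \<open>g\<close> is real on the line, so its
  spectrum is symmetric; the last factor shifts it from [- \<sigma>/2, \<sigma>/2] to
  [0, \<sigma>].\<close>

definition f :: "real \<Rightarrow> complex" where
  "f x = of_real (\<epsilon> ^ 6 / N) * sinc6 \<epsilon> (of_real x) * of_real (g x) * exp (- (\<i> * of_real (pi * \<sigma> * x)))"

text \<open>In \<open>saw - h\<close> the function h cancels, leaving the linear phase and a
  multiple of \<pi>, which is only a sign.\<close>

lemma p_eq_g: "p x = of_real (g x) * exp (\<i> * of_real (pi * \<sigma>1 * x - c))"
proof -
  have "Complex (S.V0 x - \<Omega> x) (S.saw x - h x)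
    = of_real (S.V0 x - \<Omega> x) + \<i> * of_real (- (pi * of_int (S.jump x))) + \<i> * of_real (pi * \<sigma>1 * x - c)"
    by (simp add: complex_eq_iff S.saw_def \<theta>_def)
  moreover have "exp (\<i> * of_real (- (pi * of_int (S.jump x)))) = of_real (cos (pi * of_int (S.jump x)))"
    by (simp add: complex_eq_iff Re_exp Im_exp)
  ultimately show ?thesis
    unfolding p_def g_def by (simp only: exp_add exp_of_real[symmetric] of_real_mult)
qed

lemma abs_g: "\<bar>g x\<bar> = exp (S.V0 x - \<Omega> x)"
proof -
  have "(cos (pi * of_int (S.jump x)))\<^sup>2 = 1"
    using sin_cos_squared_add2[of "pi * of_int (S.jump x)"] by simp
  then have "\<bar>cos (pi * of_int (S.jump x))\<bar> = 1" by (metis abs_1 power2_eq_1_iff abs_minus_cancel)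
  then show ?thesis by (simp add: g_def abs_mult)
qed

lemma measurable_f [measurable]: "f \<in> borel_measurable borel"
proof -
  have "g = (\<lambda>x. Re (p x * exp (- (\<i> * of_real (pi * \<sigma>1 * x - c)))))"
    by (rule ext) (simp add: p_eq_g mult.assoc flip: exp_add)
  then have [measurable]: "g \<in> borel_measurable borel" by simp
  show ?thesis unfolding f_def by measurable
qed

lemma cmod_f: "cmod (f x) = \<epsilon> ^ 6 / N * cmod (sinc6 \<epsilon> (of_real x)) * (exp (S.V0 x) * exp (- \<Omega> x))"
  unfolding f_def norm_mult norm_of_real using \<epsilon>(1) by (simp add: abs_g norm_exp_eq_Re N_def flip: exp_add)

text \<open>The interior bound on exp V passes to the limit at height 0. The spare factor 1 / (1 +
  x^2), left from three powers against two, gives integrability besides the bound by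
  \<omega>.\<close>

lemma AE_cmod_f_le: "AE x in lborel. cmod (f x) \<le> exp (- \<Omega> x) / (1 + x\<^sup>2)"
  using S.AE_saw_regular
proof eventually_elim
  case (elim x)
  then obtain K where K: "\<And>u. \<bar>S.saw (x + u) - S.saw (x - u)\<bar> \<le> K * \<bar>u\<bar>" by blast
  define y where "y n = 1 / real (Suc n)" for n
  have y: "y n > 0" "y n \<le> 1" "y \<longlonglongrightarrow> 0" for n
    using LIMSEQ_inverse_real_of_nat by (auto simp: y_def[abs_def] inverse_eq_divide)
  define q where "q = 1 + x\<^sup>2"
  have q: "q > 0" by (simp add: q_def add_pos_nonneg)
  have "exp (S.V0 x) \<le> 144 * exp (L + pi / 2) * (1 + x\<^sup>2 + 0\<^sup>2)\<^sup>2"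
  proof (rule LIMSEQ_le)
    show "(\<lambda>n. exp (S.V x (y n))) \<longlonglongrightarrow> exp (S.V0 x)"
      by (intro tendsto_exp S.V_tendsto_V0[OF K y])
    show "(\<lambda>n. 144 * exp (L + pi / 2) * (1 + x\<^sup>2 + (y n)\<^sup>2)\<^sup>2) \<longlonglongrightarrow> 144 * exp (L + pi / 2) * (1 + x\<^sup>2 + 0\<^sup>2)\<^sup>2"
      by (intro tendsto_intros y)
    show "\<exists>n0. \<forall>n\<ge>n0. exp (S.V x (y n)) \<le> 144 * exp (L + pi / 2) * (1 + x\<^sup>2 + (y n)\<^sup>2)\<^sup>2"
      using S.exp_V_le y by blast
  qed
  also have "\<dots> \<le> 144 * exp pi * q\<^sup>2"
    unfolding q_def using L pi_gt_zero by (intro mult_mono) auto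
  finally have V: "exp (S.V0 x) \<le> 144 * exp pi * q\<^sup>2" .
  have A: "\<epsilon> ^ 6 * cmod (sinc6 \<epsilon> (of_real x)) \<le> 8 / q ^ 3"
    using cmod_sinc6_le[OF \<epsilon>(1,2), of "of_real x"] q by (simp add: q_def pos_le_divide_eq)
  have "\<epsilon> ^ 6 * cmod (sinc6 \<epsilon> (of_real x)) * exp (S.V0 x) \<le> 8 / q ^ 3 * (144 * exp pi * q\<^sup>2)"
    using \<epsilon>(1) q by (intro mult_mono A V) auto
  also have "\<dots> = N / q" using q by (simp add: N_def power2_eq_square power3_eq_cube)
  finally have "\<epsilon> ^ 6 * cmod (sinc6 \<epsilon> (of_real x)) * exp (S.V0 x) / N * exp (- \<Omega> x) \<le> N / q / N * exp (- \<Omega> x)"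
    by (intro mult_right_mono divide_right_mono) (auto simp: N_def)
  also have "N / q / N * exp (- \<Omega> x) = exp (- \<Omega> x) / q" using q by (simp add: N_def)
  finally show ?case unfolding cmod_f q_def by (simp add: mult_ac)
qed

text \<open>On this window the sinc power is at least 1/64 and Q at least exp (- \<pi>); the
  remaining \<epsilon>^6 is (\<pi>/12)^6 (\<sigma> - \<sigma>')^6.\<close>

lemma cmod_f_ge:
  assumes x: "1/2 < x" "x < 1"
  shows "cmod (f x) \<ge> (pi / 12) ^ 6 / (64 * exp pi * N) * (\<sigma> - \<sigma>') ^ 6 * exp (- \<Omega> x)"
proof -
  have V: "exp (- pi) \<le> exp (S.V0 x)"
    using S.V0_ge_window[OF L(2) _ x] by (simp add: \<theta>_def c_def)
  have A: "1 / 64 \<le> cmod (sinc6 \<epsilon> (of_real x))"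
    using x by (intro cmod_sinc6_ge \<epsilon>) auto
  have "\<epsilon> ^ 6 / N * (1 / 64) * (exp (- pi) * exp (- \<Omega> x)) \<le> cmod (f x)"
    unfolding cmod_f using \<epsilon>(1) V A by (intro mult_mono order_refl) (auto simp: N_def)
  moreover have "\<epsilon> ^ 6 / N * (1 / 64) * (exp (- pi) * exp (- \<Omega> x))
     = (pi / 12) ^ 6 / (64 * exp pi * N) * (\<sigma> - \<sigma>') ^ 6 * exp (- \<Omega> x)"
  proof -
    have "\<epsilon> = pi / 12 * (\<sigma> - \<sigma>')" by (simp add: \<epsilon>_def)
    then have "\<epsilon> ^ 6 = (pi / 12) ^ 6 * (\<sigma> - \<sigma>') ^ 6" by (simp only: power_mult_distrib)
    moreover have "a * b / n * (1 / 64) * (exp (- pi) * e) = a / (64 * exp pi * n) * b * e" for a b n e :: real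
      by (simp add: exp_minus field_simps)
    ultimately show ?thesis by (simp only:)
  qed
  ultimately show ?thesis by simp
qed

lemma f_integrable: "integrable lborel f"
proof (rule integrable_Cauchy_bound[of _ "exp B"])
  show "AE x in lborel. cmod (f x) \<le> exp B / (1 + x\<^sup>2)"
    using AE_cmod_f_le below
  proof eventually_elim
    case (elim x)
    have "exp (- \<Omega> x) / (1 + x\<^sup>2) \<le> exp B / (1 + x\<^sup>2)"
      using elim(2) by (intro divide_right_mono) auto
    then show ?case using elim(1) by linarith
  qed
qed measurable

section \<open>The inverse Fourier transform and its support\<close>

definition \<psi> :: "real \<Rightarrow> complex" where
  "\<psi> \<xi> = (LINT t|lborel. f t * exp (2 * of_real pi * \<i> * of_real (t * \<xi>)))"

text \<open>Written through \<open>p\<close>, the integrand carries the frequency 2 \<pi> \<xi> -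
  \<pi> \<sigma> - \<pi> \<sigma>1, which reaches the threshold 6 \<epsilon> exactly at \<xi> =
  \<sigma>.\<close>

lemma \<psi>_eq_0_right:
  assumes "\<xi> \<ge> \<sigma>"
  shows "\<psi> \<xi> = 0"
proof -
  define \<mu> where "\<mu> = 2 * pi * \<xi> - pi * \<sigma> - pi * \<sigma>1"
  have "pi * \<sigma> \<le> pi * \<xi>" using assms by simp
  then have \<mu>: "\<mu> \<ge> 6 * \<epsilon>" unfolding \<epsilon>(3) \<mu>_def by (simp add: right_diff_distrib)
  have eq: "f t * exp (2 * of_real pi * \<i> * of_real (t * \<xi>))
     = of_real (\<epsilon> ^ 6 / N) * exp (\<i> * of_real c) * (p t * sinc6 \<epsilon> (of_real t) * exp (\<i> * of_real (\<mu> * t)))" for t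
  proof -
    have "- (\<i> * of_real (pi * \<sigma> * t)) + 2 * of_real pi * \<i> * of_real (t * \<xi>)
      = \<i> * of_real c + (\<i> * of_real (pi * \<sigma>1 * t - c) + \<i> * of_real (\<mu> * t))"
      by (simp add: complex_eq_iff \<mu>_def algebra_simps)
    then have "exp (- (\<i> * of_real (pi * \<sigma> * t))) * exp (2 * of_real pi * \<i> * of_real (t * \<xi>))
      = exp (\<i> * of_real c) * (exp (\<i> * of_real (pi * \<sigma>1 * t - c)) * exp (\<i> * of_real (\<mu> * t)))"
      by (simp only: exp_add[symmetric])
    then show ?thesis unfolding f_def p_eq_g by (rule mult_rearrange)
  qed
  show ?thesis
    unfolding \<psi>_def eq integral_mult_right_zero boundary_integral_eq_0[OF \<mu>] by simp
qed

text \<open>Here the frequency has the wrong sign for the upper half-plane. But \<open>g\<close> and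
  \<open>sinc6\<close> are real on the line, so the integrand is the conjugate of one of the
  previous kind, again with threshold 6 \<epsilon>, now at \<xi> = 0.\<close>

lemma \<psi>_eq_0_left:
  assumes "\<xi> \<le> 0"
  shows "\<psi> \<xi> = 0"
proof -
  define \<mu> where "\<mu> = pi * \<sigma> - pi * \<sigma>1 - 2 * pi * \<xi>"
  have "pi * \<xi> \<le> 0" using assms by (simp add: mult_nonneg_nonpos)
  then have \<mu>: "\<mu> \<ge> 6 * \<epsilon>" unfolding \<epsilon>(3) \<mu>_def by (simp add: right_diff_distrib)
  have eq: "f t * exp (2 * of_real pi * \<i> * of_real (t * \<xi>))
     = cnj (of_real (\<epsilon> ^ 6 / N) * exp (\<i> * of_real c) * (p t * sinc6 \<epsilon> (of_real t) * exp (\<i> * of_real (\<mu> * t))))" for t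
  proof -
    have "- (\<i> * of_real (pi * \<sigma> * t)) + 2 * of_real pi * \<i> * of_real (t * \<xi>)
      = - (\<i> * of_real c) + (- (\<i> * of_real (pi * \<sigma>1 * t - c)) + - (\<i> * of_real (\<mu> * t)))"
      by (simp add: complex_eq_iff \<mu>_def algebra_simps)
    then have "exp (- (\<i> * of_real (pi * \<sigma> * t))) * exp (2 * of_real pi * \<i> * of_real (t * \<xi>))
      = exp (- (\<i> * of_real c)) * (exp (- (\<i> * of_real (pi * \<sigma>1 * t - c))) * exp (- (\<i> * of_real (\<mu> * t))))"
      by (simp only: exp_add[symmetric])
    then have "f t * exp (2 * of_real pi * \<i> * of_real (t * \<xi>)) = of_real (\<epsilon> ^ 6 / N) * exp (- (\<i> * of_real c))
        * (of_real (g t) * exp (- (\<i> * of_real (pi * \<sigma>1 * t - c))) * sinc6 \<epsilon> (of_real t) * exp (- (\<i> * of_real (\<mu> * t))))"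
      unfolding f_def by (rule mult_rearrange)
    moreover have "cnj (exp (\<i> * of_real r)) = exp (- (\<i> * of_real r))" for r
      by (simp add: exp_cnj)
    ultimately show ?thesis unfolding p_eq_g sinc6_of_real
      by (simp only: complex_cnj_mult complex_cnj_complex_of_real)
  qed
  show ?thesis
    unfolding \<psi>_def eq Bochner_Integration.integral_cnj integral_mult_right_zero boundary_integral_eq_0[OF \<mu>]
    by (simp only: mult_zero_right complex_cnj_zero)
qed

lemma measurable_\<psi> [measurable]: "\<psi> \<in> borel_measurable borel"
  unfolding \<psi>_def by measurable

text \<open>A bounded function on a bounded interval lies in L1, as Fourier inversion requires, and
  in L2.\<close>

lemma \<psi>_bounded:
  obtains M where "M \<ge> 0" "\<And>\<xi>. cmod (\<psi> \<xi>) \<le> M * indicator {0..\<sigma>} \<xi>"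
proof
  show "(LINT t|lborel. cmod (f t)) \<ge> 0" by simp
  show "cmod (\<psi> \<xi>) \<le> (LINT t|lborel. cmod (f t)) * indicator {0..\<sigma>} \<xi>" for \<xi>
  proof (cases "\<xi> \<in> {0..\<sigma>}")
    case True
    have "cmod (\<psi> \<xi>) \<le> (LINT t|lborel. cmod (f t * exp (2 * of_real pi * \<i> * of_real (t * \<xi>))))"
      unfolding \<psi>_def by (rule integral_norm_bound)
    then show ?thesis using True by (simp add: norm_mult norm_exp_eq_Re)
  qed (use \<psi>_eq_0_left \<psi>_eq_0_right in auto)
qed

lemma \<psi>_integrable: "integrable lborel \<psi>" "integrable lborel (\<lambda>x. (cmod (\<psi> x))\<^sup>2)"
proof -
  obtain M where M: "M \<ge> 0" "\<And>\<xi>. cmod (\<psi> \<xi>) \<le> M * indicator {0..\<sigma>} \<xi>" using \<psi>_bounded by blast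
  have I: "integrable lborel (\<lambda>\<xi>. K * indicator {0..\<sigma>} \<xi> :: real)" for K
    by (intro integrable_mult_right integrable_real_indicator) (auto simp: emeasure_lborel_Icc_eq)
  show "integrable lborel \<psi>"
    by (rule Bochner_Integration.integrable_bound[OF I[of M]])
      (use M in \<open>auto intro!: AE_I2 simp: order_trans[OF M(2) abs_ge_self]\<close>)
  have "(cmod (\<psi> \<xi>))\<^sup>2 \<le> M\<^sup>2 * indicator {0..\<sigma>} \<xi>" for \<xi>
    using power_mono[OF M(2)[of \<xi>], of 2] by (cases "\<xi> \<in> {0..\<sigma>}") (simp_all add: power_mult_distrib)
  then show "integrable lborel (\<lambda>x. (cmod (\<psi> x))\<^sup>2)"
    by (intro Bochner_Integration.integrable_bound[OF I[of "M\<^sup>2"]]) auto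
qed

lemma fourier_\<psi>: "AE x in lborel. fourier \<psi> x = f x"
proof -
  have eq: "fourier \<psi> x = (LINT \<xi>|lborel. exp (- 2 * of_real pi * \<i> * of_real (x * \<xi>)) * \<psi> \<xi>)" for x
    unfolding fourier_def mult.commute[of _ x] by (rule integral_completion) measurable
  show ?thesis
    unfolding eq using fourier_inversion_AE[OF f_integrable] \<psi>_integrable(1)
    unfolding \<psi>_def[abs_def] by simp
qed

end

section \<open>Transfer from Lebesgue measurable data to Borel representatives\<close>

theorem theorem2p2:
  shows "\<exists>C::real. C > 0 \<and>
    (\<forall>(\<sigma>'::real) (\<sigma>::real) (\<omega>::real \<Rightarrow> real) (h::real \<Rightarrow> real).
       0 < \<sigma>' \<and> \<sigma>' < \<sigma> \<and> \<sigma> < 1 / 10 \<and>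
       (\<forall>x. \<omega> x > 0) \<and> ess_bounded \<omega> \<and> log_integral \<omega> > - \<infinity> \<and>
       is_modified_hilbert (\<lambda>x. - ln (\<omega> x)) h \<and>
       (\<forall>x. h differentiable (at x)) \<and> ess_bounded (deriv h) \<and>
       Linf_norm (deriv h) \<le> ereal (pi * \<sigma>')
       \<longrightarrow>
       (\<exists>\<psi>::real \<Rightarrow> complex. L2_fun \<psi> \<and>
          ess_support \<psi> \<subseteq> {0..\<sigma>} \<and>
          (AE x in lebesgue. norm (fourier \<psi> x) \<le> \<omega> x) \<and>
          ((AE x in lebesgue. x \<in> {-1<..<-1/2} \<longrightarrow>
              norm (fourier \<psi> x) \<ge> C * (\<sigma> - \<sigma>') ^ 6 * \<omega> x) \<or>
           (AE x in lebesgue. x \<in> {1/2<..<1} \<longrightarrow>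
              norm (fourier \<psi> x) \<ge> C * (\<sigma> - \<sigma>') ^ 6 * \<omega> x))))"
proof (intro exI[of _ "(pi / 12) ^ 6 / (64 * exp pi * (1152 * exp pi))"] conjI allI impI)
  \<comment> \<open>The constant of \<open>cmod_f_ge\<close> with \<open>N\<close> written out,
    since it must be named before \<sigma> and \<omega> are.\<close>
  let ?C = "(pi / 12) ^ 6 / (64 * exp pi * (1152 * exp pi))"
  show "?C > 0" by simp
  fix \<sigma>' \<sigma> :: real and \<omega> h :: "real \<Rightarrow> real"
  assume "0 < \<sigma>' \<and> \<sigma>' < \<sigma> \<and> \<sigma> < 1 / 10 \<and>
       (\<forall>x. \<omega> x > 0) \<and> ess_bounded \<omega> \<and> log_integral \<omega> > - \<infinity> \<and>
       is_modified_hilbert (\<lambda>x. - ln (\<omega> x)) h \<and>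
       (\<forall>x. h differentiable (at x)) \<and> ess_bounded (deriv h) \<and>
       Linf_norm (deriv h) \<le> ereal (pi * \<sigma>')"
  then have \<sigma>: "0 < \<sigma>'" "\<sigma>' < \<sigma>" "\<sigma> < 1 / 10"
    and \<omega>: "\<And>x. \<omega> x > 0" and bdd: "ess_bounded \<omega>"
    and hil: "is_modified_hilbert (\<lambda>x. - ln (\<omega> x)) h"
    and diff: "\<And>x. h differentiable (at x)"
    and dm: "deriv h \<in> borel_measurable lebesgue" and db: "Linf_norm (deriv h) \<le> ereal (pi * \<sigma>')"
    by (auto simp: ess_bounded_def)
  have \<omega>m [measurable]: "\<omega> \<in> borel_measurable lebesgue" using bdd by (simp add: ess_bounded_def)
  have "(\<lambda>x. - ln (\<omega> x)) \<in> borel_measurable lebesgue" by measurable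
  \<comment> \<open>\<omega> is only Lebesgue measurable, whereas the analysis above runs over Borel
    functions; a representative equal a.e. bridges the two.\<close>
  then obtain \<Omega> where \<Omega>m [measurable]: "\<Omega> \<in> borel_measurable borel"
    and \<Omega>eq: "AE x in lborel. - ln (\<omega> x) = \<Omega> x"
    using completion_ex_borel_measurable_real[of "\<lambda>x. - ln (\<omega> x)" lborel] by auto
  have \<Omega>eqL: "AE x in lebesgue. - ln (\<omega> x) = \<Omega> x" using \<Omega>eq by (rule AE_completion)
  have exp\<Omega>: "AE x in lborel. exp (- \<Omega> x) = \<omega> x"
    using \<Omega>eq
  proof eventually_elim
    case (elim x)
    have "exp (ln (\<omega> x)) = \<omega> x" using \<omega>[of x] by simp
    then show ?case by (simp flip: elim)
  qed
  obtain B where B: "AE x in lborel. - B \<le> \<Omega> x"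
  proof -
    obtain M where "Linf_norm \<omega> \<le> ereal M"
      using bdd by (cases "Linf_norm \<omega>") (auto simp: ess_bounded_def)
    then have "AE x in lebesgue. \<bar>\<omega> x\<bar> \<le> M" by (rule AE_le_of_Linf_norm[OF \<omega>m])
    then have "AE x in lborel. \<bar>\<omega> x\<bar> \<le> M" by (simp add: AE_completion_iff)
    then have "AE x in lborel. - ln M \<le> \<Omega> x"
      using \<Omega>eq
    proof eventually_elim
      case (elim x)
      then have "ln (\<omega> x) \<le> ln M" using \<omega>[of x] by simp
      then show ?case using elim(2) by simp
    qed
    then show thesis by (rule that)
  qed
  have int: "integrable lborel (\<lambda>t. \<Omega> t / (1 + t\<^sup>2))"
  proof -
    have "integrable lebesgue (\<lambda>x. - ln (\<omega> x) / (1 + x\<^sup>2))"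
      using hil by (simp add: is_modified_hilbert_def)
    then have "integrable lebesgue (\<lambda>x. \<Omega> x / (1 + x\<^sup>2))"
    proof (rule integrable_cong_AE_imp)
      show "(\<lambda>x. \<Omega> x / (1 + x\<^sup>2)) \<in> borel_measurable lebesgue"
        by (intro measurable_completion) measurable
      show "AE x in lebesgue. - ln (\<omega> x) / (1 + x\<^sup>2) = \<Omega> x / (1 + x\<^sup>2)"
        using \<Omega>eqL by eventually_elim simp
    qed
    then show ?thesis by (subst (asm) integrable_completion) auto
  qed
  interpret W: log_weight \<Omega> by standard (use int in auto)
  \<comment> \<open>Neither the change on a null set nor the passage from \<open>lebesgue\<close> to
    \<open>lborel\<close> alters the truncated integrals, so the identity holds for every x and
    y.\<close>
  have trunc: "hilbert_trunc (\<lambda>x. - ln (\<omega> x)) y x = W.hilbert_cut y x / pi" for y x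
  proof -
    have "(LINT t:{t. \<bar>x - t\<bar> > y}|lebesgue. - ln (\<omega> t) * (1 / (x - t) + t / (t\<^sup>2 + 1)))
      = (LINT t|lebesgue. indicator {t. \<bar>x - t\<bar> > y} t * (\<Omega> t * (1 / (x - t) + t / (t\<^sup>2 + 1))))"
      unfolding set_lebesgue_integral_def real_scaleR_def
    proof (rule integral_cong_AE)
      have k: "(\<lambda>t. indicator {t. \<bar>x - t\<bar> > y} t * (1 / (x - t) + t / (t\<^sup>2 + 1))) \<in> borel_measurable lebesgue"
        by (intro measurable_completion) measurable
      have "(\<lambda>t. - ln (\<omega> t) * (indicator {t. \<bar>x - t\<bar> > y} t * (1 / (x - t) + t / (t\<^sup>2 + 1)))) \<in> borel_measurable lebesgue"
        by (intro borel_measurable_times k) measurable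
      then show "(\<lambda>t. indicator {t. \<bar>x - t\<bar> > y} t * (- ln (\<omega> t) * (1 / (x - t) + t / (t\<^sup>2 + 1)))) \<in> borel_measurable lebesgue"
        by (simp only: mult.left_commute)
      show "(\<lambda>t. indicator {t. \<bar>x - t\<bar> > y} t * (\<Omega> t * (1 / (x - t) + t / (t\<^sup>2 + 1)))) \<in> borel_measurable lebesgue"
        by (intro measurable_completion) measurable
      show "AE t in lebesgue. indicator {t. \<bar>x - t\<bar> > y} t * (- ln (\<omega> t) * (1 / (x - t) + t / (t\<^sup>2 + 1)))
          = indicator {t. \<bar>x - t\<bar> > y} t * (\<Omega> t * (1 / (x - t) + t / (t\<^sup>2 + 1)))"
        using \<Omega>eqL by eventually_elim simp
    qed
    also have "\<dots> = W.hilbert_cut y x"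
      unfolding W.hilbert_cut_def by (rule integral_completion) measurable
    finally show ?thesis by (simp add: hilbert_trunc_def)
  qed
  have "AE x in lborel. ((\<lambda>y. W.hilbert_cut y x) \<longlongrightarrow> pi * h x) (at_right 0)"
  proof -
    have "AE x in lborel. ((\<lambda>y. hilbert_trunc (\<lambda>x. - ln (\<omega> x)) y x) \<longlongrightarrow> h x) (at_right 0)"
      using hil by (simp add: is_modified_hilbert_def AE_completion_iff)
    then show ?thesis
    proof eventually_elim
      case (elim x)
      from tendsto_mult_left[OF this, of pi] show ?case by (simp add: trunc)
    qed
  qed
  moreover have "\<bar>h b - h a\<bar> \<le> pi * \<sigma>' * (b - a)" if "a \<le> b" for a b
    using \<sigma> by (intro lipschitz_of_AE_deriv_bound diff AE_le_of_Linf_norm dm db that) auto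
  ultimately interpret A: admissible_weight \<Omega> h \<sigma>' \<sigma> B
    by unfold_locales (use \<sigma> B in auto)
  have F: "AE x in lborel. cmod (fourier A.\<psi> x) \<le> \<omega> x"
    using A.fourier_\<psi> A.AE_cmod_f_le exp\<Omega>
  proof eventually_elim
    case (elim x)
    have "exp (- \<Omega> x) / (1 + x\<^sup>2) \<le> exp (- \<Omega> x) / 1"
      by (rule divide_left_mono) (auto simp: add_pos_nonneg)
    then show ?case using elim by simp
  qed
  \<comment> \<open>It is the interval (1/2, 1) that is obtained, because \<theta> was normalised to
    vanish at its midpoint.\<close>
  have G: "AE x in lborel. x \<in> {1/2<..<1} \<longrightarrow> cmod (fourier A.\<psi> x) \<ge> ?C * (\<sigma> - \<sigma>') ^ 6 * \<omega> x"
    using A.fourier_\<psi> exp\<Omega>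
  proof eventually_elim
    case (elim x)
    then show ?case using A.cmod_f_ge[of x] by (auto simp: A.N_def)
  qed
  have "L2_fun A.\<psi>"
    unfolding L2_fun_def
  proof
    show "A.\<psi> \<in> borel_measurable lebesgue" by (intro measurable_completion) simp
    show "integrable lebesgue (\<lambda>x. (cmod (A.\<psi> x))\<^sup>2)"
      using A.\<psi>_integrable(2) by (subst integrable_completion) auto
  qed
  moreover have "ess_support A.\<psi> \<subseteq> {0..\<sigma>}"
  proof -
    have "open (- {0..\<sigma>})" "AE x in lebesgue. x \<in> - {0..\<sigma>} \<longrightarrow> A.\<psi> x = 0"
      using A.\<psi>_eq_0_left A.\<psi>_eq_0_right by auto
    then show ?thesis unfolding ess_support_def by blast
  qed
  ultimately show "\<exists>\<psi>::real \<Rightarrow> complex. L2_fun \<psi> \<and>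
          ess_support \<psi> \<subseteq> {0..\<sigma>} \<and>
          (AE x in lebesgue. norm (fourier \<psi> x) \<le> \<omega> x) \<and>
          ((AE x in lebesgue. x \<in> {-1<..<-1/2} \<longrightarrow>
              norm (fourier \<psi> x) \<ge> ?C * (\<sigma> - \<sigma>') ^ 6 * \<omega> x) \<or>
           (AE x in lebesgue. x \<in> {1/2<..<1} \<longrightarrow>
              norm (fourier \<psi> x) \<ge> ?C * (\<sigma> - \<sigma>') ^ 6 * \<omega> x))"
    using AE_completion[OF F] AE_completion[OF G] by blast
qed

end
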